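(* Let $(\Lambda_A,E_A)$ be a Jacobi structure on an affine bundle $\pi:A\to M$ of rank $n>0$. Then the following are equivalent: (i) $(\Lambda_A,E_A)$ is affine-homogeneous; (ii) $E_A$ is affine-invariant and $\Lambda_A$ is affine; (iii) $(\Lambda_A,E_A)$ is strongly-affine; (iv) $(\Lambda_A,E_A)$ is affine and basic functions form an ideal in the algebra of affine functions with respect to the corresponding Jacobi bracket; (v) $(\Lambda_A,E_A)$ is affine and there exists $\bar X_0\in\Gamma(\hat A)$ such that $E_A(a)=-\bar X_0(\tilde a)\circ\pi$ for all affine functions $a:A\to\mathbb{R}$, where $\tilde a\in\Gamma(A^+)$ is the section of $A^+$ associated with the affine function $a$.
   Context: Everything is smooth. The Schouten–Nijenhuis bracket $[\cdot,\cdot]_{SN}$ is taken in the graded Lie algebra convention: for $P$ a $(p+1)$-vector and $Q$ a $(q+1)$-vector field, $[P,Q]_{SN}=-(-1)^{pq}[Q,P]_{SN}$, $[P,Q\wedge R]_{SN}=[P,Q]_{SN}\wedge R+(-1)^{p(q+1)}Q\wedge[P,R]_{SN}$, it is the Lie bracket on vector fields, and $[X,f]_{SN}=X(f)$. A Jacobi structure on a manifold $N$ is a pair $(\Lambda,E)$ of a bivector field and a vector field with $[\Lambda,\Lambda]_{SN}=-2E\wedge\Lambda$, $[E,\Lambda]_{SN}=0$; equivalently the Jacobi bracket $\{f,g\}_{(\Lambda,E)}=\Lambda(df,dg)+fE(g)-gE(f)$ satisfies the Jacobi identity. The hamiltonian vector field of $f$ is $X_f^{(\Lambda,E)}=\#_\Lambda(df)+fE$,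 where $\#_\Lambda(\alpha)(\beta)=\Lambda(\alpha,\beta)$. An affine bundle $\pi:A\to M$ is a locally trivial bundle whose fibres $A_p$ are affine spaces modelled on the fibres of a vector bundle $V(A)\to M$, with affine transition maps. A function on $A$ is affine if it is smooth and affine on fibres, and basic if it is of the form $f_M\circ\pi$. $A^+=\bigcup_p\mathrm{Aff}(A_p,\mathbb{R})$ is the vector bundle whose sections $\tilde a$ correspond to affine functions $a$ on $A$; $\hat A=(A^+)^*$. A Jacobi structure on $A$ is affine if the Jacobi bracket of two affine functions is affine. A bivector field $\Lambda_A$ on $A$ is affine if $\Lambda_A(da,db)$ is an affine function for all affine $a,b$. An affine Jacobi structure is strongly-affine if for every affine function $a$ the hamiltonian vector field $X_a^{(\Lambda_A,E_A)}$ is affine, i.e. maps affine functions to affine functions. First-order polydifferential operators on $A$: let $\mathcal{T}A=TA\oplus\mathbb{R}$ and let $I$ be the generating section of $\mathbb{R}$ (identity operator on functions). Every element of $\Gamma(\wedge^k\mathcal{T}A)$ is uniquely $P_1+I\wedge P_2$ with $P_1$ a $k$-vector and $P_2$ a $(k-1)$-vector field on $A$. The Schouten–Jacobi bracket is $$[P_1+I\wedge P_2,Q_1+I\wedge Q_2]_1=[P_1,Q_1]_{SN}+(-1)^pI\wedge[P_1,Q_2]_{SN}+I\wedge[P_2,Q_1]_{SN}+pP_1\wedge Q_2-(-1)^pqP_2\wedge Q_1+(p-q)I\wedge P_2\wedge Q_2,$$ where $P_1$ is a $(p+1)$-vector, $P_2$ a $p$-vector, $Q_1$ a $(q+1)$-vector,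 $Q_2$ a $q$-vector field. Sections $X$ of $V(A)$ lift vertically to vector fields $X^v$ on $A$ (generators of fibre translations by $X$), and functions $f$ on $M$ lift to $f^v=f\circ\pi$, regarded as degree-zero elements of $\Gamma(\wedge\mathcal{T}A)$. $\mathcal{V}_1(A)$ is the vector space spanned by all these $X^v$ and $f^v$. A first-order polydifferential operator $F$ on $A$ is affine-invariant if $[D,F]_1=0$ for all $D\in\mathcal{V}_1(A)$. The Jacobi structure $(\Lambda_A,E_A)$ is affine-homogeneous if $[D_1,[D_2,\Lambda_A+I\wedge E_A]_1]_1=0$ for all $D_1,D_2\in\mathcal{V}_1(A)$. *)

theory Defs
  imports "HOL-Analysis.Analysis"
begin

text \<open>Model spaces: finite-dimensional real inner product spaces. These are the axioms of the
  class \<open>euclidean_space\<close> without the requirement that the orthonormal basis be nonempty, so that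
  zero-dimensional manifolds (for instance an affine bundle over a point) are covered.\<close>

class fin_euclidean = real_inner +
  assumes ex_finite_orthonormal_basis:
    "\<exists>B. finite B \<and> (\<forall>u\<in>B. \<forall>v\<in>B. inner u v = (if u = v then 1 else 0)) \<and>
         (\<forall>x. (\<forall>u\<in>B. inner x u = 0) \<longleftrightarrow> x = 0)"

subclass (in euclidean_space) fin_euclidean
proof
  show "\<exists>B. finite B \<and> (\<forall>u\<in>B. \<forall>v\<in>B. inner u v = (if u = v then 1 else 0)) \<and>
         (\<forall>x. (\<forall>u\<in>B. inner x u = 0) \<longleftrightarrow> x = 0)"
    by (intro exI[of _ Basis] conjI ballI allI finite_Basis inner_Basis euclidean_all_zero_iff)
qed

instance prod :: (fin_euclidean, fin_euclidean) fin_euclidean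
proof
  obtain B :: "'a set" where B: "finite B"
      "\<forall>u\<in>B. \<forall>v\<in>B. inner u v = (if u = v then 1 else 0)"
      "\<forall>x. (\<forall>u\<in>B. inner x u = 0) \<longleftrightarrow> x = 0"
    using ex_finite_orthonormal_basis by (elim exE conjE)
  obtain C :: "'b set" where C: "finite C"
      "\<forall>u\<in>C. \<forall>v\<in>C. inner u v = (if u = v then 1 else 0)"
      "\<forall>x. (\<forall>u\<in>C. inner x u = 0) \<longleftrightarrow> x = 0"
    using ex_finite_orthonormal_basis by (elim exE conjE)
  let ?D = "(\<lambda>u. (u, 0::'b)) ` B \<union> (\<lambda>v. (0::'a, v)) ` C"
  have zB: "b \<noteq> 0" if "b \<in> B" for b
    using B(2)[rule_format, OF that that] by auto
  have zC: "c \<noteq> 0" if "c \<in> C" for c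
    using C(2)[rule_format, OF that that] by auto
  have "inner u v = (if u = v then 1 else 0)" if uv: "u \<in> ?D" "v \<in> ?D" for u v
  proof -
    consider b b' where "b \<in> B" "b' \<in> B" "u = (b, 0)" "v = (b', 0)"
      | b c where "b \<in> B" "c \<in> C" "u = (b, 0)" "v = (0, c)"
      | b c where "b \<in> B" "c \<in> C" "v = (b, 0)" "u = (0, c)"
      | c c' where "c \<in> C" "c' \<in> C" "u = (0, c)" "v = (0, c')"
      using uv by blast
    then show ?thesis
      using zB zC by cases (simp_all add: B(2) C(2))
  qed
  then have "\<forall>u\<in>?D. \<forall>v\<in>?D. inner u v = (if u = v then 1 else 0)"
    by blast
  moreover have "(\<forall>u\<in>?D. inner x u = 0) \<longleftrightarrow> x = 0" for x :: "'a \<times> 'b"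
  proof -
    have "(\<forall>u\<in>?D. inner x u = 0) \<longleftrightarrow> (\<forall>u\<in>B. inner (fst x) u = 0) \<and> (\<forall>u\<in>C. inner (snd x) u = 0)"
      unfolding ball_Un ball_simps inner_prod_def by simp
    also have "\<dots> \<longleftrightarrow> fst x = 0 \<and> snd x = 0"
      using B(3) C(3) by metis
    also have "\<dots> \<longleftrightarrow> x = 0"
      by (simp add: prod_eq_iff)
    finally show ?thesis .
  qed
  ultimately show "\<exists>D::('a \<times> 'b) set. finite D \<and>
      (\<forall>u\<in>D. \<forall>v\<in>D. inner u v = (if u = v then 1 else 0)) \<and>
      (\<forall>x. (\<forall>u\<in>D. inner x u = 0) \<longleftrightarrow> x = 0)"
    using B(1) C(1) by (intro exI[of _ ?D] conjI) (simp, assumption, blast)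
qed


section \<open>Smooth manifolds\<close>

primrec times_differentiable_on ::
    "nat \<Rightarrow> 'a::real_normed_vector set \<Rightarrow> ('a \<Rightarrow> 'b::real_normed_vector) \<Rightarrow> bool" where
  "times_differentiable_on 0 S f \<longleftrightarrow> continuous_on S f"
| "times_differentiable_on (Suc k) S f \<longleftrightarrow>
     (\<forall>x\<in>S. f differentiable (at x)) \<and>
     (\<forall>v. times_differentiable_on k S (\<lambda>x. frechet_derivative f (at x) v))"

text \<open>Only used for open \<open>S\<close>.\<close>

definition smooth_on :: "'a::real_normed_vector set \<Rightarrow> ('a \<Rightarrow> 'b::real_normed_vector) \<Rightarrow> bool" where
  "smooth_on S f \<longleftrightarrow> (\<forall>k. times_differentiable_on k S f)"

text \<open>A chart is a triple of its domain, the coordinate map and the inverse of the latter.\<close>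

type_synonym ('m, 'e) chart = "'m set \<times> ('m \<Rightarrow> 'e) \<times> ('e \<Rightarrow> 'm)"

definition smooth_atlas ::
    "('m::{t2_space, second_countable_topology}, 'e::fin_euclidean) chart set \<Rightarrow> bool" where
  "smooth_atlas \<A> \<longleftrightarrow>
     (\<forall>(U, \<phi>, \<psi>) \<in> \<A>. open U \<and> open (\<phi> ` U) \<and> homeomorphism U (\<phi> ` U) \<phi> \<psi>) \<and>
     (\<Union>(U, \<phi>, \<psi>) \<in> \<A>. U) = UNIV \<and>
     (\<forall>(U, \<phi>, \<psi>) \<in> \<A>. \<forall>(U', \<phi>', \<psi>') \<in> \<A>. smooth_on (\<phi> ` (U \<inter> U')) (\<phi>' \<circ> \<psi>))"

definition std_atlas :: "('e::real_normed_vector, 'e) chart set" where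
  "std_atlas = {(UNIV, id, id)}"

definition prod_atlas ::
    "('m, 'e) chart set \<Rightarrow> ('n, 'f) chart set \<Rightarrow> ('m \<times> 'n, 'e \<times> 'f) chart set" where
  "prod_atlas \<A> \<B> =
     {(U \<times> U', map_prod \<phi> \<phi>', map_prod \<psi> \<psi>') | U \<phi> \<psi> U' \<phi>' \<psi>'. (U, \<phi>, \<psi>) \<in> \<A> \<and> (U', \<phi>', \<psi>') \<in> \<B>}"

text \<open>Smoothness on an open subset \<open>S\<close> of the manifold with atlas \<open>\<A>\<close>.\<close>

definition smooth_map_on ::
    "('m::topological_space, 'e::real_normed_vector) chart set \<Rightarrow>
     ('n::topological_space, 'f::real_normed_vector) chart set \<Rightarrow> 'm set \<Rightarrow> ('m \<Rightarrow> 'n) \<Rightarrow> bool" where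
  "smooth_map_on \<A> \<B> S f \<longleftrightarrow> continuous_on S f \<and>
     (\<forall>(U, \<phi>, \<psi>) \<in> \<A>. \<forall>(U', \<phi>', \<psi>') \<in> \<B>. smooth_on (\<phi> ` (S \<inter> U \<inter> f -` U')) (\<phi>' \<circ> f \<circ> \<psi>))"

definition smooth_functions ::
    "('m::topological_space, 'e::real_normed_vector) chart set \<Rightarrow> ('m \<Rightarrow> real) set" where
  "smooth_functions \<A> = {f. smooth_map_on \<A> std_atlas UNIV f}"


section \<open>Multivector fields, Schouten--Nijenhuis and Schouten--Jacobi bracket\<close>

text \<open>An element of the exterior algebra of polyvector fields, homogeneous or not, is represented
  by its action on lists of smooth functions: \<open>P [f\<^sub>1, \<dots>, f\<^sub>k]\<close> is the function
  \<open>P\<^sub>k(df\<^sub>1, \<dots>, df\<^sub>k)\<close>, where \<open>P\<^sub>k\<close> is the component of degree \<open>k\<close>. In particular the component of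
  degree 0 is the function \<open>P []\<close>.\<close>

type_synonym 'a polyvector = "('a \<Rightarrow> real) list \<Rightarrow> 'a \<Rightarrow> real"

text \<open>\<open>k\<close>-vector fields are the alternating \<open>k\<close>-derivations of the algebra of smooth functions. They
  are set to 0 on other lists, so that equality of such fields is equality in HOL.\<close>

definition multivector_field ::
    "nat \<Rightarrow> ('a::topological_space, 'e::real_normed_vector) chart set \<Rightarrow> 'a polyvector \<Rightarrow> bool" where
  "multivector_field k \<A> P \<longleftrightarrow>
     (\<forall>fs. \<not> (length fs = k \<and> set fs \<subseteq> smooth_functions \<A>) \<longrightarrow> P fs = (\<lambda>x. 0)) \<and>
     (\<forall>fs. length fs = k \<and> set fs \<subseteq> smooth_functions \<A> \<longrightarrow>
        P fs \<in> smooth_functions \<A> \<and>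
        (\<forall>i<k. \<forall>g \<in> smooth_functions \<A>. \<forall>h \<in> smooth_functions \<A>. \<forall>c.
           P (fs[i := (\<lambda>x. g x + c * h x)]) = (\<lambda>x. P (fs[i := g]) x + c * P (fs[i := h]) x) \<and>
           P (fs[i := (\<lambda>x. g x * h x)]) = (\<lambda>x. g x * P (fs[i := h]) x + P (fs[i := g]) x * h x)) \<and>
        (\<forall>i<k. \<forall>j<k. i \<noteq> j \<and> fs ! i = fs ! j \<longrightarrow> P fs = (\<lambda>x. 0)))"

text \<open>Sign of the permutation which moves the positions in \<open>S\<close> to the front of a list of length
  \<open>n\<close>, keeping the order inside \<open>S\<close> and inside its complement.\<close>

definition shuffle_sign :: "nat \<Rightarrow> nat set \<Rightarrow> real" where
  "shuffle_sign n S = (-1) ^ card {(i, j). i < j \<and> j < n \<and> i \<notin> S \<and> j \<in> S}"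

definition wedge :: "'a polyvector \<Rightarrow> 'a polyvector \<Rightarrow> 'a polyvector" where
  "wedge P Q fs x =
     (\<Sum>S\<in>Pow {..<length fs}. shuffle_sign (length fs) S * P (nths fs S) x * Q (nths fs (- S)) x)"

text \<open>For \<open>P\<close> of degree \<open>p + 1\<close> and \<open>Q\<close> of degree \<open>q + 1\<close> this is
  \<open>(-1)\<^sup>p\<^sup>q P \<circ> Q - Q \<circ> P\<close>, where \<open>P \<circ> Q\<close> is the sum over all \<open>(q + 1, p)\<close>-shuffles of the insertions of
  \<open>Q\<close> into the first argument of \<open>P\<close>. In a summand of \<open>P \<circ> Q\<close> one has \<open>card S = q + 1\<close> and
  \<open>length fs - card S = p\<close>, so that \<open>(-1)\<^sup>p\<^sup>q\<close> can be read off from \<open>S\<close>. The signs are those of the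
  unique graded Lie bracket with \<open>[P, Q] = -(-1)\<^sup>p\<^sup>q [Q, P]\<close> and
  \<open>[P, Q \<and> R] = [P, Q] \<and> R + (-1)\<^bsup>p (q + 1)\<^esup> Q \<and> [P, R]\<close> which extends the Lie bracket of
  vector fields and \<open>[X, f] = X f\<close>.\<close>

definition schouten_nijenhuis :: "'a polyvector \<Rightarrow> 'a polyvector \<Rightarrow> 'a polyvector" where
  "schouten_nijenhuis P Q fs x =
     (\<Sum>S\<in>Pow {..<length fs}. shuffle_sign (length fs) S *
        ((-1) ^ ((length fs - card S) * (card S + 1)) * P (Q (nths fs S) # nths fs (- S)) x
         - Q (P (nths fs S) # nths fs (- S)) x))"

text \<open>First-order polydifferential operators: the pair \<open>(P\<^sub>1, P\<^sub>2)\<close> stands for \<open>P\<^sub>1 + I \<and> P\<^sub>2\<close>.\<close>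

type_synonym 'a polydiffop = "'a polyvector \<times> 'a polyvector"

definition zero_polydiffop :: "'a polydiffop" where
  "zero_polydiffop = ((\<lambda>fs x. 0), (\<lambda>fs x. 0))"

definition component :: "nat \<Rightarrow> 'a polydiffop \<Rightarrow> 'a polydiffop" where
  "component k F =
     ((\<lambda>fs x. if length fs = k then fst F fs x else 0),
      (\<lambda>fs x. if length fs + 1 = k then snd F fs x else 0))"

text \<open>The bracket \<open>[P\<^sub>1 + I \<and> P\<^sub>2, Q\<^sub>1 + I \<and> Q\<^sub>2]\<^sub>1\<close> for homogeneous arguments of degrees
  \<open>p + 1\<close> and \<open>q + 1\<close>, where \<open>p, q \<ge> -1\<close>.\<close>

definition homogeneous_schouten_jacobi ::
    "int \<Rightarrow> int \<Rightarrow> 'a polydiffop \<Rightarrow> 'a polydiffop \<Rightarrow> 'a polydiffop" where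
  "homogeneous_schouten_jacobi p q P Q =
     (let P1 = fst P; P2 = snd P; Q1 = fst Q; Q2 = snd Q in
      ((\<lambda>fs x. schouten_nijenhuis P1 Q1 fs x + of_int p * wedge P1 Q2 fs x
               - (-1) powi p * of_int q * wedge P2 Q1 fs x),
       (\<lambda>fs x. (-1) powi p * schouten_nijenhuis P1 Q2 fs x + schouten_nijenhuis P2 Q1 fs x
               + of_int (p - q) * wedge P2 Q2 fs x)))"

text \<open>Bilinear extension to inhomogeneous arguments. A value on a list of length \<open>n\<close> is a part of the
  component of degree \<open>n\<close> or \<open>n + 1\<close> of the result and thus only involves components of
  degree at most \<open>n + 2\<close> of the arguments.\<close>

definition schouten_jacobi :: "'a polydiffop \<Rightarrow> 'a polydiffop \<Rightarrow> 'a polydiffop" where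
  "schouten_jacobi P Q =
     (let B = (\<lambda>k l. homogeneous_schouten_jacobi (int k - 1) (int l - 1) (component k P) (component l Q)) in
      ((\<lambda>fs x. \<Sum>k\<le>length fs + 2. \<Sum>l\<le>length fs + 2. fst (B k l) fs x),
       (\<lambda>fs x. \<Sum>k\<le>length fs + 2. \<Sum>l\<le>length fs + 2. snd (B k l) fs x)))"


section \<open>Jacobi structures\<close>

definition jacobi_structure ::
    "('a::topological_space, 'e::real_normed_vector) chart set \<Rightarrow> 'a polyvector \<Rightarrow> 'a polyvector \<Rightarrow> bool" where
  "jacobi_structure \<A> \<Lambda> E \<longleftrightarrow>
     multivector_field 2 \<A> \<Lambda> \<and> multivector_field 1 \<A> E \<and>
     schouten_nijenhuis \<Lambda> \<Lambda> = (\<lambda>fs x. - 2 * wedge E \<Lambda> fs x) \<and>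
     schouten_nijenhuis E \<Lambda> = (\<lambda>fs x. 0)"

definition jacobi_bracket ::
    "'a polyvector \<Rightarrow> 'a polyvector \<Rightarrow> ('a \<Rightarrow> real) \<Rightarrow> ('a \<Rightarrow> real) \<Rightarrow> 'a \<Rightarrow> real" where
  "jacobi_bracket \<Lambda> E f g = (\<lambda>x. \<Lambda> [f, g] x + f x * E [g] x - g x * E [f] x)"

definition hamiltonian_vector_field ::
    "'a polyvector \<Rightarrow> 'a polyvector \<Rightarrow> ('a \<Rightarrow> real) \<Rightarrow> ('a \<Rightarrow> real) \<Rightarrow> 'a \<Rightarrow> real" where
  "hamiltonian_vector_field \<Lambda> E f g = (\<lambda>x. \<Lambda> [f, g] x + f x * E [g] x)"


section \<open>Affine bundles\<close>

text \<open>Vector bundle with total space \<open>'w\<close>, base \<open>'m\<close> modelled on \<open>'e\<close>, and fibre model \<open>'f\<close>.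
  Addition is only meaningful for two elements of the same fibre.\<close>

record ('w, 'm, 'e, 'f) vector_bundle =
  vb_base :: "('m, 'e) chart set"
  vb_total :: "('w, 'e \<times> 'f) chart set"
  vb_proj :: "'w \<Rightarrow> 'm"
  vb_add :: "'w \<Rightarrow> 'w \<Rightarrow> 'w"
  vb_scale :: "real \<Rightarrow> 'w \<Rightarrow> 'w"

text \<open>Affine bundle with total space \<open>'a\<close>, modelled on \<open>ab_model\<close>; \<open>ab_translate A y X\<close> is the point
  \<open>y + X\<close>, for \<open>X\<close> in the fibre of the model bundle over the base point of \<open>y\<close>.\<close>

record ('a, 'w, 'm, 'e, 'f) affine_bundle =
  ab_model :: "('w, 'm, 'e, 'f) vector_bundle"
  ab_total :: "('a, 'e \<times> 'f) chart set"
  ab_proj :: "'a \<Rightarrow> 'm"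
  ab_translate :: "'a \<Rightarrow> 'w \<Rightarrow> 'a"

text \<open>\<open>\<tau>\<close> is the fibre component of a diffeomorphism from the part over \<open>U\<close> to \<open>U \<times> 'f\<close>.\<close>

definition trivialization ::
    "('m::topological_space, 'e::real_normed_vector) chart set \<Rightarrow>
     ('a::topological_space, 'e \<times> 'f::real_normed_vector) chart set \<Rightarrow>
     ('a \<Rightarrow> 'm) \<Rightarrow> 'm set \<Rightarrow> ('a \<Rightarrow> 'f) \<Rightarrow> bool" where
  "trivialization \<A> \<B> \<pi> U \<tau> \<longleftrightarrow>
     open U \<and>
     bij_betw (\<lambda>y. (\<pi> y, \<tau> y)) (\<pi> -` U) (U \<times> UNIV) \<and>
     smooth_map_on \<B> (prod_atlas \<A> std_atlas) (\<pi> -` U) (\<lambda>y. (\<pi> y, \<tau> y)) \<and>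
     smooth_map_on (prod_atlas \<A> std_atlas) \<B> (U \<times> UNIV) (inv_into (\<pi> -` U) (\<lambda>y. (\<pi> y, \<tau> y)))"

definition vb_trivialization ::
    "('w::topological_space, 'm::topological_space, 'e::real_normed_vector, 'f::real_normed_vector) vector_bundle \<Rightarrow>
     'm set \<Rightarrow> ('w \<Rightarrow> 'f) \<Rightarrow> bool" where
  "vb_trivialization V U \<theta> \<longleftrightarrow>
     trivialization (vb_base V) (vb_total V) (vb_proj V) U \<theta> \<and>
     (\<forall>X Y. vb_proj V X \<in> U \<and> vb_proj V Y = vb_proj V X \<longrightarrow>
        vb_proj V (vb_add V X Y) = vb_proj V X \<and> \<theta> (vb_add V X Y) = \<theta> X + \<theta> Y) \<and>
     (\<forall>c X. vb_proj V X \<in> U \<longrightarrow>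
        vb_proj V (vb_scale V c X) = vb_proj V X \<and> \<theta> (vb_scale V c X) = c *\<^sub>R \<theta> X)"

text \<open>Since \<open>\<theta>\<close> is bijective on fibres and compatible with the operations, every fibre
  is a vector space isomorphic to \<open>'f\<close>, and transition maps are linear on fibres.\<close>

definition is_vector_bundle ::
    "('w::{t2_space, second_countable_topology}, 'm::{t2_space, second_countable_topology},
      'e::fin_euclidean, 'f::fin_euclidean) vector_bundle \<Rightarrow> bool" where
  "is_vector_bundle V \<longleftrightarrow>
     smooth_atlas (vb_base V) \<and> smooth_atlas (vb_total V) \<and>
     smooth_map_on (vb_total V) (vb_base V) UNIV (vb_proj V) \<and>
     (\<forall>p. \<exists>U \<theta>. p \<in> U \<and> vb_trivialization V U \<theta>)"

definition ab_base :: "('a, 'w, 'm, 'e, 'f) affine_bundle \<Rightarrow> ('m, 'e) chart set" where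
  "ab_base A = vb_base (ab_model A)"

definition ab_fibre :: "('a, 'w, 'm, 'e, 'f) affine_bundle \<Rightarrow> 'm \<Rightarrow> 'a set" where
  "ab_fibre A p = {y. ab_proj A y = p}"

definition ab_trivialization ::
    "('a::topological_space, 'w::topological_space, 'm::topological_space,
      'e::real_normed_vector, 'f::real_normed_vector) affine_bundle \<Rightarrow>
     'm set \<Rightarrow> ('a \<Rightarrow> 'f) \<Rightarrow> ('w \<Rightarrow> 'f) \<Rightarrow> bool" where
  "ab_trivialization A U \<tau> \<theta> \<longleftrightarrow>
     vb_trivialization (ab_model A) U \<theta> \<and>
     trivialization (ab_base A) (ab_total A) (ab_proj A) U \<tau> \<and>
     (\<forall>y X. ab_proj A y \<in> U \<and> vb_proj (ab_model A) X = ab_proj A y \<longrightarrow>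
        ab_proj A (ab_translate A y X) = ab_proj A y \<and> \<tau> (ab_translate A y X) = \<tau> y + \<theta> X)"

text \<open>The equivariance of \<open>\<tau>\<close> forces translation to be a free and transitive action of the fibres
  of the model bundle on those of \<open>A\<close>, and the transition maps to be affine on fibres with linear part given
  by the transition maps of the model bundle.\<close>

definition is_affine_bundle ::
    "('a::{t2_space, second_countable_topology}, 'w::{t2_space, second_countable_topology},
      'm::{t2_space, second_countable_topology}, 'e::fin_euclidean, 'f::fin_euclidean) affine_bundle \<Rightarrow> bool" where
  "is_affine_bundle A \<longleftrightarrow>
     is_vector_bundle (ab_model A) \<and> smooth_atlas (ab_total A) \<and>
     smooth_map_on (ab_total A) (ab_base A) UNIV (ab_proj A) \<and>
     (\<forall>p. \<exists>U \<tau> \<theta>. p \<in> U \<and> ab_trivialization A U \<tau> \<theta>)"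

definition ab_rank :: "('a, 'w, 'm, 'e, 'f::real_vector) affine_bundle \<Rightarrow> nat" where
  "ab_rank A = dim (UNIV :: 'f set)"


section \<open>Affine and basic functions\<close>

definition fibre_linear :: "('w, 'm, 'e, 'f) vector_bundle \<Rightarrow> 'm \<Rightarrow> ('w \<Rightarrow> real) \<Rightarrow> bool" where
  "fibre_linear V p l \<longleftrightarrow>
     (\<forall>X Y. vb_proj V X = p \<and> vb_proj V Y = p \<longrightarrow> l (vb_add V X Y) = l X + l Y) \<and>
     (\<forall>c X. vb_proj V X = p \<longrightarrow> l (vb_scale V c X) = c * l X)"

text \<open>The fibre of \<open>A\<^sup>+\<close> over \<open>p\<close>: affine functions on the fibre of \<open>A\<close> over \<open>p\<close>, extended
  by \<open>undefined\<close> outside that fibre.\<close>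

definition aff_fibre :: "('a, 'w, 'm, 'e, 'f) affine_bundle \<Rightarrow> 'm \<Rightarrow> ('a \<Rightarrow> real) set" where
  "aff_fibre A p = {\<alpha> \<in> extensional (ab_fibre A p).
     \<exists>l. fibre_linear (ab_model A) p l \<and>
       (\<forall>y\<in>ab_fibre A p. \<forall>X. vb_proj (ab_model A) X = p \<longrightarrow> \<alpha> (ab_translate A y X) = \<alpha> y + l X)}"

text \<open>The section \<open>\<tilde>a\<close> of \<open>A\<^sup>+\<close> associated with a function \<open>a\<close> which is affine on fibres.\<close>

definition assoc_section ::
    "('a, 'w, 'm, 'e, 'f) affine_bundle \<Rightarrow> ('a \<Rightarrow> real) \<Rightarrow> 'm \<Rightarrow> 'a \<Rightarrow> real" where
  "assoc_section A a p = restrict a (ab_fibre A p)"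

definition affine_functions ::
    "('a::topological_space, 'w, 'm, 'e::real_normed_vector, 'f::real_normed_vector) affine_bundle \<Rightarrow>
     ('a \<Rightarrow> real) set" where
  "affine_functions A =
     {a \<in> smooth_functions (ab_total A). \<forall>p. assoc_section A a p \<in> aff_fibre A p}"

definition basic_functions ::
    "('a, 'w, 'm::topological_space, 'e::real_normed_vector, 'f) affine_bundle \<Rightarrow> ('a \<Rightarrow> real) set" where
  "basic_functions A = {f \<circ> ab_proj A | f. f \<in> smooth_functions (ab_base A)}"

text \<open>Smooth sections of the dual bundle of \<open>A\<^sup>+\<close>. A trivialization \<open>(\<tau>, \<theta>)\<close> of \<open>A\<close> over \<open>U\<close> induces the
  trivialization of \<open>A\<^sup>+\<close> over \<open>U\<close> that identifies the affine function \<open>c + l\<close> on \<open>'f\<close> with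
  \<open>(c + l) \<circ> \<tau>\<close>; smoothness is smoothness in the dual trivializations.\<close>

definition hat_section ::
    "('a::topological_space, 'w::topological_space, 'm::topological_space,
      'e::real_normed_vector, 'f::real_normed_vector) affine_bundle \<Rightarrow>
     ('m \<Rightarrow> ('a \<Rightarrow> real) \<Rightarrow> real) \<Rightarrow> bool" where
  "hat_section A \<xi> \<longleftrightarrow>
     (\<forall>p. \<forall>\<alpha>\<in>aff_fibre A p. \<forall>\<beta>\<in>aff_fibre A p. \<forall>c.
        \<xi> p (restrict (\<lambda>y. \<alpha> y + c * \<beta> y) (ab_fibre A p)) = \<xi> p \<alpha> + c * \<xi> p \<beta>) \<and>
     (\<forall>U \<tau> \<theta>. ab_trivialization A U \<tau> \<theta> \<longrightarrow>
        (\<forall>c l. linear l \<longrightarrow>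
           smooth_map_on (ab_base A) std_atlas U
             (\<lambda>p. \<xi> p (restrict (\<lambda>y. c + l (\<tau> y)) (ab_fibre A p)))))"


section \<open>Affine properties of Jacobi structures\<close>

definition affine_bivector_field ::
    "('a::topological_space, 'w, 'm, 'e::real_normed_vector, 'f::real_normed_vector) affine_bundle \<Rightarrow>
     'a polyvector \<Rightarrow> bool" where
  "affine_bivector_field A \<Lambda> \<longleftrightarrow>
     (\<forall>a\<in>affine_functions A. \<forall>b\<in>affine_functions A. \<Lambda> [a, b] \<in> affine_functions A)"

definition affine_jacobi ::
    "('a::topological_space, 'w, 'm, 'e::real_normed_vector, 'f::real_normed_vector) affine_bundle \<Rightarrow>
     'a polyvector \<Rightarrow> 'a polyvector \<Rightarrow> bool" where
  "affine_jacobi A \<Lambda> E \<longleftrightarrow>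
     (\<forall>a\<in>affine_functions A. \<forall>b\<in>affine_functions A. jacobi_bracket \<Lambda> E a b \<in> affine_functions A)"

definition strongly_affine_jacobi ::
    "('a::topological_space, 'w, 'm, 'e::real_normed_vector, 'f::real_normed_vector) affine_bundle \<Rightarrow>
     'a polyvector \<Rightarrow> 'a polyvector \<Rightarrow> bool" where
  "strongly_affine_jacobi A \<Lambda> E \<longleftrightarrow> affine_jacobi A \<Lambda> E \<and>
     (\<forall>a\<in>affine_functions A. \<forall>b\<in>affine_functions A.
        hamiltonian_vector_field \<Lambda> E a b \<in> affine_functions A)"

text \<open>Ideals of a Lie algebra of functions with carrier \<open>L\<close> and bracket \<open>br\<close>.\<close>

definition lie_ideal ::
    "('a \<Rightarrow> real) set \<Rightarrow> (('a \<Rightarrow> real) \<Rightarrow> ('a \<Rightarrow> real) \<Rightarrow> 'a \<Rightarrow> real) \<Rightarrow> ('a \<Rightarrow> real) set \<Rightarrow> bool" where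
  "lie_ideal L br J \<longleftrightarrow> J \<subseteq> L \<and> (\<lambda>x. 0) \<in> J \<and>
     (\<forall>f\<in>J. \<forall>g\<in>J. \<forall>c. (\<lambda>x. f x + c * g x) \<in> J) \<and>
     (\<forall>a\<in>L. \<forall>f\<in>J. br a f \<in> J \<and> br f a \<in> J)"

definition vb_section ::
    "('w::topological_space, 'm::topological_space, 'e::real_normed_vector, 'f::real_normed_vector) vector_bundle \<Rightarrow>
     ('m \<Rightarrow> 'w) \<Rightarrow> bool" where
  "vb_section V X \<longleftrightarrow> smooth_map_on (vb_base V) (vb_total V) UNIV X \<and> (\<forall>p. vb_proj V (X p) = p)"

definition vertical_lift ::
    "('a::topological_space, 'w, 'm, 'e::real_normed_vector, 'f::real_normed_vector) affine_bundle \<Rightarrow>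
     ('m \<Rightarrow> 'w) \<Rightarrow> 'a polyvector" where
  "vertical_lift A X fs y =
     (if length fs = 1 \<and> set fs \<subseteq> smooth_functions (ab_total A)
      then deriv (\<lambda>t. hd fs (ab_translate A y (vb_scale (ab_model A) t (X (ab_proj A y))))) 0
      else 0)"

definition function_lift ::
    "('a, 'w, 'm, 'e, 'f) affine_bundle \<Rightarrow> ('m \<Rightarrow> real) \<Rightarrow> 'a polyvector" where
  "function_lift A f fs y = (if fs = [] then f (ab_proj A y) else 0)"

text \<open>The linear span of the vertical lifts of sections and of functions on the base.\<close>

inductive_set vertical_lifts ::
    "('a::topological_space, 'w::topological_space, 'm::topological_space,
      'e::real_normed_vector, 'f::real_normed_vector) affine_bundle \<Rightarrow> 'a polydiffop set"
  for A where
  section_lift: "vb_section (ab_model A) X \<Longrightarrow> (vertical_lift A X, \<lambda>fs x. 0) \<in> vertical_lifts A"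
| function_lift: "f \<in> smooth_functions (ab_base A) \<Longrightarrow> (function_lift A f, \<lambda>fs x. 0) \<in> vertical_lifts A"
| linear_combination: "D \<in> vertical_lifts A \<Longrightarrow> D' \<in> vertical_lifts A \<Longrightarrow>
    ((\<lambda>fs x. c * fst D fs x + c' * fst D' fs x), (\<lambda>fs x. c * snd D fs x + c' * snd D' fs x))
      \<in> vertical_lifts A"

definition affine_invariant ::
    "('a::topological_space, 'w::topological_space, 'm::topological_space,
      'e::real_normed_vector, 'f::real_normed_vector) affine_bundle \<Rightarrow> 'a polydiffop \<Rightarrow> bool" where
  "affine_invariant A F \<longleftrightarrow> (\<forall>D\<in>vertical_lifts A. schouten_jacobi D F = zero_polydiffop)"

definition affine_homogeneous_jacobi ::
    "('a::topological_space, 'w::topological_space, 'm::topological_space,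
      'e::real_normed_vector, 'f::real_normed_vector) affine_bundle \<Rightarrow>
     'a polyvector \<Rightarrow> 'a polyvector \<Rightarrow> bool" where
  "affine_homogeneous_jacobi A \<Lambda> E \<longleftrightarrow>
     (\<forall>D1\<in>vertical_lifts A. \<forall>D2\<in>vertical_lifts A.
        schouten_jacobi D1 (schouten_jacobi D2 (\<Lambda>, E)) = zero_polydiffop)"

end

theory Submission
  imports Defs
begin

text \<open>Call \<open>(\<Lambda>, E)\<close> fibre compatible if \<open>E\<close> kills basic functions, maps affine functions to basic ones,
  and \<open>\<Lambda>(da, db)\<close> is affine for affine \<open>a, b\<close>. In positive rank this forces \<open>\<Lambda>(df, da)\<close> to be basic
  and \<open>\<Lambda>(df, dg) = 0\<close> for basic \<open>f, g\<close>: applying \<open>\<Lambda>(\<cdot>, a)\<close> to \<open>f h\<close> with \<open>h = \<Lambda>(df, da)\<close> shows that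
  \<open>h\<^sup>2\<close> is affine, so \<open>h\<close> is constant on fibres. Each of the five conditions is equivalent to fibre
  compatibility. From homogeneity one recovers it because a smooth function is basic if it is killed
  by all vertical lifts \<open>X\<^sup>v\<close>, and affine if all its derivatives along vertical lifts are basic.
  Conversely the iterated brackets are derivations in each argument, so it suffices that they vanish on
  affine functions: by Hadamard's lemma a derivation which kills all affine functions is zero, since
  coordinates of a bundle chart are affine.\<close>

section \<open>Finite-dimensional inner product spaces\<close>

text \<open>All operators act on lists of globally defined functions, so local data have to be made
  global: chart coordinates, coefficient functions and prescribed fibre vectors enter only after
  multiplication by a bump function, and the bump is pulled back from the base whenever affinity on
  the fibres must survive. Positive rank provides, at each point, a section X and an affine a with
  X^v(a) nonzero there, so a basic function whose products with all affine functions are basic is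
  zero. Applied to E(b a) = b E(a) + E(b) a, this shows that E kills basic functions as soon as it
  maps affine functions to basic ones. Hence (iii), (iv) and (v) only have to yield that E(a) is
  basic for affine a. Behind homogeneity lies a degree count along the fibres: a vertical lift sends
  affine functions to basic ones and basic ones to zero, so each bracket with it lowers the fibre
  degree. One bracket exhausts E, two exhaust \<Lambda>.\<close>

definition orthobasis :: "'a::fin_euclidean set" where
  "orthobasis = (SOME B. finite B \<and> (\<forall>u\<in>B. \<forall>v\<in>B. inner u v = (if u = v then 1 else 0)) \<and>
     (\<forall>x. (\<forall>u\<in>B. inner x u = 0) \<longleftrightarrow> x = 0))"

lemma
  shows finite_orthobasis [simp, intro]: "finite (orthobasis :: 'a::fin_euclidean set)"
    and inner_orthobasis: "u \<in> orthobasis \<Longrightarrow> v \<in> orthobasis \<Longrightarrow> inner u v = (if u = (v::'a) then 1 else 0)"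
    and orthobasis_all_zero: "(\<And>u. u \<in> orthobasis \<Longrightarrow> inner x u = 0) \<Longrightarrow> x = (0::'a)"
proof -
  have "finite (orthobasis :: 'a set) \<and>
     (\<forall>u\<in>orthobasis. \<forall>v\<in>orthobasis. inner u v = (if u = (v::'a) then 1 else 0)) \<and>
     (\<forall>x::'a. (\<forall>u\<in>orthobasis. inner x u = 0) \<longleftrightarrow> x = 0)"
    unfolding orthobasis_def by (rule someI_ex[OF ex_finite_orthonormal_basis])
  then show "finite (orthobasis :: 'a set)"
    and "u \<in> orthobasis \<Longrightarrow> v \<in> orthobasis \<Longrightarrow> inner u v = (if u = (v::'a) then 1 else 0)"
    and "(\<And>u. u \<in> orthobasis \<Longrightarrow> inner x u = 0) \<Longrightarrow> x = (0::'a)"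
    by blast+
qed

lemma orthobasis_expansion: "(\<Sum>b\<in>orthobasis. inner x b *\<^sub>R b) = (x::'a::fin_euclidean)"
proof -
  have "x - (\<Sum>b\<in>orthobasis. inner x b *\<^sub>R b) = 0"
  proof (rule orthobasis_all_zero)
    fix u :: 'a assume u: "u \<in> orthobasis"
    have "inner (\<Sum>b\<in>orthobasis. inner x b *\<^sub>R b) u = (\<Sum>b\<in>orthobasis. inner x b * (if b = u then 1 else 0))"
      unfolding inner_sum_left by (intro sum.cong refl) (simp add: inner_orthobasis u)
    also have "\<dots> = inner x u"
      using u by (simp add: if_distrib[of "(*) _"] cong: if_cong)
    finally show "inner (x - (\<Sum>b\<in>orthobasis. inner x b *\<^sub>R b)) u = 0"
      by (simp add: inner_diff_left)
  qed
  then show ?thesis by simp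
qed

lemma norm_orthobasis: "b \<in> orthobasis \<Longrightarrow> norm b = 1"
  by (simp add: norm_eq_sqrt_inner inner_orthobasis)

text \<open>By Tychonoff, a product of intervals is compact; the ball around 0 is a closed subset of
  its image under the map from coordinates to vectors.\<close>

lemma compact_cball_fin_euclidean: "compact (cball (z::'a::fin_euclidean) r)"
proof -
  let ?s = "\<lambda>c. \<Sum>b\<in>orthobasis. c b *\<^sub>R (b::'a)" and ?P = "PiE UNIV (\<lambda>_::'a. {-r..r})"
  have "compact ?P"
    using compactin_PiE[of "\<lambda>_. euclidean" UNIV "\<lambda>_::'a. {-r..r}"] by (simp add: euclidean_product_topology)
  then have "compact (?s ` ?P)"
    by (intro compact_continuous_image continuous_intros continuous_on_subset[OF continuous_on_product_coordinates]) auto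
  moreover have "cball 0 r \<subseteq> ?s ` ?P"
  proof
    fix x :: 'a assume x: "x \<in> cball 0 r"
    \<comment> \<open>The product runs over all vectors of the type, not only over the basis; the
      filler 0 lies in the interval because \<open>r \<ge> 0\<close>.\<close>
    let ?c = "\<lambda>b. if b \<in> orthobasis then inner x b else 0"
    have "\<bar>inner x b\<bar> \<le> r" if "b \<in> orthobasis" for b
      using Cauchy_Schwarz_ineq2[of x b] x norm_orthobasis[OF that] by simp
    moreover have "r \<ge> 0" using x norm_ge_zero[of x] by (simp del: norm_ge_zero)
    ultimately have "?c \<in> ?P" by (auto simp: abs_le_iff minus_le_iff)
    moreover have "x = ?s ?c"
      using orthobasis_expansion[of x] by (simp cong: sum.cong)
    ultimately show "x \<in> ?s ` ?P" by (intro image_eqI[of x ?s ?c])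
  qed
  ultimately have "compact (cball (0::'a) r)"
    using compact_Int_closed[of "?s ` ?P" "cball 0 r"] by (simp add: Int_absorb1)
  then have "compact ((+) z ` cball 0 r)"
    by (rule compact_translation)
  then show ?thesis by (simp add: image_add_cball)
qed

text \<open>A Cauchy sequence is bounded, hence stays in a compact and therefore complete ball.
  Completeness is wanted for Leibniz's rule in \<open>smooth_on_ray_integral\<close>.\<close>

instance fin_euclidean \<subseteq> banach
proof
  fix X :: "nat \<Rightarrow> 'a"
  assume X: "Cauchy X"
  then have "bounded (range X)"
    by (rule cauchy_imp_bounded)
  then obtain r where "range X \<subseteq> cball 0 r"
    unfolding bounded_iff by (fastforce simp: subset_iff)
  then show "convergent X"
    using X completeE[OF compact_imp_complete[OF compact_cball_fin_euclidean[of 0 r]], of X]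
    unfolding convergent_def by (metis rangeI subsetD)
qed

lemma linear_fin_euclidean_bounded:
  fixes l :: "'a::fin_euclidean \<Rightarrow> 'b::real_normed_vector"
  assumes "linear l"
  shows "bounded_linear l"
proof -
  have "l = (\<lambda>x. \<Sum>b\<in>orthobasis. inner x b *\<^sub>R l b)"
    using linear_sum[OF assms, of "\<lambda>b. inner _ b *\<^sub>R b" orthobasis] linear_scale[OF assms]
    by (metis (no_types, lifting) orthobasis_expansion sum.cong)
  moreover have "bounded_linear (\<lambda>x. \<Sum>b\<in>orthobasis. inner x b *\<^sub>R l b)"
    by (intro bounded_linear_sum bounded_linear_scaleR_const bounded_linear_inner_left)
  ultimately show ?thesis by simp
qed


section \<open>Smooth maps between open sets\<close>

text \<open>\<open>frechet_derivative\<close> is taken in the whole space, so openness of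
  \<open>S\<close> is what makes it depend on the values in \<open>S\<close> alone.\<close>

lemma times_diff_cong:
  assumes "open S" "\<And>x. x \<in> S \<Longrightarrow> f x = g x" "times_differentiable_on k S f"
  shows "times_differentiable_on k S g"
  using assms(2,3)
proof (induction k arbitrary: f g)
  case 0
  then show ?case by (simp cong: continuous_on_cong)
next
  case (Suc k)
  have D: "(g has_derivative f') (at x)" if "x \<in> S" "(f has_derivative f') (at x)" for x f'
    using has_derivative_transform_within_open[OF that(2) assms(1) that(1)] Suc.prems(1) by simp
  have "g differentiable (at x)" "frechet_derivative g (at x) = frechet_derivative f (at x)"
    if "x \<in> S" for x
  proof -
    have "(g has_derivative frechet_derivative f (at x)) (at x)"
      using that Suc.prems(2) by (intro D) (auto simp: frechet_derivative_works)
    then show "g differentiable (at x)" "frechet_derivative g (at x) = frechet_derivative f (at x)"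
      by (auto simp: differentiable_def dest: frechet_derivative_at)
  qed
  with Suc.prems(2) show ?case
    by (auto intro: Suc.IH[rotated])
qed

text \<open>Trades the derivative picked by \<open>frechet_derivative\<close> for any explicit
  formula; the closure properties below are inductions on the order through this rule.\<close>

lemma times_diff_SucI:
  assumes "open S" "\<And>x. x \<in> S \<Longrightarrow> (f has_derivative f' x) (at x)"
    "\<And>v. times_differentiable_on k S (\<lambda>x. f' x v)"
  shows "times_differentiable_on (Suc k) S f"
proof -
  have "frechet_derivative f (at x) = f' x" if "x \<in> S" for x
    using frechet_derivative_at[OF assms(2)[OF that]] by simp
  then have "times_differentiable_on k S (\<lambda>x. frechet_derivative f (at x) v)" for v
    by (intro times_diff_cong[OF assms(1) _ assms(3)]) simp
  with assms(2) show ?thesis by (auto simp: differentiable_def)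
qed

lemma times_diff_SucD:
  assumes "times_differentiable_on (Suc k) S f"
  shows "x \<in> S \<Longrightarrow> (f has_derivative frechet_derivative f (at x)) (at x)"
    and "times_differentiable_on k S (\<lambda>x. frechet_derivative f (at x) v)"
  using assms by (auto simp: frechet_derivative_works)

lemma times_diff_subset:
  "times_differentiable_on k S f \<Longrightarrow> T \<subseteq> S \<Longrightarrow> times_differentiable_on k T f"
  by (induction k arbitrary: f) (auto intro: continuous_on_subset)

lemma times_diff_less:
  "times_differentiable_on (Suc k) S f \<Longrightarrow> times_differentiable_on k S f"
proof (induction k arbitrary: f)
  case 0
  then show ?case
    by (auto intro!: continuous_at_imp_continuous_on differentiable_imp_continuous_within)
next
  case (Suc k)
  show ?case
    using Suc.prems Suc.IH[OF times_diff_SucD(2)[OF Suc.prems]] by simp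
qed

lemma times_diff_continuous: "times_differentiable_on k S f \<Longrightarrow> continuous_on S f"
  by (induction k) (simp, blast dest: times_diff_less)

lemma times_diff_local:
  assumes "\<And>x. x \<in> S \<Longrightarrow> \<exists>T. open T \<and> x \<in> T \<and> times_differentiable_on k T f"
  shows "times_differentiable_on k S f"
  using assms
proof (induction k arbitrary: f)
  case 0
  then have "isCont f x" if "x \<in> S" for x
    using that by (metis continuous_on_interior interior_open times_diff_continuous)
  then show ?case by (simp add: continuous_at_imp_continuous_on)
next
  case (Suc k)
  then show ?case by (fastforce intro!: Suc.IH)
qed

lemma times_diff_const: "open S \<Longrightarrow> times_differentiable_on k S (\<lambda>x. c)"
  by (induction k arbitrary: c) (auto intro!: times_diff_SucI[of _ _ "\<lambda>x v. 0"] continuous_intros simp del: times_differentiable_on.simps(2))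

lemma times_diff_add:
  assumes "open S" "times_differentiable_on k S f" "times_differentiable_on k S g"
  shows "times_differentiable_on k S (\<lambda>x. f x + g x)"
  using assms(2,3)
proof (induction k arbitrary: f g)
  case (Suc k)
  show ?case
    by (rule times_diff_SucI[OF assms(1)
          has_derivative_add[OF Suc.prems[THEN times_diff_SucD(1)]]])
      (auto intro!: Suc.IH Suc.prems[THEN times_diff_SucD(2)])
qed (auto intro: continuous_intros)

lemma times_diff_sum:
  assumes "open S" "\<And>i. i \<in> I \<Longrightarrow> times_differentiable_on k S (f i)"
  shows "times_differentiable_on k S (\<lambda>x. \<Sum>i\<in>I. f i x)"
  using assms(2)
  by (induction I rule: infinite_finite_induct)
    (auto intro: times_diff_const times_diff_add assms(1))

lemma times_diff_bounded_linear:
  assumes "open S" "bounded_linear h" "times_differentiable_on k S f"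
  shows "times_differentiable_on k S (\<lambda>x. h (f x))"
  using assms(3)
proof (induction k arbitrary: f)
  case (Suc k)
  show ?case
    by (rule times_diff_SucI[OF assms(1)
          bounded_linear.has_derivative[OF assms(2) Suc.prems[THEN times_diff_SucD(1)]]])
      (auto intro!: Suc.IH Suc.prems[THEN times_diff_SucD(2)])
qed (auto intro: bounded_linear.continuous_on[OF assms(2)])

lemma times_diff_bilinear:
  assumes "open S" "bounded_bilinear h" "times_differentiable_on k S f" "times_differentiable_on k S g"
  shows "times_differentiable_on k S (\<lambda>x. h (f x) (g x))"
  using assms(3,4)
proof (induction k arbitrary: f g)
  case (Suc k)
  show ?case
    by (rule times_diff_SucI[OF assms(1)
          bounded_bilinear.FDERIV[OF assms(2) Suc.prems[THEN times_diff_SucD(1)]]])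
      (auto intro!: times_diff_add Suc.IH assms(1) Suc.prems[THEN times_diff_SucD(2)]
        Suc.prems[THEN times_diff_less])
qed (auto intro: bounded_bilinear.continuous_on[OF assms(2)])

text \<open>The recursion only knows derivatives of \<open>g\<close> in fixed directions, whereas
  the chain rule differentiates \<open>g\<close> in the moving direction \<open>f'(x) v\<close>.
  Expanding that direction in an orthonormal basis leaves fixed directions with varying
  coefficients, whence the finite-dimensional intermediate space.\<close>

lemma times_diff_compose:
  fixes g :: "'b::fin_euclidean \<Rightarrow> 'c::real_normed_vector"
  assumes "open S" "open T" "\<And>x. x \<in> S \<Longrightarrow> f x \<in> T"
    "times_differentiable_on k S f" "times_differentiable_on k T g"
  shows "times_differentiable_on k S (\<lambda>x. g (f x))"
  using assms(4,5)
proof (induction k arbitrary: g)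
  case 0
  then show ?case using assms(3) by (auto intro: continuous_on_compose2)
next
  case (Suc k)
  have D: "((\<lambda>x. g (f x)) has_derivative (\<lambda>v. \<Sum>b\<in>orthobasis.
      inner (frechet_derivative f (at x) v) b *\<^sub>R frechet_derivative g (at (f x)) b)) (at x)" if x: "x \<in> S" for x
  proof -
    let ?g' = "frechet_derivative g (at (f x))" and ?f' = "frechet_derivative f (at x)"
    have g': "(g has_derivative ?g') (at (f x))"
      using Suc.prems(2) assms(3)[OF x] by (rule times_diff_SucD)
    have l: "linear ?g'"
      using g' has_derivative_linear by blast
    have "?g' (?f' v) = (\<Sum>b\<in>orthobasis. inner (?f' v) b *\<^sub>R ?g' b)" for v
      by (subst orthobasis_expansion[of "?f' v", symmetric]) (simp only: linear_sum[OF l] linear_scale[OF l])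
    then show ?thesis
      using has_derivative_compose[OF times_diff_SucD(1)[OF Suc.prems(1) x] g'] by simp
  qed
  show ?case
  proof (rule times_diff_SucI[OF assms(1) D])
    fix v
    show "times_differentiable_on k S (\<lambda>x. \<Sum>b\<in>orthobasis.
      inner (frechet_derivative f (at x) v) b *\<^sub>R frechet_derivative g (at (f x)) b)"
    proof (rule times_diff_sum[OF assms(1)])
      fix b
      show "times_differentiable_on k S
          (\<lambda>x. inner (frechet_derivative f (at x) v) b *\<^sub>R frechet_derivative g (at (f x)) b)"
        by (rule times_diff_bilinear[OF assms(1) bounded_bilinear_scaleR
              times_diff_bounded_linear[OF assms(1) bounded_linear_inner_left
                times_diff_SucD(2)[OF Suc.prems(1)]]
              Suc.IH[OF times_diff_less[OF Suc.prems(1)] times_diff_SucD(2)[OF Suc.prems(2)]]])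
    qed
  qed
qed

lemma times_diff_inverse:
  fixes f :: "'a::real_normed_vector \<Rightarrow> real"
  assumes "open S" "\<And>x. x \<in> S \<Longrightarrow> f x \<noteq> 0" "times_differentiable_on k S f"
  shows "times_differentiable_on k S (\<lambda>x. inverse (f x))"
  using assms(3)
proof (induction k)
  case (Suc k)
  have D: "((\<lambda>x. inverse (f x)) has_derivative
      (\<lambda>v. - (inverse (f x) * frechet_derivative f (at x) v * inverse (f x)))) (at x)" if "x \<in> S" for x
    using Deriv.has_derivative_inverse[OF assms(2)[OF that] times_diff_SucD(1)[OF Suc.prems that]] .
  show ?case
    by (rule times_diff_SucI[OF assms(1) D], assumption)
      (intro times_diff_bounded_linear[OF assms(1) bounded_linear_minus[OF bounded_linear_ident]]
        times_diff_bilinear[OF assms(1) bounded_bilinear_mult] Suc.IH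
        times_diff_less[OF Suc.prems] times_diff_SucD(2)[OF Suc.prems])
qed (auto intro!: continuous_intros assms(2))

section \<open>Closure properties of smooth maps\<close>

lemma smooth_on_cong:
  "open S \<Longrightarrow> (\<And>x. x \<in> S \<Longrightarrow> f x = g x) \<Longrightarrow> smooth_on S f \<Longrightarrow> smooth_on S g"
  unfolding smooth_on_def by (blast intro: times_diff_cong)

lemma smooth_on_subset: "smooth_on S f \<Longrightarrow> T \<subseteq> S \<Longrightarrow> smooth_on T f"
  unfolding smooth_on_def by (blast intro: times_diff_subset)

lemma smooth_on_local:
  "(\<And>x. x \<in> S \<Longrightarrow> \<exists>T. open T \<and> x \<in> T \<and> smooth_on T f) \<Longrightarrow> smooth_on S f"
  unfolding smooth_on_def by (rule allI, rule times_diff_local) blast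

lemma smooth_on_imp_continuous_on: "smooth_on S f \<Longrightarrow> continuous_on S f"
  unfolding smooth_on_def by (blast intro: times_diff_continuous)

lemma smooth_on_has_derivative:
  "smooth_on S f \<Longrightarrow> x \<in> S \<Longrightarrow> (f has_derivative frechet_derivative f (at x)) (at x)"
  unfolding smooth_on_def by (blast intro: times_diff_SucD)

lemma smooth_on_frechet_derivative:
  "smooth_on S f \<Longrightarrow> smooth_on S (\<lambda>x. frechet_derivative f (at x) v)"
  unfolding smooth_on_def by (blast intro: times_diff_SucD)

named_theorems smooth_intros

lemma smooth_on_const [smooth_intros]: "open S \<Longrightarrow> smooth_on S (\<lambda>x. c)"
  unfolding smooth_on_def by (blast intro: times_diff_const)

lemma smooth_on_add [smooth_intros]:
  "open S \<Longrightarrow> smooth_on S f \<Longrightarrow> smooth_on S g \<Longrightarrow> smooth_on S (\<lambda>x. f x + g x)"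
  unfolding smooth_on_def by (blast intro: times_diff_add)

lemma smooth_on_sum [smooth_intros]:
  "open S \<Longrightarrow> (\<And>i. i \<in> I \<Longrightarrow> smooth_on S (f i)) \<Longrightarrow> smooth_on S (\<lambda>x. \<Sum>i\<in>I. f i x)"
  unfolding smooth_on_def by (blast intro: times_diff_sum)

lemma smooth_on_bounded_linear:
  "open S \<Longrightarrow> bounded_linear h \<Longrightarrow> smooth_on S f \<Longrightarrow> smooth_on S (\<lambda>x. h (f x))"
  unfolding smooth_on_def by (blast intro: times_diff_bounded_linear)

lemma smooth_on_bilinear:
  "open S \<Longrightarrow> bounded_bilinear h \<Longrightarrow> smooth_on S f \<Longrightarrow> smooth_on S g \<Longrightarrow> smooth_on S (\<lambda>x. h (f x) (g x))"
  unfolding smooth_on_def by (blast intro: times_diff_bilinear)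

lemma smooth_on_compose:
  fixes g :: "'b::fin_euclidean \<Rightarrow> 'c::real_normed_vector"
  shows "open S \<Longrightarrow> open T \<Longrightarrow> (\<And>x. x \<in> S \<Longrightarrow> f x \<in> T) \<Longrightarrow> smooth_on S f \<Longrightarrow> smooth_on T g \<Longrightarrow>
    smooth_on S (\<lambda>x. g (f x))"
  unfolding smooth_on_def by (blast intro: times_diff_compose)

lemma smooth_on_inverse [smooth_intros]:
  fixes f :: "'a::real_normed_vector \<Rightarrow> real"
  shows "open S \<Longrightarrow> smooth_on S f \<Longrightarrow> (\<And>x. x \<in> S \<Longrightarrow> f x \<noteq> 0) \<Longrightarrow> smooth_on S (\<lambda>x. inverse (f x))"
  unfolding smooth_on_def by (blast intro: times_diff_inverse)

lemma smooth_on_id [smooth_intros]: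
  assumes "open S"
  shows "smooth_on S (\<lambda>x. x)"
  unfolding smooth_on_def
proof
  fix k show "times_differentiable_on k S (\<lambda>x. x)"
  proof (cases k)
    case (Suc j)
    show ?thesis unfolding Suc
      by (rule times_diff_SucI[OF assms has_derivative_ident])
        (rule times_diff_const[OF assms])
  qed simp
qed

lemma smooth_on_mult [smooth_intros]:
  fixes f g :: "'a::real_normed_vector \<Rightarrow> real"
  shows "open S \<Longrightarrow> smooth_on S f \<Longrightarrow> smooth_on S g \<Longrightarrow> smooth_on S (\<lambda>x. f x * g x)"
  by (rule smooth_on_bilinear[OF _ bounded_bilinear_mult])

lemma smooth_on_scaleR [smooth_intros]:
  "open S \<Longrightarrow> smooth_on S f \<Longrightarrow> smooth_on S g \<Longrightarrow> smooth_on S (\<lambda>x. f x *\<^sub>R g x)"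
  by (rule smooth_on_bilinear[OF _ bounded_bilinear_scaleR])

lemma smooth_on_inner [smooth_intros]:
  "open S \<Longrightarrow> smooth_on S f \<Longrightarrow> smooth_on S g \<Longrightarrow> smooth_on S (\<lambda>x. inner (f x) (g x))"
  by (rule smooth_on_bilinear[OF _ bounded_bilinear_inner])

lemma smooth_on_minus [smooth_intros]: "open S \<Longrightarrow> smooth_on S f \<Longrightarrow> smooth_on S (\<lambda>x. - f x)"
  by (rule smooth_on_bounded_linear[OF _ bounded_linear_minus[OF bounded_linear_ident]])

lemma smooth_on_diff [smooth_intros]:
  "open S \<Longrightarrow> smooth_on S f \<Longrightarrow> smooth_on S g \<Longrightarrow> smooth_on S (\<lambda>x. f x - g x)"
  using smooth_on_add[of S f "\<lambda>x. - g x"] smooth_on_minus[of S g] by simp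

lemma smooth_on_fst [smooth_intros]: "open S \<Longrightarrow> smooth_on S f \<Longrightarrow> smooth_on S (\<lambda>x. fst (f x))"
  by (rule smooth_on_bounded_linear[OF _ bounded_linear_fst])

lemma smooth_on_snd [smooth_intros]: "open S \<Longrightarrow> smooth_on S f \<Longrightarrow> smooth_on S (\<lambda>x. snd (f x))"
  by (rule smooth_on_bounded_linear[OF _ bounded_linear_snd])

lemma smooth_on_Pair [smooth_intros]:
  assumes "open S" "smooth_on S f" "smooth_on S g"
  shows "smooth_on S (\<lambda>x. (f x, g x))"
proof -
  have "smooth_on S (\<lambda>x. (f x, 0) + (0, g x))"
    by (intro smooth_on_add smooth_on_bounded_linear[where h="\<lambda>y. (y, 0)"]
        smooth_on_bounded_linear[where h="\<lambda>y. (0, y)"] assms bounded_linear_Pair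
        bounded_linear_ident bounded_linear_zero)
  then show ?thesis by simp
qed


section \<open>Hadamard's lemma\<close>

lemma has_derivative_orthobasis:
  fixes f :: "'a::fin_euclidean \<Rightarrow> 'b::real_normed_vector"
  assumes "(f has_derivative f') F"
  shows "f' v = (\<Sum>b\<in>orthobasis. inner v b *\<^sub>R f' b)"
proof -
  have l: "linear f'" using assms has_derivative_linear by blast
  show ?thesis
    by (subst orthobasis_expansion[of v, symmetric]) (simp only: linear_sum[OF l] linear_scale[OF l])
qed

lemma ball_shrink:
  fixes z0 :: "'a::real_normed_vector"
  assumes "x \<in> ball z0 r" "t \<in> {0..1}"
  shows "z0 + t *\<^sub>R (x - z0) \<in> ball z0 r"
proof -
  have "norm (t *\<^sub>R (x - z0)) \<le> norm (x - z0)"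
    using assms(2) by (simp add: mult_left_le_one_le)
  also have "\<dots> < r"
    using assms(1) by (simp add: dist_norm norm_minus_commute)
  finally show ?thesis by (simp add: dist_norm)
qed

text \<open>The weight \<open>t ^ m\<close> closes the family under differentiation: the chain rule
  along the ray contributes one further factor \<open>t\<close>, so a directional derivative is the
  same kind of integral, with \<open>m + 1\<close> and a directional derivative of
  \<open>h\<close>.\<close>

lemma smooth_on_ray_integral:
  fixes h :: "'a::fin_euclidean \<Rightarrow> real"
  assumes "smooth_on (ball z0 r) h"
  shows "smooth_on (ball z0 r) (\<lambda>x. integral {0..1} (\<lambda>t. t ^ m * h (z0 + t *\<^sub>R (x - z0))))"
proof -
  let ?I = "\<lambda>m h x. integral {0..1} (\<lambda>t::real. t ^ m * h (z0 + t *\<^sub>R (x - z0)))"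
  have cont: "continuous_on (ball z0 r \<times> {0..1}) (\<lambda>(x, t). t ^ m * h (z0 + t *\<^sub>R (x - z0)))"
    if "smooth_on (ball z0 r) h" for m and h :: "'a \<Rightarrow> real"
    unfolding split_beta
    by (intro continuous_intros continuous_on_compose2[OF smooth_on_imp_continuous_on[OF that]])
      (auto intro!: ball_shrink simp del: mem_ball)
  have deriv: "(?I m h has_derivative (\<lambda>v. ?I (Suc m) (\<lambda>z. frechet_derivative h (at z) v) x)) (at x)"
    if h: "smooth_on (ball z0 r) h" and x: "x \<in> ball z0 r" for m x and h :: "'a \<Rightarrow> real"
  proof -
    let ?D = "\<lambda>x t v. t ^ Suc m * frechet_derivative h (at (z0 + t *\<^sub>R (x - z0))) v"
    \<comment> \<open>\<open>leibniz_rule\<close> wants the derivative as a bounded linear map that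
      is continuous in both parameters; it is assembled from the coordinate functionals.\<close>
    let ?B = "\<lambda>x t. \<Sum>b\<in>orthobasis. ?D x t b *\<^sub>R blinfun_inner_left b"
    have app: "blinfun_apply (?B x t) v = ?D x t v" if "x \<in> ball z0 r" "t \<in> {0..1}" for x t v
      using has_derivative_orthobasis[OF smooth_on_has_derivative[OF h ball_shrink[OF that]], of v]
      by (simp add: blinfun.sum_left blinfun.scaleR_left sum_distrib_left mult_ac inner_commute)
    have D: "(?I m h has_derivative integral (cbox 0 1) (?B x)) (at x within ball z0 r)"
      unfolding cbox_interval[symmetric]
    proof (rule leibniz_rule)
      fix y t assume y: "y \<in> ball z0 r" and t: "t \<in> cbox (0::real) 1"
      have "((\<lambda>x. t ^ m * h (z0 + t *\<^sub>R (x - z0))) has_derivative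
          (\<lambda>v. t ^ m * frechet_derivative h (at (z0 + t *\<^sub>R (y - z0))) (t *\<^sub>R v))) (at y)"
      proof -
        have "((\<lambda>x. z0 + t *\<^sub>R (x - z0)) has_derivative (\<lambda>v. t *\<^sub>R v)) (at y)"
          by (auto intro!: derivative_eq_intros)
        from has_derivative_compose[where f="\<lambda>x. z0 + t *\<^sub>R (x - z0)", OF this smooth_on_has_derivative[OF h ball_shrink[OF y]]]
        show ?thesis
          using t by (intro has_derivative_mult_right) auto
      qed
      moreover have "t ^ m * frechet_derivative h (at (z0 + t *\<^sub>R (y - z0))) (t *\<^sub>R v) = ?B y t v" for v
        using app[OF y, of t v] t
          has_derivative_linear[OF smooth_on_has_derivative[OF h ball_shrink[OF y]], of t]
        by (simp add: linear_scale)
      ultimately show "((\<lambda>x. t ^ m * h (z0 + t *\<^sub>R (x - z0))) has_derivative blinfun_apply (?B y t))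
          (at y within ball z0 r)"
        by (auto intro: has_derivative_at_withinI)
    next
      fix y assume y: "y \<in> ball z0 r"
      show "(\<lambda>t. t ^ m * h (z0 + t *\<^sub>R (y - z0))) integrable_on cbox 0 1"
        using y by (intro integrable_continuous continuous_on_compose2[OF cont[OF h], of _ "\<lambda>t. (y, t)", simplified split_conv])
          (auto intro!: continuous_intros)
    next
      have "continuous_on (ball z0 r \<times> cbox 0 1)
          (\<lambda>p. (\<lambda>(x, t). t ^ Suc m * frechet_derivative h (at (z0 + t *\<^sub>R (x - z0))) b) p *\<^sub>R blinfun_inner_left b)" for b
        using cont[OF smooth_on_frechet_derivative[OF h, of b], of "Suc m"]
        by (intro continuous_intros) (simp del: power_Suc)
      then have "continuous_on (ball z0 r \<times> cbox 0 1)
          (\<lambda>p. \<Sum>b\<in>orthobasis. (\<lambda>(x, t). t ^ Suc m * frechet_derivative h (at (z0 + t *\<^sub>R (x - z0))) b) p *\<^sub>R blinfun_inner_left b)"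
        by (intro continuous_on_sum)
      then show "continuous_on (ball z0 r \<times> cbox 0 1) (\<lambda>(x, t). ?B x t)"
        by (simp add: split_beta)
    qed (use x in auto)
    have app': "blinfun_apply (integral (cbox 0 1) (?B x)) v = ?I (Suc m) (\<lambda>z. frechet_derivative h (at z) v) x" for v
    proof -
      have "?B x integrable_on cbox 0 1"
      proof (rule integrable_continuous, intro continuous_on_sum continuous_intros)
        fix b
        show "continuous_on (cbox 0 1) (\<lambda>t. frechet_derivative h (at (z0 + t *\<^sub>R (x - z0))) b)"
          using x by (intro continuous_on_compose2[OF smooth_on_imp_continuous_on[OF smooth_on_frechet_derivative[OF h]]])
            (auto intro!: ball_shrink continuous_intros simp del: mem_ball)
      qed
      then have "blinfun_apply (integral (cbox 0 1) (?B x)) v = integral (cbox 0 1) (\<lambda>t. blinfun_apply (?B x t) v)"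
        by (subst integral_linear[symmetric, OF _ blinfun.bounded_linear_left[of v]]) (auto simp: o_def)
      also have "\<dots> = integral (cbox 0 1) (\<lambda>t. ?D x t v)"
        using x by (intro integral_cong app) auto
      finally show ?thesis by simp
    qed
    show ?thesis
      by (rule has_derivative_eq_rhs[OF D[unfolded at_within_open[OF x open_ball]] ext[OF app']])
  qed
  have "times_differentiable_on k (ball z0 r) (?I m h)" if "smooth_on (ball z0 r) h" for k m and h :: "'a \<Rightarrow> real"
    using that
  proof (induction k arbitrary: m h)
    case 0
    show ?case
      using integral_continuous_on_param[OF cont[OF 0, unfolded cbox_interval[symmetric]]]
      by (simp add: cbox_interval)
  next
    case (Suc k)
    show ?case
      by (rule times_diff_SucI[OF open_ball deriv[OF Suc.prems]])
        (auto intro!: Suc.IH smooth_on_frechet_derivative Suc.prems simp del: power_Suc)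
  qed
  then show ?thesis
    using assms by (simp add: smooth_on_def)
qed

text \<open>Integrate the derivative of \<open>F\<close> along the segment from \<open>z0\<close> to
  \<open>z\<close> and expand the direction \<open>z - z0\<close> in the basis.\<close>

lemma hadamard:
  fixes F :: "'a::fin_euclidean \<Rightarrow> real"
  assumes F: "smooth_on (ball z0 r) F"
  obtains G :: "'a \<Rightarrow> 'a \<Rightarrow> real" where "\<And>b. smooth_on (ball z0 r) (G b)"
    "\<And>z. z \<in> ball z0 r \<Longrightarrow> F z = F z0 + (\<Sum>b\<in>orthobasis. inner (z - z0) b * G b z)"
proof
  \<comment> \<open>The factor \<open>t ^ 0\<close> is kept so that the coefficients are literally
    ray integrals with exponent 0.\<close>
  let ?G = "\<lambda>b z. integral {0..1} (\<lambda>t. t ^ 0 * frechet_derivative F (at (z0 + t *\<^sub>R (z - z0))) b)"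
  show "smooth_on (ball z0 r) (?G b)" for b
    by (rule smooth_on_ray_integral[OF smooth_on_frechet_derivative[OF F]])
  fix z assume z: "z \<in> ball z0 r"
  let ?D = "\<lambda>t. frechet_derivative F (at (z0 + t *\<^sub>R (z - z0)))"
  have "((\<lambda>t. F (z0 + t *\<^sub>R (z - z0))) has_vector_derivative ?D t (z - z0)) (at t within {0..1})"
    if t: "t \<in> {0..1}" for t
  proof -
    have "((\<lambda>t. F (z0 + t *\<^sub>R (z - z0))) has_derivative (\<lambda>s. ?D t (s *\<^sub>R (z - z0)))) (at t within {0..1})"
      by (rule has_derivative_compose[where f="\<lambda>t. z0 + t *\<^sub>R (z - z0)", OF _ smooth_on_has_derivative[OF F ball_shrink[OF z t]]])
        (auto intro!: derivative_eq_intros)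
    then show ?thesis
      using has_derivative_linear[OF smooth_on_has_derivative[OF F ball_shrink[OF z t]]]
      by (simp add: has_vector_derivative_def linear_scale)
  qed
  then have "((\<lambda>t. ?D t (z - z0)) has_integral F (z0 + 1 *\<^sub>R (z - z0)) - F (z0 + 0 *\<^sub>R (z - z0))) {0..1}"
    by (intro fundamental_theorem_of_calculus) auto
  then have "F z - F z0 = integral {0..1} (\<lambda>t. ?D t (z - z0))"
    by (simp add: integral_unique)
  also have "\<dots> = integral {0..1} (\<lambda>t. \<Sum>b\<in>orthobasis. inner (z - z0) b *\<^sub>R ?D t b)"
    by (intro integral_cong has_derivative_orthobasis[OF smooth_on_has_derivative[OF F ball_shrink[OF z]]])
  also have "\<dots> = (\<Sum>b\<in>orthobasis. integral {0..1} (\<lambda>t. inner (z - z0) b *\<^sub>R ?D t b))"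
  proof (intro integral_sum integrable_cmul)
    fix b :: 'a
    have "continuous_on (cbox 0 1) (\<lambda>t. ?D t b)"
      using z by (intro continuous_on_compose2[OF smooth_on_imp_continuous_on[OF smooth_on_frechet_derivative[OF F]]])
        (auto intro!: ball_shrink continuous_intros simp del: mem_ball)
    then show "(\<lambda>t. ?D t b) integrable_on {0..1}"
      using integrable_continuous by fastforce
  qed simp
  finally show "F z = F z0 + (\<Sum>b\<in>orthobasis. inner (z - z0) b * ?G b z)"
    by simp
qed


section \<open>Bump functions\<close>

text \<open>For \<open>n = 0\<close> this is the standard smooth function that is flat at 0; the powers occur in its
  derivatives.\<close>

definition flat :: "nat \<Rightarrow> real \<Rightarrow> real" where
  "flat n t = (if t \<le> 0 then 0 else exp (- inverse t) * inverse t ^ n)"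

lemma flat_tendsto_0: "(flat n \<longlongrightarrow> 0) (at 0)"
proof -
  have "((\<lambda>x::real. x ^ n / exp x) \<longlongrightarrow> 0) at_top"
    by (rule tendsto_power_div_exp_0)
  then have "((\<lambda>t::real. inverse t ^ n / exp (inverse t)) \<longlongrightarrow> 0) (at_right 0)"
    by (rule filterlim_compose[OF _ filterlim_inverse_at_top_right])
  then have "(flat n \<longlongrightarrow> 0) (at_right 0)"
    by (rule Lim_transform_eventually)
      (auto simp: flat_def eventually_at_right_less exp_minus field_simps intro!: eventually_mono[OF eventually_at_right_less])
  moreover have "(flat n \<longlongrightarrow> 0) (at_left 0)"
    by (rule Lim_transform_eventually[OF tendsto_const])
      (auto simp: flat_def intro!: eventually_mono[OF eventually_at_left_real[of "-1"]])
  ultimately show ?thesis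
    by (simp add: filterlim_split_at)
qed

text \<open>The exponential contributes \<open>inverse t ^ 2\<close>, the power
  \<open>inverse t ^ n\<close> the second term; the family is closed under differentiation,
  including at 0.\<close>

lemma flat_has_real_derivative:
  "(flat n has_real_derivative flat (n + 2) t - real n * flat (n + 1) t) (at t)"
proof (cases t "0::real" rule: linorder_cases)
  case less
  have "((\<lambda>t. 0) has_real_derivative 0) (at t)" by simp
  then have "(flat n has_real_derivative 0) (at t)"
    by (rule has_field_derivative_transform_within_open[of _ _ _ "{..<0}"]) (use less in \<open>auto simp: flat_def\<close>)
  then show ?thesis using less by (simp add: flat_def)
next
  case equal
  \<comment> \<open>Division by \<open>h\<close> just raises the exponent, so the difference
    quotient at 0 is again a flat function.\<close>
  have "(\<lambda>h. (flat n h - flat n 0) / h) = (\<lambda>h. flat (n + 1) h)"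
    by (auto simp: flat_def field_simps)
  then have "(flat n has_real_derivative 0) (at 0)"
    unfolding DERIV_def using flat_tendsto_0[of "n + 1"] by simp
  then show ?thesis using equal by (simp add: flat_def)
next
  case greater
  have "((\<lambda>t. exp (- inverse t) * inverse t ^ n) has_real_derivative
      exp (- inverse t) * inverse t ^ (n + 2) - real n * (exp (- inverse t) * inverse t ^ (n + 1))) (at t)"
  proof -
    have "((\<lambda>t. exp (- inverse t) * inverse t ^ n) has_real_derivative
        exp (- inverse t) * inverse t ^ 2 * inverse t ^ n +
        exp (- inverse t) * (real n * inverse t ^ (n - 1) * - (inverse t ^ 2))) (at t)"
      using greater by (auto intro!: derivative_eq_intros simp: power2_eq_square)
    also have "exp (- inverse t) * inverse t ^ 2 * inverse t ^ n +
        exp (- inverse t) * (real n * inverse t ^ (n - 1) * - (inverse t ^ 2)) =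
        exp (- inverse t) * inverse t ^ (n + 2) - real n * (exp (- inverse t) * inverse t ^ (n + 1))"
      by (cases n) (simp_all add: power2_eq_square algebra_simps)
    finally show ?thesis .
  qed
  then have "(flat n has_real_derivative
      exp (- inverse t) * inverse t ^ (n + 2) - real n * (exp (- inverse t) * inverse t ^ (n + 1))) (at t)"
    by (rule has_field_derivative_transform_within_open[of _ _ _ "{0<..}"]) (use greater in \<open>auto simp: flat_def\<close>)
  then show ?thesis using greater by (simp add: flat_def)
qed

lemma smooth_on_flat: "smooth_on UNIV (flat n)"
proof -
  have "times_differentiable_on k UNIV (flat n)" for k
  proof (induction k arbitrary: n)
    case 0
    show ?case
      using DERIV_isCont[OF flat_has_real_derivative] by (simp add: continuous_at_imp_continuous_on)
  next
    case (Suc k)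
    show ?case
    proof (rule times_diff_SucI)
      show "(flat n has_derivative (\<lambda>v. (flat (n + 2) t + (- real n) * flat (n + 1) t) * v)) (at t)" for t
        using flat_has_real_derivative[of n t] by (simp add: has_field_derivative_def)
      show "times_differentiable_on k UNIV (\<lambda>t. (flat (n + 2) t + (- real n) * flat (n + 1) t) * v)" for v
        by (intro times_diff_bilinear[OF _ bounded_bilinear_mult] times_diff_add
            times_diff_const Suc.IH open_UNIV)
    qed simp
  qed
  then show ?thesis by (simp add: smooth_on_def)
qed

lemma bump_exists:
  fixes z0 :: "'a::fin_euclidean"
  assumes "r > 0"
  obtains \<beta> :: "'a \<Rightarrow> real" where "smooth_on UNIV \<beta>" "\<beta> z0 = 1" "\<And>z. z \<notin> ball z0 r \<Longrightarrow> \<beta> z = 0"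
proof
  \<comment> \<open>The argument is positive exactly on the open ball, and \<open>flat\<close>
    vanishes on nonpositive numbers; division by the value at the centre normalises.\<close>
  let ?e = "\<lambda>z. flat 0 (r\<^sup>2 - inner (z - z0) (z - z0))"
  let ?b = "\<lambda>z. inverse (?e z0) * ?e z"
  show "smooth_on UNIV ?b"
    by (intro smooth_intros smooth_on_compose[OF _ _ _ _ smooth_on_flat]) auto
  show "?b z0 = 1"
    using assms by (simp add: flat_def)
  fix z assume "z \<notin> ball z0 r"
  then have "r\<^sup>2 \<le> (norm (z - z0))\<^sup>2"
    using assms by (intro power_mono) (auto simp: dist_norm norm_minus_commute)
  then show "?b z = 0"
    by (simp add: flat_def power2_norm_eq_inner)
qed


section \<open>Charts of the maximal atlas\<close>

text \<open>Charts compatible with the atlas without belonging to it. Restrictions of charts and the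
  charts induced by trivializations are of this kind.\<close>

definition local_chart ::
    "('m::topological_space, 'e::real_normed_vector) chart set \<Rightarrow> 'm set \<Rightarrow> ('m \<Rightarrow> 'e) \<Rightarrow> ('e \<Rightarrow> 'm) \<Rightarrow> bool" where
  "local_chart \<A> U \<phi> \<psi> \<longleftrightarrow> open U \<and> open (\<phi> ` U) \<and> homeomorphism U (\<phi> ` U) \<phi> \<psi> \<and>
     (\<forall>(V, k, k') \<in> \<A>. smooth_on (k ` (U \<inter> V)) (\<phi> \<circ> k') \<and> smooth_on (\<phi> ` (U \<inter> V)) (k \<circ> \<psi>))"

lemma local_chart_open: "local_chart \<A> U \<phi> \<psi> \<Longrightarrow> open U"
  and local_chart_inverse: "local_chart \<A> U \<phi> \<psi> \<Longrightarrow> y \<in> U \<Longrightarrow> \<psi> (\<phi> y) = y"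
  by (auto simp: local_chart_def homeomorphism_def)

lemma local_chart_open_image:
  assumes "local_chart \<A> U \<phi> \<psi>" "open N" "N \<subseteq> U"
  shows "open (\<phi> ` N)"
proof -
  have "\<phi> ` N = \<phi> ` U \<inter> \<psi> -` N"
    using assms(3) local_chart_inverse[OF assms(1)] by force
  then show ?thesis
    using assms by (auto simp: local_chart_def homeomorphism_def intro!: continuous_open_preimage)
qed

lemma local_chart_subset:
  assumes "local_chart \<A> U \<phi> \<psi>" "open N" "N \<subseteq> U"
  shows "local_chart \<A> N \<phi> \<psi>"
proof -
  have "homeomorphism N (\<phi> ` N) \<phi> \<psi>"
    using assms(1,3) by (auto simp: local_chart_def intro: homeomorphism_of_subsets)
  moreover have "\<phi> ` (N \<inter> V) \<subseteq> \<phi> ` (U \<inter> V)" "k ` (N \<inter> V) \<subseteq> k ` (U \<inter> V)" for V and k :: "'a \<Rightarrow> 'b"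
    using assms(3) by auto
  ultimately show ?thesis
    using assms(1,2) local_chart_open_image[OF assms]
    unfolding local_chart_def by (blast intro: smooth_on_subset)
qed

lemma smooth_atlas_local_chart:
  "smooth_atlas \<A> \<Longrightarrow> (U, \<phi>, \<psi>) \<in> \<A> \<Longrightarrow> local_chart \<A> U \<phi> \<psi>"
  unfolding smooth_atlas_def local_chart_def by (fastforce simp: Int_commute)

lemma smooth_atlas_chart_at:
  assumes "smooth_atlas \<A>"
  obtains U \<phi> \<psi> where "(U, \<phi>, \<psi>) \<in> \<A>" "x \<in> U" "local_chart \<A> U \<phi> \<psi>"
  using assms smooth_atlas_local_chart[OF assms] unfolding smooth_atlas_def by blast

lemma smooth_atlas_std: "smooth_atlas (std_atlas :: (real, real) chart set)"
  unfolding smooth_atlas_def std_atlas_def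
  using smooth_on_id[OF open_UNIV] by (auto simp: id_def o_def intro: homeomorphism_ident)

text \<open>Compatibility is only given against members of the atlas; near each point the transition
  factors through one of them.\<close>

lemma local_chart_transition:
  assumes "smooth_atlas \<A>" and U: "local_chart \<A> U \<phi> \<psi>" and V: "local_chart \<A> V k k'"
  shows "smooth_on (\<phi> ` (U \<inter> V)) (k \<circ> \<psi>)"
proof (rule smooth_on_local)
  fix z assume "z \<in> \<phi> ` (U \<inter> V)"
  then obtain y where y: "y \<in> U" "y \<in> V" "z = \<phi> y" by blast
  obtain W \<kappa> \<kappa>' where W: "(W, \<kappa>, \<kappa>') \<in> \<A>" "y \<in> W" "local_chart \<A> W \<kappa> \<kappa>'"
    by (rule smooth_atlas_chart_at[OF assms(1)])
  let ?N = "U \<inter> V \<inter> W"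
  have "open ?N" using U V W(3) by (auto dest: local_chart_open)
  then have oU: "open (\<phi> ` ?N)" and oW: "open (\<kappa> ` ?N)"
    using local_chart_open_image[OF U, of ?N] local_chart_open_image[OF W(3), of ?N] by auto
  have "smooth_on (\<phi> ` (U \<inter> W)) (\<kappa> \<circ> \<psi>)" "smooth_on (\<kappa> ` (V \<inter> W)) (k \<circ> \<kappa>')"
    using U V W(1) unfolding local_chart_def by auto
  then have "smooth_on (\<phi> ` ?N) (\<kappa> \<circ> \<psi>)" "smooth_on (\<kappa> ` ?N) (k \<circ> \<kappa>')"
    by (auto elim!: smooth_on_subset)
  then have "smooth_on (\<phi> ` ?N) (\<lambda>z. (k \<circ> \<kappa>') ((\<kappa> \<circ> \<psi>) z))"
    by (rule smooth_on_compose[OF oU oW, rotated]) (use local_chart_inverse[OF U] in auto)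
  then have "smooth_on (\<phi> ` ?N) (k \<circ> \<psi>)"
    by (rule smooth_on_cong[OF oU, rotated]) (auto simp: local_chart_inverse[OF U] local_chart_inverse[OF W(3)])
  then show "\<exists>T. open T \<and> z \<in> T \<and> smooth_on T (k \<circ> \<psi>)"
    using y W(2) oU by blast
qed

lemma local_chart_change:
  assumes A: "smooth_atlas \<A>" and U: "local_chart \<A> U \<phi> \<psi>" and V: "local_chart \<A> V k k'"
    and B: "smooth_atlas \<B>" and U': "local_chart \<B> U' \<phi>' \<psi>'" and V': "local_chart \<B> V' \<kappa> \<kappa>'"
    and N: "open N" "N \<subseteq> U \<inter> V" "f ` N \<subseteq> U' \<inter> V'"
    and f: "smooth_on (\<phi> ` N) (\<phi>' \<circ> f \<circ> \<psi>)"
  shows "smooth_on (k ` N) (\<kappa> \<circ> f \<circ> k')"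
proof -
  have o: "open (\<phi> ` N)" "open (k ` N)" "open (\<phi>' ` (U' \<inter> V'))"
    using N U U' V V' by (auto intro!: local_chart_open_image[OF U] local_chart_open_image[OF V]
        local_chart_open_image[OF U'] dest: local_chart_open)
  have "smooth_on (k ` N) (\<phi> \<circ> k')"
    using local_chart_transition[OF A V U] N(2) by (auto intro: smooth_on_subset)
  then have "smooth_on (k ` N) (\<lambda>z. (\<phi>' \<circ> f \<circ> \<psi>) ((\<phi> \<circ> k') z))"
    by (rule smooth_on_compose[OF o(2,1) _ _ f, rotated]) (use N(2) local_chart_inverse[OF V] in auto)
  then have "smooth_on (k ` N) (\<lambda>z. (\<kappa> \<circ> \<psi>') ((\<phi>' \<circ> f \<circ> \<psi>) ((\<phi> \<circ> k') z)))"
    by (rule smooth_on_compose[OF o(2,3) _ _ local_chart_transition[OF B U' V'], rotated])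
      (use N(2,3) local_chart_inverse[OF V] local_chart_inverse[OF U] in fastforce)
  then show ?thesis
    using N(2,3) local_chart_inverse[OF V] local_chart_inverse[OF U] local_chart_inverse[OF U']
    by (elim smooth_on_cong[OF o(2), rotated]) fastforce
qed

text \<open>Near each point the expression in the given charts arises from the one in atlas charts
  by composing with smooth transitions on both sides.\<close>

lemma smooth_map_on_charts:
  assumes A: "smooth_atlas \<A>" and B: "smooth_atlas \<B>" and f: "smooth_map_on \<A> \<B> S f" and S: "open S"
    and U: "local_chart \<A> U \<phi> \<psi>" and U': "local_chart \<B> U' \<phi>' \<psi>'" and "U \<subseteq> S" "f ` U \<subseteq> U'"
  shows "smooth_on (\<phi> ` U) (\<phi>' \<circ> f \<circ> \<psi>)"
proof (rule smooth_on_local)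
  fix z assume "z \<in> \<phi> ` U"
  then obtain y where y: "y \<in> U" "z = \<phi> y" by blast
  obtain V k k' where V: "(V, k, k') \<in> \<A>" "y \<in> V" "local_chart \<A> V k k'"
    by (rule smooth_atlas_chart_at[OF A])
  obtain V' \<kappa> \<kappa>' where V': "(V', \<kappa>, \<kappa>') \<in> \<B>" "f y \<in> V'" "local_chart \<B> V' \<kappa> \<kappa>'"
    by (rule smooth_atlas_chart_at[OF B])
  define N where "N = U \<inter> V \<inter> (S \<inter> f -` V')"
  have oN: "open N"
    unfolding N_def using f S U V(3) V'(3)
    by (intro open_Int continuous_open_preimage) (auto simp: smooth_map_on_def dest: local_chart_open)
  have "smooth_on (k ` N) (\<kappa> \<circ> f \<circ> k')"
    using f V(1) V'(1) unfolding smooth_map_on_def N_def by (fast intro: smooth_on_subset)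
  then have "smooth_on (\<phi> ` N) (\<phi>' \<circ> f \<circ> \<psi>)"
    using assms(8) by (intro local_chart_change[OF A V(3) U B V'(3) U' oN]) (auto simp: N_def)
  then show "\<exists>T. open T \<and> z \<in> T \<and> smooth_on T (\<phi>' \<circ> f \<circ> \<psi>)"
    using y V(2) V'(2) assms(7) local_chart_open_image[OF U oN] unfolding N_def by blast
qed

text \<open>Continuity comes for free: near each point \<open>f\<close> is the smooth coordinate
  expression composed with a chart and an inverse chart.\<close>

lemma smooth_map_onI:
  assumes A: "smooth_atlas \<A>" and B: "smooth_atlas \<B>"
    and f: "\<And>y. y \<in> S \<Longrightarrow> \<exists>U \<phi> \<psi> U' \<phi>' \<psi>'. y \<in> U \<and> U \<subseteq> S \<and> local_chart \<A> U \<phi> \<psi> \<and>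
      local_chart \<B> U' \<phi>' \<psi>' \<and> f ` U \<subseteq> U' \<and> smooth_on (\<phi> ` U) (\<phi>' \<circ> f \<circ> \<psi>)"
  shows "smooth_map_on \<A> \<B> S f"
proof -
  have cont: "isCont f y" if y: "y \<in> S" for y
  proof -
    obtain U \<phi> \<psi> U' \<phi>' \<psi>' where U: "y \<in> U" "local_chart \<A> U \<phi> \<psi>" and U': "local_chart \<B> U' \<phi>' \<psi>'" "f ` U \<subseteq> U'"
      and sm: "smooth_on (\<phi> ` U) (\<phi>' \<circ> f \<circ> \<psi>)"
      using f[OF y] by metis
    have "continuous_on U (\<lambda>x. \<psi>' ((\<phi>' \<circ> f \<circ> \<psi>) (\<phi> x)))"
    proof (rule continuous_on_compose2[of "\<phi>' ` U'" \<psi>'])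
      show "continuous_on (\<phi>' ` U') \<psi>'"
        using U'(1) by (auto simp: local_chart_def homeomorphism_def)
      show "continuous_on U (\<lambda>x. (\<phi>' \<circ> f \<circ> \<psi>) (\<phi> x))"
        by (rule continuous_on_compose2[OF smooth_on_imp_continuous_on[OF sm]])
          (use U(2) in \<open>auto simp: local_chart_def homeomorphism_def\<close>)
    qed (use U'(2) local_chart_inverse[OF U(2)] in auto)
    then have "continuous_on U f"
      by (rule continuous_on_eq)
        (use U'(2) in \<open>auto simp: local_chart_inverse[OF U(2)] image_subset_iff local_chart_inverse[OF U'(1)]\<close>)
    then show ?thesis
      using U local_chart_open[OF U(2)] by (simp add: continuous_on_eq_continuous_at)
  qed
  have S: "open S"
    unfolding open_subopen[of S] using f local_chart_open by metis
  have "smooth_on (k ` (S \<inter> V \<inter> f -` V')) (\<kappa> \<circ> f \<circ> k')"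
    if VV: "(V, k, k') \<in> \<A>" "(V', \<kappa>, \<kappa>') \<in> \<B>" for V k k' V' \<kappa> \<kappa>'
  proof (rule smooth_on_local)
    note V = smooth_atlas_local_chart[OF A VV(1)] and V' = smooth_atlas_local_chart[OF B VV(2)]
    fix z assume "z \<in> k ` (S \<inter> V \<inter> f -` V')"
    then obtain y where y: "y \<in> S" "y \<in> V" "f y \<in> V'" "z = k y" by blast
    obtain U \<phi> \<psi> U' \<phi>' \<psi>' where U: "y \<in> U" "U \<subseteq> S" "local_chart \<A> U \<phi> \<psi>" and U': "local_chart \<B> U' \<phi>' \<psi>'" "f ` U \<subseteq> U'"
      and sm: "smooth_on (\<phi> ` U) (\<phi>' \<circ> f \<circ> \<psi>)"
      using f[OF y(1)] by metis
    define N where "N = U \<inter> V \<inter> (S \<inter> f -` V')"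
    have oN: "open N"
      unfolding N_def using cont S U(3) V V'
      by (intro open_Int continuous_open_preimage) (auto intro: continuous_at_imp_continuous_on dest: local_chart_open)
    have "smooth_on (k ` N) (\<kappa> \<circ> f \<circ> k')"
      using U'(2) by (intro local_chart_change[OF A U(3) V B U'(1) V' oN] smooth_on_subset[OF sm]) (auto simp: N_def)
    then show "\<exists>T. open T \<and> z \<in> T \<and> smooth_on T (\<kappa> \<circ> f \<circ> k')"
      using y U(1) local_chart_open_image[OF V oN] unfolding N_def by blast
  qed
  then show ?thesis
    unfolding smooth_map_on_def using cont by (auto intro: continuous_at_imp_continuous_on)
qed

section \<open>Algebra of smooth real functions\<close>

lemma local_chart_std: "local_chart (std_atlas :: (real, real) chart set) UNIV id id"
  by (rule smooth_atlas_local_chart[OF smooth_atlas_std]) (simp add: std_atlas_def)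

lemma smooth_real_mapD:
  assumes "smooth_atlas \<A>" "smooth_map_on \<A> std_atlas S c" "open S" "local_chart \<A> U \<phi> \<psi>" "U \<subseteq> S"
  shows "smooth_on (\<phi> ` U) (\<lambda>z. c (\<psi> z) :: real)"
  using smooth_map_on_charts[OF assms(1) smooth_atlas_std assms(2-4) local_chart_std assms(5)]
  by (simp add: o_def)

lemma smooth_real_mapI:
  fixes c :: "'m::{t2_space, second_countable_topology} \<Rightarrow> real"
  assumes "smooth_atlas \<A>"
    "\<And>y. y \<in> S \<Longrightarrow> \<exists>U \<phi> \<psi>. y \<in> U \<and> U \<subseteq> S \<and> local_chart \<A> U \<phi> \<psi> \<and> smooth_on (\<phi> ` U) (\<lambda>z. c (\<psi> z))"
  shows "smooth_map_on \<A> std_atlas S c"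
proof (rule smooth_map_onI[OF assms(1) smooth_atlas_std])
  fix y assume "y \<in> S"
  then obtain U \<phi> \<psi> where "y \<in> U" "U \<subseteq> S" "local_chart \<A> U \<phi> \<psi>" "smooth_on (\<phi> ` U) (\<lambda>z. c (\<psi> z))"
    using assms(2) by blast
  then show "\<exists>U \<phi> \<psi> U' \<phi>' \<psi>'. y \<in> U \<and> U \<subseteq> S \<and> local_chart \<A> U \<phi> \<psi> \<and>
      local_chart std_atlas U' \<phi>' \<psi>' \<and> c ` U \<subseteq> U' \<and> smooth_on (\<phi> ` U) (\<phi>' \<circ> c \<circ> \<psi>)"
    using local_chart_std by (intro exI[of _ U] exI[of _ \<phi>] exI[of _ \<psi>] exI[of _ UNIV] exI[of _ id]) (auto simp: o_def)
qed

lemma smooth_functionsD: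
  assumes "smooth_atlas \<A>" "c \<in> smooth_functions \<A>" "local_chart \<A> U \<phi> \<psi>"
  shows "smooth_on (\<phi> ` U) (\<lambda>z. c (\<psi> z))"
  using assms smooth_real_mapD[OF assms(1) _ open_UNIV assms(3)] by (auto simp: smooth_functions_def)

lemma smooth_functionsI:
  assumes "smooth_atlas \<A>"
    "\<And>y. \<exists>U \<phi> \<psi>. y \<in> U \<and> local_chart \<A> U \<phi> \<psi> \<and> smooth_on (\<phi> ` U) (\<lambda>z. c (\<psi> z))"
  shows "c \<in> smooth_functions \<A>"
  unfolding smooth_functions_def using assms(2) by (auto intro: smooth_real_mapI[OF assms(1)])

lemma smooth_functions_const: "smooth_atlas \<A> \<Longrightarrow> (\<lambda>x. k) \<in> smooth_functions \<A>"
  by (rule smooth_functionsI, assumption, erule smooth_atlas_chart_at)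
    (blast intro: smooth_on_const local_chart_open_image local_chart_open)

lemma
  assumes A: "smooth_atlas \<A>" and f: "f \<in> smooth_functions \<A>" and g: "g \<in> smooth_functions \<A>"
  shows smooth_functions_add: "(\<lambda>x. f x + g x) \<in> smooth_functions \<A>"
    and smooth_functions_mult: "(\<lambda>x. f x * g x) \<in> smooth_functions \<A>"
proof -
  have "\<exists>U \<phi> \<psi>. y \<in> U \<and> local_chart \<A> U \<phi> \<psi> \<and> smooth_on (\<phi> ` U) (\<lambda>z. f (\<psi> z) + g (\<psi> z))"
    "\<exists>U \<phi> \<psi>. y \<in> U \<and> local_chart \<A> U \<phi> \<psi> \<and> smooth_on (\<phi> ` U) (\<lambda>z. f (\<psi> z) * g (\<psi> z))" for y
  proof -
    obtain U \<phi> \<psi> where U: "(U, \<phi>, \<psi>) \<in> \<A>" "y \<in> U" "local_chart \<A> U \<phi> \<psi>"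
      by (rule smooth_atlas_chart_at[OF A])
    note s = smooth_functionsD[OF A f U(3)] smooth_functionsD[OF A g U(3)]
      local_chart_open_image[OF U(3) local_chart_open[OF U(3)] order_refl]
    show "\<exists>U \<phi> \<psi>. y \<in> U \<and> local_chart \<A> U \<phi> \<psi> \<and> smooth_on (\<phi> ` U) (\<lambda>z. f (\<psi> z) + g (\<psi> z))"
      "\<exists>U \<phi> \<psi>. y \<in> U \<and> local_chart \<A> U \<phi> \<psi> \<and> smooth_on (\<phi> ` U) (\<lambda>z. f (\<psi> z) * g (\<psi> z))"
      using U(2,3) smooth_on_add[OF s(3,1,2)] smooth_on_mult[OF s(3,1,2)] by blast+
  qed
  then show "(\<lambda>x. f x + g x) \<in> smooth_functions \<A>" "(\<lambda>x. f x * g x) \<in> smooth_functions \<A>"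
    by (auto intro: smooth_functionsI[OF A])
qed

lemma smooth_functions_sum:
  assumes "smooth_atlas \<A>" "\<And>i. i \<in> I \<Longrightarrow> f i \<in> smooth_functions \<A>"
  shows "(\<lambda>x. \<Sum>i\<in>I. f i x) \<in> smooth_functions \<A>"
  using assms(2)
  by (induction I rule: infinite_finite_induct)
    (auto intro: smooth_functions_const[OF assms(1)] smooth_functions_add[OF assms(1)])

section \<open>Bump functions and cutoffs on manifolds\<close>

text \<open>Vanishing outside \<open>U\<close> would not make an extension by zero smooth at the
  boundary of \<open>U\<close>; the closed set \<open>K\<close> leaves an open neighbourhood there
  on which the function is zero.\<close>

definition supported_in :: "('m::topological_space \<Rightarrow> real) \<Rightarrow> 'm set \<Rightarrow> bool" where
  "supported_in f U \<longleftrightarrow> (\<exists>K. closed K \<and> K \<subseteq> U \<and> (\<forall>x. x \<notin> K \<longrightarrow> f x = 0))"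

lemma supported_inD: "supported_in f U \<Longrightarrow> x \<notin> U \<Longrightarrow> f x = 0"
  by (auto simp: supported_in_def)

text \<open>Away from \<open>U\<close> use an atlas chart with the closed support removed, where the
  function is constantly zero.\<close>

lemma smooth_if_supported_in_chart:
  assumes A: "smooth_atlas \<A>" and U: "local_chart \<A> U \<phi> \<psi>" and f: "supported_in f U"
    and sm: "smooth_on (\<phi> ` U) (\<lambda>z. f (\<psi> z))"
  shows "f \<in> smooth_functions \<A>"
proof (rule smooth_functionsI[OF A])
  fix y
  show "\<exists>U \<phi> \<psi>. y \<in> U \<and> local_chart \<A> U \<phi> \<psi> \<and> smooth_on (\<phi> ` U) (\<lambda>z. f (\<psi> z))"
  proof (cases "y \<in> U")
    case False
    obtain K where K: "closed K" "K \<subseteq> U" "\<And>x. x \<notin> K \<Longrightarrow> f x = 0"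
      using f by (auto simp: supported_in_def)
    obtain V k k' where V: "(V, k, k') \<in> \<A>" "y \<in> V" "local_chart \<A> V k k'"
      by (rule smooth_atlas_chart_at[OF A])
    have V': "local_chart \<A> (V - K) k k'"
      using V(3) K(1) by (auto intro!: local_chart_subset[OF V(3)] open_Diff dest: local_chart_open)
    have o: "open (k ` (V - K))" using V' by (auto simp: local_chart_def)
    have "smooth_on (k ` (V - K)) (\<lambda>z. f (k' z))"
      by (rule smooth_on_cong[OF o _ smooth_on_const[OF o, of 0]])
        (auto simp: local_chart_inverse[OF V(3)] K(3))
    with V' V(2) False K(2) show ?thesis by blast
  qed (use U sm in blast)
qed

text \<open>Turns a function known only in coordinates into a global one. Off \<open>U\<close> the
  values of \<open>G (\<phi> x)\<close> are arbitrary, but they are multiplied by 0.\<close>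

lemma smooth_cutoff:
  assumes A: "smooth_atlas \<A>" and \<beta>: "\<beta> \<in> smooth_functions \<A>" "supported_in \<beta> U"
    and U: "local_chart \<A> U \<phi> \<psi>" and G: "smooth_on (\<phi> ` U) G"
  shows "(\<lambda>x. \<beta> x * G (\<phi> x)) \<in> smooth_functions \<A>"
proof (rule smooth_if_supported_in_chart[OF A U])
  show "supported_in (\<lambda>x. \<beta> x * G (\<phi> x)) U"
    using \<beta>(2) by (auto simp: supported_in_def)
  have o: "open (\<phi> ` U)" using U by (auto simp: local_chart_def)
  show "smooth_on (\<phi> ` U) (\<lambda>z. \<beta> (\<psi> z) * G (\<phi> (\<psi> z)))"
    by (rule smooth_on_cong[OF o _ smooth_on_mult[OF o smooth_functionsD[OF A \<beta>(1) U] G]])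
      (auto simp: local_chart_inverse[OF U])
qed

text \<open>Transports a Euclidean bump through a chart. The preimage of a closed coordinate ball is
  compact, hence closed in the Hausdorff manifold, and serves as support.\<close>

lemma smooth_bump:
  fixes \<A> :: "('m::{t2_space, second_countable_topology}, 'e::fin_euclidean) chart set"
  assumes A: "smooth_atlas \<A>" and N: "open N" "y \<in> N"
  obtains \<beta> where "\<beta> \<in> smooth_functions \<A>" "\<beta> y = 1" "supported_in \<beta> N"
proof -
  obtain U \<phi> \<psi> where "(U, \<phi>, \<psi>) \<in> \<A>" "y \<in> U" "local_chart \<A> U \<phi> \<psi>"
    by (rule smooth_atlas_chart_at[OF A])
  then have U: "local_chart \<A> (U \<inter> N) \<phi> \<psi>" and y: "y \<in> U \<inter> N"
    using N local_chart_subset[of \<A> U \<phi> \<psi> "U \<inter> N"] by (auto dest: local_chart_open)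
  let ?U = "U \<inter> N"
  obtain r where r: "r > 0" "cball (\<phi> y) r \<subseteq> \<phi> ` ?U"
    using open_contains_cball[of "\<phi> ` ?U"] U y unfolding local_chart_def by blast
  obtain b :: "'e \<Rightarrow> real" where b: "smooth_on UNIV b" "b (\<phi> y) = 1" "\<And>z. z \<notin> ball (\<phi> y) r \<Longrightarrow> b z = 0"
    by (rule bump_exists[OF r(1), of "\<phi> y"]) blast
  define K where "K = \<psi> ` cball (\<phi> y) r"
  have "compact K"
    unfolding K_def using U r(2) compact_cball_fin_euclidean
    by (intro compact_continuous_image) (auto simp: local_chart_def homeomorphism_def intro: continuous_on_subset)
  then have K: "closed K" by (rule compact_imp_closed)
  have KU: "K \<subseteq> ?U"
    unfolding K_def using r(2) local_chart_inverse[OF U] by force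
  have "b (\<phi> x) = 0" if "x \<in> ?U" "x \<notin> K" for x
    using that local_chart_inverse[OF U that(1)] unfolding K_def
    by (intro b(3)) (metis image_eqI ball_subset_cball subsetD)
  then have "\<forall>x. x \<notin> K \<longrightarrow> (if x \<in> ?U then b (\<phi> x) else 0) = 0"
    by simp
  with K KU have supp: "supported_in (\<lambda>x. if x \<in> ?U then b (\<phi> x) else 0) ?U"
    unfolding supported_in_def by blast
  have o: "open (\<phi> ` ?U)" using U by (auto simp: local_chart_def)
  have "smooth_on (\<phi> ` ?U) (\<lambda>z. if \<psi> z \<in> ?U then b (\<phi> (\<psi> z)) else 0)"
    by (rule smooth_on_cong[OF o _ smooth_on_subset[OF b(1) subset_UNIV]])
      (auto simp: local_chart_inverse[OF U])
  note smooth = smooth_if_supported_in_chart[OF A U supp this]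
  from supp have "supported_in (\<lambda>x. if x \<in> ?U then b (\<phi> x) else 0) N"
    unfolding supported_in_def by blast
  from that[OF smooth _ this] y b(2) show ?thesis by simp
qed


section \<open>Bundle charts\<close>

text \<open>A trivialization is a diffeomorphism onto \<open>U \<times> UNIV\<close>, so following
  it by a base chart gives a chart of the total space; both transition conditions are its smoothness
  read in the product chart over \<open>V\<close>. The statement serves the affine bundle and its
  model bundle alike.\<close>

lemma trivialization_local_chart:
  fixes \<A> :: "('m::{t2_space, second_countable_topology}, 'e::fin_euclidean) chart set"
    and \<B> :: "('a::{t2_space, second_countable_topology}, 'e \<times> 'f::fin_euclidean) chart set"
  assumes A: "smooth_atlas \<A>" and p: "smooth_map_on \<B> \<A> UNIV \<pi>"
    and triv: "trivialization \<A> \<B> \<pi> U \<tau>" and V: "(V, \<phi>, \<psi>) \<in> \<A>"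
  defines "\<Phi> \<equiv> \<lambda>y. (\<phi> (\<pi> y), \<tau> y)"
    and "\<Psi> \<equiv> \<lambda>z. inv_into (\<pi> -` U) (\<lambda>y. (\<pi> y, \<tau> y)) (\<psi> (fst z), snd z)"
  shows "local_chart \<B> (\<pi> -` (U \<inter> V)) \<Phi> \<Psi>" and "\<Phi> ` (\<pi> -` (U \<inter> V)) = \<phi> ` (U \<inter> V) \<times> UNIV"
proof -
  let ?h = "\<lambda>y. (\<pi> y, \<tau> y)"
  let ?g = "inv_into (\<pi> -` U) ?h"
  note Vc = smooth_atlas_local_chart[OF A V]
  have oU: "open U" and bij: "bij_betw ?h (\<pi> -` U) (U \<times> UNIV)"
    and h: "smooth_map_on \<B> (prod_atlas \<A> std_atlas) (\<pi> -` U) ?h"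
    and g: "smooth_map_on (prod_atlas \<A> std_atlas) \<B> (U \<times> UNIV) ?g"
    using triv by (auto simp: trivialization_def)
  have gh: "?g (\<pi> y, \<tau> y) = y" if "\<pi> y \<in> U" for y
    using bij_betw_inv_into_left[OF bij, of y] that by simp
  have hg: "\<pi> (?g (p, u)) = p" "\<tau> (?g (p, u)) = u" if "p \<in> U" for p u
    using bij_betw_inv_into_right[OF bij, of "(p, u)"] that by simp_all
  have \<psi>\<phi>: "\<psi> (\<phi> p) = p" if "p \<in> V" for p
    using local_chart_inverse[OF Vc that] .
  show img: "\<Phi> ` (\<pi> -` (U \<inter> V)) = \<phi> ` (U \<inter> V) \<times> UNIV"
  proof (intro equalityI subsetI)
    fix z assume "z \<in> \<phi> ` (U \<inter> V) \<times> (UNIV :: 'f set)"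
    then obtain p u where "p \<in> U" "p \<in> V" "z = (\<phi> p, u)" by auto
    then have "z = \<Phi> (?g (p, u))" "?g (p, u) \<in> \<pi> -` (U \<inter> V)"
      by (simp_all add: \<Phi>_def hg)
    then show "z \<in> \<Phi> ` (\<pi> -` (U \<inter> V))" by blast
  qed (auto simp: \<Phi>_def)
  have oW: "open (U \<inter> V)" and oV: "open V" using oU local_chart_open[OF Vc] by auto
  have cp: "continuous_on UNIV \<pi>" using p by (auto simp: smooth_map_on_def)
  have o1: "open (\<pi> -` (U \<inter> V))"
    using continuous_open_vimage[OF oW, of \<pi>] cp by (simp add: continuous_on_eq_continuous_at)
  have o2: "open (\<phi> ` (U \<inter> V) \<times> (UNIV :: 'f set))"
    by (intro open_Times open_UNIV local_chart_open_image[OF Vc oW]) simp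
  have hom: "homeomorphism (\<pi> -` (U \<inter> V)) (\<Phi> ` (\<pi> -` (U \<inter> V))) \<Phi> \<Psi>"
  proof (rule homeomorphismI)
    have ch: "continuous_on (\<pi> -` (U \<inter> V)) ?h"
      using h by (auto simp: smooth_map_on_def intro: continuous_on_subset)
    have "continuous_on (\<pi> -` (U \<inter> V)) (\<lambda>y. (\<lambda>p. (\<phi> (fst p), snd p)) (?h y))"
    proof (rule continuous_on_compose2[OF _ ch])
      show "continuous_on (V \<times> UNIV) (\<lambda>p::'m \<times> 'f. (\<phi> (fst p), snd p))"
      proof (rule continuous_on_Pair)
        show "continuous_on (V \<times> (UNIV :: 'f set)) (\<lambda>p. \<phi> (fst p))"
          by (rule continuous_on_compose2[of V \<phi>])
            (use Vc in \<open>auto simp: local_chart_def homeomorphism_def intro: continuous_on_fst\<close>)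
      qed (intro continuous_intros)
    qed auto
    then show "continuous_on (\<pi> -` (U \<inter> V)) \<Phi>" by (simp add: \<Phi>_def)
    have cg: "continuous_on (U \<times> UNIV) ?g"
      using g by (auto simp: smooth_map_on_def)
    have "continuous_on (\<phi> ` V) \<psi>"
      using Vc by (auto simp: local_chart_def homeomorphism_def)
    then have c\<psi>: "continuous_on (\<phi> ` (U \<inter> V) \<times> (UNIV :: 'f set)) (\<lambda>z. \<psi> (fst z))"
      by (rule continuous_on_compose2) (auto intro: continuous_on_fst)
    show "continuous_on (\<Phi> ` (\<pi> -` (U \<inter> V))) \<Psi>"
      unfolding \<Psi>_def img
      by (rule continuous_on_compose2[OF cg continuous_on_Pair[OF c\<psi> continuous_on_snd[OF continuous_on_id]]])
        (auto simp: \<psi>\<phi>)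
  qed (auto simp: \<Phi>_def \<Psi>_def gh \<psi>\<phi>)
  have VP: "(V \<times> UNIV, map_prod \<phi> id, map_prod \<psi> id) \<in> prod_atlas \<A> (std_atlas :: ('f, 'f) chart set)"
    unfolding prod_atlas_def std_atlas_def using V by blast
  have s1: "smooth_on (k ` (\<pi> -` (U \<inter> V) \<inter> W)) (\<Phi> \<circ> k')" if W: "(W, k, k') \<in> \<B>" for W k k'
  proof -
    have "smooth_on (k ` (\<pi> -` U \<inter> W \<inter> ?h -` (V \<times> UNIV))) (map_prod \<phi> id \<circ> ?h \<circ> k')"
      using h W VP unfolding smooth_map_on_def by blast
    moreover have "\<pi> -` U \<inter> W \<inter> ?h -` (V \<times> UNIV) = \<pi> -` (U \<inter> V) \<inter> W" by auto
    moreover have "map_prod \<phi> id \<circ> ?h \<circ> k' = \<Phi> \<circ> k'" by (auto simp: \<Phi>_def)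
    ultimately show ?thesis by simp
  qed
  have s2: "smooth_on (\<Phi> ` (\<pi> -` (U \<inter> V) \<inter> W)) (k \<circ> \<Psi>)" if W: "(W, k, k') \<in> \<B>" for W k k'
  proof -
    have "smooth_on (map_prod \<phi> id ` (U \<times> UNIV \<inter> (V \<times> UNIV) \<inter> ?g -` W)) (k \<circ> ?g \<circ> map_prod \<psi> id)"
      using g W VP unfolding smooth_map_on_def by blast
    moreover have "\<Phi> ` (\<pi> -` (U \<inter> V) \<inter> W) \<subseteq> map_prod \<phi> id ` (U \<times> UNIV \<inter> (V \<times> UNIV) \<inter> ?g -` W)"
    proof
      fix z assume "z \<in> \<Phi> ` (\<pi> -` (U \<inter> V) \<inter> W)"
      then obtain y where y: "\<pi> y \<in> U" "\<pi> y \<in> V" "y \<in> W" "z = \<Phi> y" by auto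
      then show "z \<in> map_prod \<phi> id ` (U \<times> UNIV \<inter> (V \<times> UNIV) \<inter> ?g -` W)"
        by (intro image_eqI[of _ _ "?h y"]) (auto simp: \<Phi>_def gh)
    qed
    moreover have "k \<circ> ?g \<circ> map_prod \<psi> id = k \<circ> \<Psi>" by (auto simp: \<Psi>_def map_prod_def split_beta)
    ultimately show ?thesis by (auto intro: smooth_on_subset)
  qed
  show "local_chart \<B> (\<pi> -` (U \<inter> V)) \<Phi> \<Psi>"
    unfolding local_chart_def using o1 o2[folded img] hom s1 s2 by blast
qed

locale affine_bundle_space =
  fixes A :: "('a::{t2_space, second_countable_topology}, 'w::{t2_space, second_countable_topology},
      'm::{t2_space, second_countable_topology}, 'e::fin_euclidean, 'f::fin_euclidean) affine_bundle"
  assumes affine_bundle: "is_affine_bundle A"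
begin

abbreviation "C \<equiv> smooth_functions (ab_total A)"
abbreviation "C\<^sub>M \<equiv> smooth_functions (ab_base A)"
abbreviation "L \<equiv> affine_functions A"
abbreviation "B \<equiv> basic_functions A"
abbreviation "pr \<equiv> ab_proj A"
abbreviation "V \<equiv> ab_model A"
abbreviation "vert X c \<equiv> vertical_lift A X [c]"

lemma atlas_total: "smooth_atlas (ab_total A)"
  and atlas_base: "smooth_atlas (ab_base A)"
  and atlas_model: "smooth_atlas (vb_total V)"
  and smooth_proj: "smooth_map_on (ab_total A) (ab_base A) UNIV pr"
  and smooth_vb_proj: "smooth_map_on (vb_total V) (ab_base A) UNIV (vb_proj V)"
  using affine_bundle by (auto simp: is_affine_bundle_def is_vector_bundle_def ab_base_def)

lemma vimage_proj_open: "open W \<Longrightarrow> open (pr -` W)"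
  using smooth_proj by (auto simp: smooth_map_on_def continuous_on_open_vimage)

lemma vimage_proj_closed: "closed K \<Longrightarrow> closed (pr -` K)"
  using smooth_proj by (auto simp: smooth_map_on_def continuous_on_closed_vimage)

end

text \<open>\<open>W\<close> is the intersection of the domains of a chart \<open>(\<phi>, \<psi>)\<close> of the base and of a trivialization
  \<open>(\<tau>, \<theta>)\<close>; \<open>\<Psi>\<close> and \<open>\<Theta>\<close> invert the resulting charts of the total spaces of \<open>A\<close> and of its
  model bundle.\<close>

locale bundle_chart = affine_bundle_space A
  for A :: "('a::{t2_space, second_countable_topology}, 'w::{t2_space, second_countable_topology},
      'm::{t2_space, second_countable_topology}, 'e::fin_euclidean, 'f::fin_euclidean) affine_bundle" +
  fixes W :: "'m set" and \<phi> :: "'m \<Rightarrow> 'e" and \<psi> :: "'e \<Rightarrow> 'm" and \<tau> :: "'a \<Rightarrow> 'f" and \<theta> :: "'w \<Rightarrow> 'f"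
    and \<Psi> :: "'e \<times> 'f \<Rightarrow> 'a" and \<Theta> :: "'e \<times> 'f \<Rightarrow> 'w"
  assumes chart_base: "local_chart (ab_base A) W \<phi> \<psi>"
    and chart_total: "local_chart (ab_total A) (pr -` W) (\<lambda>y. (\<phi> (pr y), \<tau> y)) \<Psi>"
    and image_total: "(\<lambda>y. (\<phi> (pr y), \<tau> y)) ` (pr -` W) = \<phi> ` W \<times> UNIV"
    and chart_model: "local_chart (vb_total V) (vb_proj V -` W) (\<lambda>X. (\<phi> (vb_proj V X), \<theta> X)) \<Theta>"
    and image_model: "(\<lambda>X. (\<phi> (vb_proj V X), \<theta> X)) ` (vb_proj V -` W) = \<phi> ` W \<times> UNIV"
    and add_model: "vb_proj V X \<in> W \<Longrightarrow> vb_proj V Y = vb_proj V X \<Longrightarrow>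
      vb_proj V (vb_add V X Y) = vb_proj V X \<and> \<theta> (vb_add V X Y) = \<theta> X + \<theta> Y"
    and scale_model: "vb_proj V X \<in> W \<Longrightarrow>
      vb_proj V (vb_scale V c X) = vb_proj V X \<and> \<theta> (vb_scale V c X) = c *\<^sub>R \<theta> X"
    and translate: "pr y \<in> W \<Longrightarrow> vb_proj V X = pr y \<Longrightarrow>
      pr (ab_translate A y X) = pr y \<and> \<tau> (ab_translate A y X) = \<tau> y + \<theta> X"
begin

lemma open_W: "open W"
  and open_image: "open (\<phi> ` W)"
  and open_image_total: "open (\<phi> ` W \<times> (UNIV :: 'f set))"
  using chart_base by (auto simp: local_chart_def intro: open_Times)

lemma base_inverse: "p \<in> W \<Longrightarrow> \<psi> (\<phi> p) = p"
  by (rule local_chart_inverse[OF chart_base])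

lemma total_inverse: "pr y \<in> W \<Longrightarrow> \<Psi> (\<phi> (pr y), \<tau> y) = y"
  using local_chart_inverse[OF chart_total, of y] by simp

lemma model_inverse: "vb_proj V X \<in> W \<Longrightarrow> \<Theta> (\<phi> (vb_proj V X), \<theta> X) = X"
  using local_chart_inverse[OF chart_model, of X] by simp

lemma
  assumes "p \<in> W"
  shows proj_\<Psi>: "pr (\<Psi> (\<phi> p, u)) = p" and \<tau>_\<Psi>: "\<tau> (\<Psi> (\<phi> p, u)) = u"
proof -
  have "(\<phi> p, u) \<in> (\<lambda>y. (\<phi> (pr y), \<tau> y)) ` (pr -` W)"
    unfolding image_total using assms by simp
  then obtain y where "pr y \<in> W" "\<phi> p = \<phi> (pr y)" "u = \<tau> y" by auto
  then show "pr (\<Psi> (\<phi> p, u)) = p" "\<tau> (\<Psi> (\<phi> p, u)) = u"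
    using total_inverse[of y] base_inverse[OF assms] base_inverse[of "pr y"] by metis+
qed

lemma
  assumes "p \<in> W"
  shows proj_\<Theta>: "vb_proj V (\<Theta> (\<phi> p, u)) = p" and \<theta>_\<Theta>: "\<theta> (\<Theta> (\<phi> p, u)) = u"
proof -
  have "(\<phi> p, u) \<in> (\<lambda>X. (\<phi> (vb_proj V X), \<theta> X)) ` (vb_proj V -` W)"
    unfolding image_model using assms by simp
  then obtain y where "vb_proj V y \<in> W" "\<phi> p = \<phi> (vb_proj V y)" "u = \<theta> y" by auto
  then show "vb_proj V (\<Theta> (\<phi> p, u)) = p" "\<theta> (\<Theta> (\<phi> p, u)) = u"
    using model_inverse[of y] base_inverse[OF assms] base_inverse[of "vb_proj V y"] by metis+
qed

lemma translate_\<Psi>: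
  assumes "p \<in> W" "vb_proj V X = p"
  shows "ab_translate A (\<Psi> (\<phi> p, u)) X = \<Psi> (\<phi> p, u + \<theta> X)"
  using translate[of "\<Psi> (\<phi> p, u)" X] total_inverse[of "ab_translate A (\<Psi> (\<phi> p, u)) X"] assms
  by (simp add: proj_\<Psi> \<tau>_\<Psi>)

lemma smooth_on_comp_fst:
  assumes "smooth_on (\<phi> ` W) f"
  shows "smooth_on (\<phi> ` W \<times> (UNIV :: 'f set)) (\<lambda>z. f (fst z))"
  by (rule smooth_on_compose[OF open_image_total open_image _ smooth_on_fst[OF open_image_total smooth_on_id[OF open_image_total]] assms])
    auto

lemma smooth_on_slice:
  assumes "smooth_on (\<phi> ` W \<times> UNIV) F"
  shows "smooth_on (\<phi> ` W) (\<lambda>x. F (x, u :: 'f))"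
  by (rule smooth_on_compose[OF open_image open_image_total _ smooth_on_Pair[OF open_image smooth_on_id[OF open_image] smooth_on_const[OF open_image]] assms])
    auto

lemma smooth_total: "c \<in> C \<Longrightarrow> smooth_on (\<phi> ` W \<times> UNIV) (\<lambda>z. c (\<Psi> z))"
  using smooth_functionsD[OF atlas_total _ chart_total] by (simp add: image_total)

lemma smooth_base: "f \<in> C\<^sub>M \<Longrightarrow> smooth_on (\<phi> ` W) (\<lambda>x. f (\<psi> x))"
  by (rule smooth_functionsD[OF atlas_base _ chart_base])

lemma smooth_fibre:
  assumes "c \<in> C" "p \<in> W"
  shows "((\<lambda>u. c (\<Psi> (\<phi> p, u))) has_derivative
    (\<lambda>v. frechet_derivative (\<lambda>z. c (\<Psi> z)) (at (\<phi> p, u)) (0, v))) (at u)"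
  by (rule has_derivative_compose[where f="\<lambda>u. (\<phi> p, u)", OF _ smooth_on_has_derivative[OF smooth_total[OF assms(1)]]])
    (use assms(2) in \<open>auto intro!: derivative_eq_intros\<close>)

lemma smooth_section:
  assumes X: "vb_section V X"
  shows "smooth_on (\<phi> ` W) (\<lambda>x. \<theta> (X (\<psi> x)))"
proof -
  have "smooth_on (\<phi> ` W) ((\<lambda>X. (\<phi> (vb_proj V X), \<theta> X)) \<circ> X \<circ> \<psi>)"
    using X by (intro smooth_map_on_charts[OF atlas_base atlas_model _ open_UNIV chart_base chart_model])
      (auto simp: vb_section_def ab_base_def)
  from smooth_on_snd[OF open_image this] show ?thesis by (simp add: o_def)
qed

text \<open>In a bundle chart the translation curve is the straight line
  \<open>\<tau> y + t *\<^sub>R \<theta> (X (pr y))\<close> in the fibre, so the lift differentiates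
  in the direction \<open>(0, \<theta> (X (pr y)))\<close>.\<close>

lemma vertical_lift_DERIV:
  assumes X: "vb_section V X" and c: "c \<in> C" and y: "pr y \<in> W"
  shows "((\<lambda>t. c (ab_translate A y (vb_scale V t (X (pr y))))) has_real_derivative
      frechet_derivative (\<lambda>z. c (\<Psi> z)) (at (\<phi> (pr y), \<tau> y)) (0, \<theta> (X (pr y)))) (at 0)"
proof -
  let ?p = "pr y" and ?v = "\<theta> (X (pr y))" and ?D = "frechet_derivative (\<lambda>z. c (\<Psi> z)) (at (\<phi> (pr y), \<tau> y))"
  have Xp: "vb_proj V (X ?p) = ?p" using X by (simp add: vb_section_def)
  have eq: "ab_translate A y (vb_scale V t (X ?p)) = \<Psi> (\<phi> ?p, \<tau> y + t *\<^sub>R ?v)" for t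
    using translate_\<Psi>[OF y, of "vb_scale V t (X ?p)" "\<tau> y"] scale_model[of "X ?p" t] y Xp total_inverse[OF y]
    by simp
  have "((\<lambda>t. c (\<Psi> (\<phi> ?p, \<tau> y + t *\<^sub>R ?v))) has_derivative (\<lambda>t. ?D (0, t *\<^sub>R ?v))) (at 0)"
  proof (rule has_derivative_compose[where f="\<lambda>t. \<tau> y + t *\<^sub>R ?v" and g="\<lambda>u. c (\<Psi> (\<phi> ?p, u))"])
    show "((\<lambda>t. \<tau> y + t *\<^sub>R ?v) has_derivative (\<lambda>t. t *\<^sub>R ?v)) (at 0)"
      by (auto intro!: derivative_eq_intros)
    show "((\<lambda>u. c (\<Psi> (\<phi> ?p, u))) has_derivative (\<lambda>v. ?D (0, v))) (at (\<tau> y + 0 *\<^sub>R ?v))"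
      using smooth_fibre[OF c y, of "\<tau> y"] by simp
  qed
  moreover have "?D (0, t *\<^sub>R ?v) = ?D (0, ?v) * t" for t
  proof -
    have "linear ?D"
      using has_derivative_linear[OF smooth_on_has_derivative[OF smooth_total[OF c]], of "(\<phi> ?p, \<tau> y)"] y by simp
    from linear_scale[OF this, of t "(0, ?v)"] show ?thesis by simp
  qed
  ultimately show ?thesis
    by (simp add: eq has_field_derivative_def)
qed

lemma vertical_lift_\<Psi>:
  assumes "vb_section V X" "c \<in> C" "p \<in> W"
  shows "vert X c (\<Psi> (\<phi> p, u)) =
    frechet_derivative (\<lambda>z. c (\<Psi> z)) (at (\<phi> p, u)) (0, \<theta> (X p))"
  using DERIV_imp_deriv[OF vertical_lift_DERIV[of X c "\<Psi> (\<phi> p, u)"]] assms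
  by (simp add: vertical_lift_def proj_\<Psi> \<tau>_\<Psi>)

text \<open>The cutoff depends on the base point alone, so along each fibre \<open>G\<close> is only
  rescaled; this keeps fibrewise affine functions affine.\<close>

lemma smooth_cutoff_total:
  assumes \<beta>: "\<beta> \<in> C\<^sub>M" and K: "supported_in \<beta> W"
    and G: "smooth_on (\<phi> ` W \<times> UNIV) G" and \<beta>C: "\<beta> \<circ> pr \<in> C"
  shows "(\<lambda>y. \<beta> (pr y) * G (\<phi> (pr y), \<tau> y)) \<in> C"
proof -
  have "supported_in (\<beta> \<circ> pr) (pr -` W)"
  proof -
    obtain K' where "closed K'" "K' \<subseteq> W" "\<And>x. x \<notin> K' \<Longrightarrow> \<beta> x = 0"
      using K unfolding supported_in_def by blast
    then show ?thesis
      unfolding supported_in_def by (intro exI[of _ "pr -` K'"]) (auto intro: vimage_proj_closed)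
  qed
  from smooth_cutoff[OF atlas_total \<beta>C this chart_total G[folded image_total]] show ?thesis by simp
qed

text \<open>Affinity is defined through translations by the model fibre. In the chart these are
  additions of \<open>\<theta> X\<close>, and \<open>\<Theta>\<close> transports the linear part to
  the fixed space \<open>'f\<close>.\<close>

lemma aff_fibre_\<Psi>:
  assumes p: "p \<in> W" and \<alpha>: "\<alpha> \<in> aff_fibre A p"
  obtains l where "linear l" "\<And>u. \<alpha> (\<Psi> (\<phi> p, u)) = \<alpha> (\<Psi> (\<phi> p, 0)) + l u"
proof -
  obtain k where k: "fibre_linear V p k"
    "\<And>y X. y \<in> ab_fibre A p \<Longrightarrow> vb_proj V X = p \<Longrightarrow> \<alpha> (ab_translate A y X) = \<alpha> y + k X"
    using \<alpha> unfolding aff_fibre_def by blast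
  have "linear (\<lambda>u. k (\<Theta> (\<phi> p, u)))"
  proof (rule linearI)
    fix u v
    have "vb_add V (\<Theta> (\<phi> p, u)) (\<Theta> (\<phi> p, v)) = \<Theta> (\<phi> p, u + v)"
      using add_model[of "\<Theta> (\<phi> p, u)" "\<Theta> (\<phi> p, v)"] model_inverse[of "vb_add V (\<Theta> (\<phi> p, u)) (\<Theta> (\<phi> p, v))"] p
      by (simp add: proj_\<Theta> \<theta>_\<Theta>)
    then show "k (\<Theta> (\<phi> p, u + v)) = k (\<Theta> (\<phi> p, u)) + k (\<Theta> (\<phi> p, v))"
      using k(1) p unfolding fibre_linear_def by (metis proj_\<Theta>)
    fix c
    have "vb_scale V c (\<Theta> (\<phi> p, u)) = \<Theta> (\<phi> p, c *\<^sub>R u)"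
      using scale_model[of "\<Theta> (\<phi> p, u)" c] model_inverse[of "vb_scale V c (\<Theta> (\<phi> p, u))"] p
      by (simp add: proj_\<Theta> \<theta>_\<Theta>)
    then show "k (\<Theta> (\<phi> p, c *\<^sub>R u)) = c *\<^sub>R k (\<Theta> (\<phi> p, u))"
      using k(1) p unfolding fibre_linear_def by (metis proj_\<Theta> real_scaleR_def)
  qed
  moreover have "\<alpha> (\<Psi> (\<phi> p, u)) = \<alpha> (\<Psi> (\<phi> p, 0)) + k (\<Theta> (\<phi> p, u))" for u
    using k(2)[of "\<Psi> (\<phi> p, 0)" "\<Theta> (\<phi> p, u)"] translate_\<Psi>[of p "\<Theta> (\<phi> p, u)" 0] p
    by (simp add: proj_\<Psi> proj_\<Theta> \<theta>_\<Theta> ab_fibre_def)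
  ultimately show ?thesis by (rule that)
qed

lemma aff_fibreI:
  assumes p: "p \<in> W" and l: "linear l" and \<alpha>: "\<And>u. \<alpha> (\<Psi> (\<phi> p, u)) = k + l u" "\<alpha> \<in> extensional (ab_fibre A p)"
  shows "\<alpha> \<in> aff_fibre A p"
  unfolding aff_fibre_def
proof (intro CollectI conjI \<alpha>(2) exI[of _ "\<lambda>X. l (\<theta> X)"] ballI allI impI)
  show "fibre_linear V p (\<lambda>X. l (\<theta> X))"
    using p add_model scale_model l by (auto simp: fibre_linear_def linear_add linear_scale)
  fix y X assume "y \<in> ab_fibre A p" and X: "vb_proj V X = p"
  then have y: "pr y = p" "y = \<Psi> (\<phi> p, \<tau> y)"
    using total_inverse[of y] p by (auto simp: ab_fibre_def)
  have "\<alpha> (ab_translate A y X) = k + l (\<tau> y + \<theta> X)"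
    using translate_\<Psi>[OF p X, of "\<tau> y"] \<alpha>(1)[of "\<tau> y + \<theta> X"] y(2) by simp
  also have "\<dots> = \<alpha> y + l (\<theta> X)"
    using \<alpha>(1)[of "\<tau> y"] y(2) linear_add[OF l] by simp
  finally show "\<alpha> (ab_translate A y X) = \<alpha> y + l (\<theta> X)" .
qed

lemma affine_function_\<Psi>:
  assumes p: "p \<in> W" and a: "a \<in> L"
  obtains l where "linear l" "\<And>u. a (\<Psi> (\<phi> p, u)) = a (\<Psi> (\<phi> p, 0)) + l u"
proof -
  have "assoc_section A a p \<in> aff_fibre A p" using a by (simp add: affine_functions_def)
  from aff_fibre_\<Psi>[OF p this] obtain l where l: "linear l"
    "\<And>u. assoc_section A a p (\<Psi> (\<phi> p, u)) = assoc_section A a p (\<Psi> (\<phi> p, 0)) + l u" by blast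
  have eq: "assoc_section A a p (\<Psi> (\<phi> p, u)) = a (\<Psi> (\<phi> p, u))" for u
    using p by (simp add: assoc_section_def ab_fibre_def proj_\<Psi>)
  show ?thesis
    by (rule that[OF l(1) l(2)[unfolded eq]])
qed

lemma assoc_sectionI:
  assumes "p \<in> W" "linear l" "\<And>u. a (\<Psi> (\<phi> p, u)) = k + l u"
  shows "assoc_section A a p \<in> aff_fibre A p"
  using assms by (intro aff_fibreI[OF assms(1,2), of _ k]) (auto simp: assoc_section_def ab_fibre_def proj_\<Psi>)

end

text \<open>The chart keeps the prescribed \<open>\<tau>\<close> and \<open>\<theta>\<close>:
  smoothness of a \<open>hat_section\<close> has to be checked in every trivialization, not in a
  convenient one.\<close>

lemma (in affine_bundle_space) trivialization_bundle_chart: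
  assumes "ab_trivialization A U \<tau> \<theta>" "p \<in> U"
  obtains W \<phi> \<psi> \<Psi> \<Theta> where "p \<in> W" "W \<subseteq> U" "bundle_chart A W \<phi> \<psi> \<tau> \<theta> \<Psi> \<Theta>"
proof -
  obtain V' \<phi> \<psi> where V: "(V', \<phi>, \<psi>) \<in> ab_base A" "p \<in> V'" "local_chart (ab_base A) V' \<phi> \<psi>"
    by (rule smooth_atlas_chart_at[OF atlas_base])
  have vb: "vb_trivialization V U \<theta>" and tr: "trivialization (ab_base A) (ab_total A) pr U \<tau>"
    using assms(1) by (auto simp: ab_trivialization_def)
  then have trv: "trivialization (ab_base A) (vb_total V) (vb_proj V) U \<theta>"
    by (simp add: vb_trivialization_def ab_base_def)
  note chart_A = trivialization_local_chart[OF atlas_base smooth_proj tr V(1)]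
  note chart_V = trivialization_local_chart[OF atlas_base smooth_vb_proj trv V(1)]
  show ?thesis
  proof (rule that[of "U \<inter> V'"])
    show "bundle_chart A (U \<inter> V') \<phi> \<psi> \<tau> \<theta>
        (\<lambda>z. inv_into (pr -` U) (\<lambda>y. (pr y, \<tau> y)) (\<psi> (fst z), snd z))
        (\<lambda>z. inv_into (vb_proj V -` U) (\<lambda>y. (vb_proj V y, \<theta> y)) (\<psi> (fst z), snd z))"
    proof (unfold_locales, goal_cases)
      case 1
      have "open (U \<inter> V')"
        using tr local_chart_open[OF V(3)] by (auto simp: trivialization_def)
      then show ?case by (rule local_chart_subset[OF V(3)]) simp
    next
      case 2 show ?case by (rule chart_A(1))
    next
      case 3 show ?case by (rule chart_A(2))
    next
      case 4 show ?case by (rule chart_V(1))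
    next
      case 5 show ?case by (rule chart_V(2))
    next
      case (6 X Y)
      then show ?case using vb by (simp add: vb_trivialization_def)
    next
      case (7 X c)
      then show ?case using vb by (simp add: vb_trivialization_def)
    next
      case (8 y X)
      then show ?case using assms(1) by (simp add: ab_trivialization_def)
    qed
  qed (use assms V(2) in auto)
qed

lemma (in affine_bundle_space) bundle_chart_at:
  obtains W \<phi> \<psi> \<tau> \<theta> \<Psi> \<Theta> where "p \<in> W" "bundle_chart A W \<phi> \<psi> \<tau> \<theta> \<Psi> \<Theta>"
proof -
  obtain U \<tau> \<theta> where "p \<in> U" "ab_trivialization A U \<tau> \<theta>"
    using affine_bundle unfolding is_affine_bundle_def by blast
  then show ?thesis
    using trivialization_bundle_chart[of U \<tau> \<theta> p] that by metis
qed


section \<open>Derivations\<close>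

text \<open>Common form of vertical lifts, of \<open>E\<close>, of \<open>\<Lambda>\<close> with one
  argument fixed, and of their commutators, so that a single vanishing criterion covers them
  all.\<close>

definition derivation :: "('a \<Rightarrow> real) set \<Rightarrow> (('a \<Rightarrow> real) \<Rightarrow> 'a \<Rightarrow> real) \<Rightarrow> bool" where
  "derivation C \<delta> \<longleftrightarrow> (\<forall>f\<in>C. \<delta> f \<in> C) \<and>
     (\<forall>f\<in>C. \<forall>g\<in>C. \<forall>c. \<delta> (\<lambda>x. f x + c * g x) = (\<lambda>x. \<delta> f x + c * \<delta> g x)) \<and>
     (\<forall>f\<in>C. \<forall>g\<in>C. \<delta> (\<lambda>x. f x * g x) = (\<lambda>x. f x * \<delta> g x + \<delta> f x * g x))"

lemma
  assumes "derivation C \<delta>" "f \<in> C"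
  shows derivation_closed: "\<delta> f \<in> C"
    and derivation_lin: "g \<in> C \<Longrightarrow> \<delta> (\<lambda>x. f x + c * g x) = (\<lambda>x. \<delta> f x + c * \<delta> g x)"
    and derivation_mult: "g \<in> C \<Longrightarrow> \<delta> (\<lambda>x. f x * g x) = (\<lambda>x. f x * \<delta> g x + \<delta> f x * g x)"
  using assms by (auto simp: derivation_def)

lemma derivation_add:
  "derivation C \<delta> \<Longrightarrow> f \<in> C \<Longrightarrow> g \<in> C \<Longrightarrow> \<delta> (\<lambda>x. f x + g x) = (\<lambda>x. \<delta> f x + \<delta> g x)"
  using derivation_lin[of C \<delta> f g 1] by simp

lemma derivation_zero:
  assumes "derivation C \<delta>" "(\<lambda>x. 0) \<in> C"
  shows "\<delta> (\<lambda>x. 0) = (\<lambda>x. 0)"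
  using derivation_add[OF assms assms(2)] by (simp add: fun_eq_iff)

lemma derivation_const:
  assumes "derivation C \<delta>" "\<And>c. (\<lambda>x. c) \<in> C"
  shows "\<delta> (\<lambda>x. c) = (\<lambda>x. 0)"
proof -
  have "\<delta> (\<lambda>x. 1) = (\<lambda>x. 0)"
    using derivation_mult[OF assms(1) assms(2)[of 1] assms(2)[of 1]] by (simp add: fun_eq_iff)
  then show ?thesis
    using derivation_lin[OF assms(1) assms(2)[of 0] assms(2)[of 1], of c] derivation_zero[OF assms(1) assms(2)]
    by simp
qed

lemma derivation_sum:
  assumes "derivation C \<delta>" "(\<lambda>x. 0) \<in> C" "\<And>f g. f \<in> C \<Longrightarrow> g \<in> C \<Longrightarrow> (\<lambda>x. f x + g x) \<in> C"
    "\<And>i. i \<in> I \<Longrightarrow> f i \<in> C"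
  shows "\<delta> (\<lambda>x. \<Sum>i\<in>I. f i x) = (\<lambda>x. \<Sum>i\<in>I. \<delta> (f i) x)"
  using assms(4)
proof (induction I rule: infinite_finite_induct)
  case (insert i I)
  have "(\<lambda>x. \<Sum>i\<in>J. f i x) \<in> C" if "\<And>i. i \<in> J \<Longrightarrow> f i \<in> C" for J
    using that by (induction J rule: infinite_finite_induct) (auto intro: assms(2,3))
  then show ?case
    using insert derivation_add[OF assms(1), of "f i" "\<lambda>x. \<Sum>i\<in>I. f i x"] by simp
qed (simp_all add: derivation_zero[OF assms(1,2)])

lemma
  assumes E: "multivector_field 1 \<A> E"
  shows vector_field_derivation: "derivation (smooth_functions \<A>) (\<lambda>f. E [f])"
    and vector_field_support: "\<not> (length fs = 1 \<and> set fs \<subseteq> smooth_functions \<A>) \<Longrightarrow> E fs = (\<lambda>x. 0)"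
proof -
  have "E [f] \<in> smooth_functions \<A> \<and>
      E [\<lambda>x. f x + c * h x] = (\<lambda>x. E [f] x + c * E [h] x) \<and>
      E [\<lambda>x. f x * h x] = (\<lambda>x. f x * E [h] x + E [f] x * h x)"
    if "f \<in> smooth_functions \<A>" "h \<in> smooth_functions \<A>" for f h c
    using E[unfolded multivector_field_def, THEN conjunct2, rule_format, of "[f]"] that by simp
  then show "derivation (smooth_functions \<A>) (\<lambda>f. E [f])"
    by (auto simp: derivation_def)
qed (use E in \<open>auto simp: multivector_field_def\<close>)

lemma
  assumes \<Lambda>: "multivector_field 2 \<A> \<Lambda>"
  shows bivector_field_derivation1: "g \<in> smooth_functions \<A> \<Longrightarrow> derivation (smooth_functions \<A>) (\<lambda>f. \<Lambda> [f, g])"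
    and bivector_field_derivation2: "f \<in> smooth_functions \<A> \<Longrightarrow> derivation (smooth_functions \<A>) (\<lambda>g. \<Lambda> [f, g])"
    and bivector_field_self: "f \<in> smooth_functions \<A> \<Longrightarrow> \<Lambda> [f, f] = (\<lambda>x. 0)"
    and bivector_field_support: "\<not> (length fs = 2 \<and> set fs \<subseteq> smooth_functions \<A>) \<Longrightarrow> \<Lambda> fs = (\<lambda>x. 0)"
proof -
  note D = \<Lambda>[unfolded multivector_field_def, THEN conjunct2, rule_format]
  let ?C = "smooth_functions \<A>"
  have cl: "\<Lambda> [f, g] \<in> ?C" if "f \<in> ?C" "g \<in> ?C" for f g
    using D[of "[f, g]"] that by simp
  have d1: "\<Lambda> [\<lambda>x. f x + c * h x, g] = (\<lambda>x. \<Lambda> [f, g] x + c * \<Lambda> [h, g] x) \<and>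
      \<Lambda> [\<lambda>x. f x * h x, g] = (\<lambda>x. f x * \<Lambda> [h, g] x + \<Lambda> [f, g] x * h x)"
    if "f \<in> ?C" "g \<in> ?C" "h \<in> ?C" for f g h c
    using D[of "[f, g]", THEN conjunct2, THEN conjunct1, rule_format, of 0 f h c] that by simp
  have d2: "\<Lambda> [g, \<lambda>x. f x + c * h x] = (\<lambda>x. \<Lambda> [g, f] x + c * \<Lambda> [g, h] x) \<and>
      \<Lambda> [g, \<lambda>x. f x * h x] = (\<lambda>x. f x * \<Lambda> [g, h] x + \<Lambda> [g, f] x * h x)"
    if "f \<in> ?C" "g \<in> ?C" "h \<in> ?C" for f g h c
    using D[of "[g, f]", THEN conjunct2, THEN conjunct1, rule_format, of 1 f h c] that by simp
  show "g \<in> ?C \<Longrightarrow> derivation ?C (\<lambda>f. \<Lambda> [f, g])" "f \<in> ?C \<Longrightarrow> derivation ?C (\<lambda>g. \<Lambda> [f, g])"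
    using cl d1 d2 by (simp_all add: derivation_def)
  show "f \<in> ?C \<Longrightarrow> \<Lambda> [f, f] = (\<lambda>x. 0)"
    using D[of "[f, f]", THEN conjunct2, THEN conjunct2, rule_format, of 0 1] by simp
qed (use \<Lambda> in \<open>auto simp: multivector_field_def\<close>)

text \<open>Alternation is postulated as vanishing on equal arguments; polarise
  \<open>\<Lambda> [f + g, f + g] = 0\<close>.\<close>

lemma bivector_field_antisym:
  assumes \<Lambda>: "multivector_field 2 \<A> \<Lambda>" and f: "f \<in> smooth_functions \<A>" and g: "g \<in> smooth_functions \<A>"
    and fg: "(\<lambda>x. f x + g x) \<in> smooth_functions \<A>"
  shows "\<Lambda> [f, g] = (\<lambda>x. - \<Lambda> [g, f] x)"
proof -
  have "\<Lambda> [\<lambda>x. f x + g x, \<lambda>x. f x + g x] = (\<lambda>x. \<Lambda> [f, f] x + \<Lambda> [f, g] x + (\<Lambda> [g, f] x + \<Lambda> [g, g] x))"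
    using derivation_add[OF bivector_field_derivation1[OF \<Lambda> fg] f g]
      derivation_add[OF bivector_field_derivation2[OF \<Lambda> f] f g]
      derivation_add[OF bivector_field_derivation2[OF \<Lambda> g] f g] by simp
  then show ?thesis
    by (simp add: bivector_field_self[OF \<Lambda>] f g fg fun_eq_iff add_eq_0_iff2)
qed


section \<open>The Schouten--Jacobi bracket with an operator of order at most one\<close>

lemma length_nths_subset: "S \<subseteq> {..<length fs} \<Longrightarrow> length (nths fs S) = card S"
  and length_nths_compl: "S \<subseteq> {..<length fs} \<Longrightarrow> length (nths fs (- S)) = length fs - card S"
proof -
  assume S: "S \<subseteq> {..<length fs}"
  have "{i. i < length fs \<and> i \<in> S} = S" "{i. i < length fs \<and> i \<in> - S} = {..<length fs} - S"
    using S by auto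
  then show "length (nths fs S) = card S" "length (nths fs (- S)) = length fs - card S"
    using S by (simp_all add: length_nths card_Diff_subset finite_subset[OF S])
qed

lemma sum_rotate3:
  "(\<Sum>k\<in>K. \<Sum>l\<in>M. \<Sum>s\<in>T. f k l s) = (\<Sum>s\<in>T. \<Sum>k\<in>K. \<Sum>l\<in>M. f k l s)"
proof -
  have "(\<Sum>l\<in>M. \<Sum>s\<in>T. f k l s) = (\<Sum>s\<in>T. \<Sum>l\<in>M. f k l s)" for k
    by (rule sum.swap)
  then show ?thesis by (simp only:) (rule sum.swap)
qed

lemma sum_delta2:
  fixes k0 l0 N :: nat
  assumes "k0 \<le> N" "l0 \<le> N"
  shows "(\<Sum>k\<le>N. \<Sum>l\<le>N. if l = l0 then if k = k0 then f k else 0 else 0) = (f k0 :: real)"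
  using assms by simp

text \<open>For fixed \<open>S\<close> the lengths of the argument lists force the degrees, so one
  pair \<open>(k, l)\<close> survives in each of the two sums and the bound \<open>n + 2\<close>
  includes it. An inner component of the wrong degree is the zero function, which the outer operator
  kills. \<open>w\<close> is a coefficient depending on the degree of the first argument;
  \<open>d = 1\<close> accounts for the degree carried by the generator \<open>I\<close> in second
  components.\<close>

lemma sum_grades_schouten_nijenhuis:
  fixes P Q :: "'a polyvector" and w :: "nat \<Rightarrow> real"
  assumes P: "\<And>gs. P ((\<lambda>x. 0) # gs) = (\<lambda>x. 0)" and Q: "\<And>gs. Q ((\<lambda>x. 0) # gs) = (\<lambda>x. 0)"
    and n: "n = length fs" and d: "d \<le> 1"
  shows "(\<Sum>k\<le>n + 2. \<Sum>l\<le>n + 2. w k * schouten_nijenhuis (\<lambda>fs x. if length fs = k then P fs x else 0)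
        (\<lambda>fs x. if length fs + d = l then Q fs x else 0) fs x) =
    (\<Sum>S\<in>Pow {..<n}. shuffle_sign n S *
      ((-1) ^ ((n - card S) * (card S + 1)) * w (Suc (n - card S)) * P (Q (nths fs S) # nths fs (- S)) x
        - w (card S) * Q (P (nths fs S) # nths fs (- S)) x))" (is "?l = ?r")
proof -
  let ?P = "\<lambda>k fs x. if length fs = k then P fs x else (0::real)"
  let ?Q = "\<lambda>l fs x. if length fs + d = l then Q fs x else (0::real)"
  have 1: "(\<Sum>k\<le>n + 2. \<Sum>l\<le>n + 2. w k * ?P k (?Q l (nths fs S) # nths fs (- S)) x) =
      w (Suc (n - card S)) * P (Q (nths fs S) # nths fs (- S)) x" if S: "S \<subseteq> {..<n}" for S
  proof -
    have len: "length (nths fs S) = card S" "length (nths fs (- S)) = n - card S" "card S \<le> n"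
      using S n length_nths_subset length_nths_compl card_mono[OF finite_lessThan S] by auto
    have "w k * ?P k (?Q l (nths fs S) # nths fs (- S)) x =
        (if l = card S + d then if k = Suc (n - card S) then w k * P (Q (nths fs S) # nths fs (- S)) x else 0 else 0)" for k l
      using len(1,2) P by auto
    then show ?thesis
      using len(3) d by (simp only:) (rule sum_delta2; simp)
  qed
  have 2: "(\<Sum>k\<le>n + 2. \<Sum>l\<le>n + 2. w k * ?Q l (?P k (nths fs S) # nths fs (- S)) x) =
      w (card S) * Q (P (nths fs S) # nths fs (- S)) x" if S: "S \<subseteq> {..<n}" for S
  proof -
    have len: "length (nths fs S) = card S" "length (nths fs (- S)) = n - card S" "card S \<le> n"
      using S n length_nths_subset length_nths_compl card_mono[OF finite_lessThan S] by auto
    have "w k * ?Q l (?P k (nths fs S) # nths fs (- S)) x =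
        (if l = Suc (n - card S) + d then if k = card S then w k * Q (P (nths fs S) # nths fs (- S)) x else 0 else 0)" for k l
      using len(1,2) Q by auto
    then show ?thesis
      using len(3) d by (simp only:) (rule sum_delta2; simp)
  qed
  let ?s = "\<lambda>S. shuffle_sign n S" and ?e = "\<lambda>S. (-1 :: real) ^ ((n - card S) * (card S + 1))"
  have "?l = (\<Sum>k\<le>n + 2. \<Sum>l\<le>n + 2. \<Sum>S\<in>Pow {..<n}.
      ?s S * (?e S * (w k * ?P k (?Q l (nths fs S) # nths fs (- S)) x)
        - w k * ?Q l (?P k (nths fs S) # nths fs (- S)) x))"
    unfolding schouten_nijenhuis_def n sum_distrib_left
    by (intro sum.cong refl) (simp only: right_diff_distrib mult_ac)
  also have "\<dots> = (\<Sum>S\<in>Pow {..<n}. \<Sum>k\<le>n + 2. \<Sum>l\<le>n + 2.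
      ?s S * (?e S * (w k * ?P k (?Q l (nths fs S) # nths fs (- S)) x)
        - w k * ?Q l (?P k (nths fs S) # nths fs (- S)) x))"
    by (rule sum_rotate3)
  also have "\<dots> = (\<Sum>S\<in>Pow {..<n}. ?s S *
      (?e S * (\<Sum>k\<le>n + 2. \<Sum>l\<le>n + 2. w k * ?P k (?Q l (nths fs S) # nths fs (- S)) x)
        - (\<Sum>k\<le>n + 2. \<Sum>l\<le>n + 2. w k * ?Q l (?P k (nths fs S) # nths fs (- S)) x)))"
    by (simp only: sum_distrib_left sum_subtractf right_diff_distrib)
  also have "\<dots> = ?r"
    by (intro sum.cong refl) (simp only: 1 2 Pow_iff mult_ac)
  finally show ?thesis .
qed

text \<open>The same collapse: \<open>S\<close> determines both degrees, with the shift by one for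
  the factor that stands behind \<open>I\<close>.\<close>

lemma sum_grades_wedge:
  fixes P Q :: "'a polyvector" and w :: "nat \<Rightarrow> real"
  assumes n: "n = length fs"
  shows "(\<Sum>k\<le>n + 2. \<Sum>l\<le>n + 2. w k * wedge (\<lambda>fs x. if length fs = k then P fs x else 0)
        (\<lambda>fs x. if length fs + 1 = l then Q fs x else 0) fs x) =
    (\<Sum>S\<in>Pow {..<n}. shuffle_sign n S * (w (card S) * P (nths fs S) x * Q (nths fs (- S)) x))" (is "?l = ?r")
proof -
  have 1: "(\<Sum>k\<le>n + 2. \<Sum>l\<le>n + 2. w k * ((if length (nths fs S) = k then P (nths fs S) x else 0) *
      (if length (nths fs (- S)) + 1 = l then Q (nths fs (- S)) x else 0))) =
      w (card S) * P (nths fs S) x * Q (nths fs (- S)) x" if S: "S \<subseteq> {..<n}" for S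
  proof -
    have len: "length (nths fs S) = card S" "length (nths fs (- S)) = n - card S" "card S \<le> n"
      using S n length_nths_subset length_nths_compl card_mono[OF finite_lessThan S] by auto
    have "w k * ((if length (nths fs S) = k then P (nths fs S) x else 0) *
      (if length (nths fs (- S)) + 1 = l then Q (nths fs (- S)) x else 0)) =
      (if l = Suc (n - card S) then if k = card S then w k * P (nths fs S) x * Q (nths fs (- S)) x else 0 else 0)" for k l
      using len(1,2) by auto
    then show ?thesis
      using len(3) by (simp only:) (rule sum_delta2; simp)
  qed
  have "?l = (\<Sum>k\<le>n + 2. \<Sum>l\<le>n + 2. \<Sum>S\<in>Pow {..<n}. shuffle_sign n S *
      (w k * ((if length (nths fs S) = k then P (nths fs S) x else 0) *
        (if length (nths fs (- S)) + 1 = l then Q (nths fs (- S)) x else 0))))"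
    unfolding wedge_def n sum_distrib_left by (intro sum.cong refl) (simp only: mult_ac)
  also have "\<dots> = (\<Sum>S\<in>Pow {..<n}. \<Sum>k\<le>n + 2. \<Sum>l\<le>n + 2. shuffle_sign n S *
      (w k * ((if length (nths fs S) = k then P (nths fs S) x else 0) *
        (if length (nths fs (- S)) + 1 = l then Q (nths fs (- S)) x else 0))))"
    by (rule sum_rotate3)
  also have "\<dots> = ?r"
    by (intro sum.cong refl) (subst 1[symmetric], simp, simp only: sum_distrib_left)
  finally show ?thesis .
qed

lemma
  fixes P Q1 Q2 :: "'a polyvector"
  assumes P: "\<And>gs. P ((\<lambda>x. 0) # gs) = (\<lambda>x. 0)" and Q1: "\<And>gs. Q1 ((\<lambda>x. 0) # gs) = (\<lambda>x. 0)"
    and Q2: "\<And>gs. Q2 ((\<lambda>x. 0) # gs) = (\<lambda>x. 0)"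
  shows fst_schouten_jacobi: "fst (schouten_jacobi (P, \<lambda>fs x. 0) (Q1, Q2)) fs x =
      (\<Sum>S\<in>Pow {..<length fs}. shuffle_sign (length fs) S *
        ((-1) ^ ((length fs - card S) * (card S + 1)) * P (Q1 (nths fs S) # nths fs (- S)) x
          - Q1 (P (nths fs S) # nths fs (- S)) x)) +
      (\<Sum>S\<in>Pow {..<length fs}. shuffle_sign (length fs) S *
        ((real (card S) - 1) * P (nths fs S) x * Q2 (nths fs (- S)) x))" (is ?fst)
    and snd_schouten_jacobi: "snd (schouten_jacobi (P, \<lambda>fs x. 0) (Q1, Q2)) fs x =
      (\<Sum>S\<in>Pow {..<length fs}. shuffle_sign (length fs) S *
        ((-1) ^ ((length fs - card S) * (card S + 1)) * (-1) ^ (length fs - card S) *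
            P (Q2 (nths fs S) # nths fs (- S)) x
          + (-1) ^ card S * Q2 (P (nths fs S) # nths fs (- S)) x))" (is ?snd)
proof -
  let ?n = "length fs"
  let ?P = "\<lambda>k fs x. if length fs = k then P fs x else (0::real)"
  let ?Q = "\<lambda>d Q l fs x. if length fs + d = l then Q fs x else (0::real)"
  have component: "component k (Q, Q') = (?Q 0 Q k, ?Q 1 Q' k)" for k and Q Q' :: "'a polyvector"
    by (simp only: component_def fst_conv snd_conv add_0_right)
  have "fst (schouten_jacobi (P, \<lambda>fs x. 0) (Q1, Q2)) fs x =
      (\<Sum>k\<le>?n + 2. \<Sum>l\<le>?n + 2. 1 * schouten_nijenhuis (?P k) (?Q 0 Q1 l) fs x) +
      (\<Sum>k\<le>?n + 2. \<Sum>l\<le>?n + 2. (real k - 1) * wedge (?P k) (?Q 1 Q2 l) fs x)"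
    unfolding sum.distrib[symmetric] schouten_jacobi_def Let_def fst_conv
    by (intro sum.cong refl) (simp add: homogeneous_schouten_jacobi_def Let_def component wedge_def)
  note this[unfolded
      sum_grades_schouten_nijenhuis[where P=P and Q=Q1 and w="\<lambda>k. 1" and d=0, OF P Q1 refl le0]
      sum_grades_wedge[where w="\<lambda>k. real k - 1", OF refl]]
  then show ?fst by simp
  \<comment> \<open>The sign is \<open>(-1)\<close> to the power \<open>p = k - 1\<close>, and
    \<open>p = -1\<close> does occur for functions.\<close>
  have pow: "(-1 :: real) powi (int k - 1) = - ((-1) ^ k)" for k
    by (cases k) (simp_all add: power_int_minus)
  have zero: "schouten_nijenhuis (\<lambda>fs x. 0) (?Q 0 Q1 l) fs x = 0" for l
    unfolding schouten_nijenhuis_def by (intro sum.neutral) (auto simp: Q1)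
  have "snd (schouten_jacobi (P, \<lambda>fs x. 0) (Q1, Q2)) fs x =
      (\<Sum>k\<le>?n + 2. \<Sum>l\<le>?n + 2. - ((-1) ^ k) * schouten_nijenhuis (?P k) (?Q 1 Q2 l) fs x)"
    unfolding schouten_jacobi_def Let_def snd_conv using zero
    by (intro sum.cong refl) (simp add: homogeneous_schouten_jacobi_def Let_def component wedge_def pow)
  note this[unfolded
      sum_grades_schouten_nijenhuis[where P=P and Q=Q2 and w="\<lambda>k. - ((-1) ^ k)" and d=1, OF P Q2 refl order_refl]]
  then show ?snd by simp
qed

lemma shuffle_sign_simps:
  "shuffle_sign 0 S = 1" "shuffle_sign (Suc 0) S = 1"
  "shuffle_sign (Suc (Suc 0)) S = (if 0 \<notin> S \<and> Suc 0 \<in> S then - 1 else 1)"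
proof -
  have "{(i, j). i < j \<and> j < Suc (Suc 0) \<and> i \<notin> S \<and> j \<in> S} = (if 0 \<notin> S \<and> Suc 0 \<in> S then {(0, Suc 0)} else {})"
    by (auto simp: less_Suc_eq)
  then show "shuffle_sign (Suc (Suc 0)) S = (if 0 \<notin> S \<and> Suc 0 \<in> S then - 1 else 1)"
    by (simp add: shuffle_sign_def)
  have "{(i, j). i < j \<and> j < Suc 0 \<and> i \<notin> S \<and> j \<in> S} = {}"
    by auto
  then show "shuffle_sign (Suc 0) S = 1"
    by (simp only: shuffle_sign_def card.empty power_0)
qed (simp add: shuffle_sign_def)

lemma nths_pair:
  "nths [g, h] S = (if 0 \<in> S then [g] else []) @ (if Suc 0 \<in> S then [h] else [])"
  by (simp add: nths_Cons)

text \<open>\<open>P\<close> stands for the operator \<open>f + \<delta>\<close> with the function \<open>f = P []\<close> and the vector field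
  \<open>\<delta> g = P [g]\<close>.\<close>

lemma schouten_jacobi_order1:
  fixes P Q1 Q2 :: "'a polyvector"
  assumes P: "\<And>gs. P ((\<lambda>x. 0) # gs) = (\<lambda>x. 0)" and Q1: "\<And>gs. Q1 ((\<lambda>x. 0) # gs) = (\<lambda>x. 0)"
    and Q2: "\<And>gs. Q2 ((\<lambda>x. 0) # gs) = (\<lambda>x. 0)"
    and P': "\<And>gs. length gs > 1 \<Longrightarrow> P gs = (\<lambda>x. 0)" and Q1': "\<And>gs. length gs > 2 \<Longrightarrow> Q1 gs = (\<lambda>x. 0)"
    and Q2': "\<And>gs. length gs > 1 \<Longrightarrow> Q2 gs = (\<lambda>x. 0)"
  defines "R1 \<equiv> fst (schouten_jacobi (P, \<lambda>fs x. 0) (Q1, Q2))"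
    and "R2 \<equiv> snd (schouten_jacobi (P, \<lambda>fs x. 0) (Q1, Q2))"
  shows "R1 [] = (\<lambda>x. P [Q1 []] x - Q1 [P []] x - P [] x * Q2 [] x)" (is ?Ga)
    and "R1 [g] = (\<lambda>x. P [Q1 [g]] x - Q1 [P [g]] x - Q1 [P [], g] x - P [] x * Q2 [g] x)" (is ?Gb)
    and "R1 [g, h] = (\<lambda>x. P [Q1 [g, h]] x - Q1 [P [g], h] x + Q1 [P [h], g] x)" (is ?Gc)
    and "length fs > 2 \<Longrightarrow> R1 fs = (\<lambda>x. 0)"
    and "R2 [] = (\<lambda>x. P [Q2 []] x + Q2 [P []] x)" (is ?Gd)
    and "R2 [g] = (\<lambda>x. P [Q2 [g]] x - Q2 [P [g]] x)" (is ?Ge)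
    and "length fs > 1 \<Longrightarrow> R2 fs = (\<lambda>x. 0)"
proof -
  note 1 = fst_schouten_jacobi[of P Q1 Q2, OF P Q1 Q2, folded R1_def]
  note 2 = snd_schouten_jacobi[of P Q1 Q2, OF P Q1 Q2, folded R2_def]
  note ev = fun_eq_iff lessThan_Suc Pow_insert shuffle_sign_simps nths_pair P' Q1' Q2'
  show ?Ga
    by (simp add: 1 ev)
  show ?Gb
    by (simp add: 1 ev)
  show ?Gc
    by (simp add: 1 ev Q1 P)
  show ?Gd
    by (simp add: 2 ev)
  show ?Ge
    by (simp add: 2 ev)
  have len: "length (nths fs S) = card S" "length (nths fs (- S)) = length fs - card S" "card S \<le> length fs"
    if "S \<subseteq> {..<length fs}" for S
    using that length_nths_subset length_nths_compl card_mono[OF finite_lessThan that] by auto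
  \<comment> \<open>If an argument is left over for \<open>P\<close>, then \<open>P\<close> receives
    at least two and vanishes; otherwise \<open>Q\<close> receives all of them, more than its degree
    allows.\<close>
  have PQ: "P (Q (nths fs S) # nths fs (- S)) x = 0"
    if "S \<subseteq> {..<length fs}" "\<And>gs. length gs > m \<Longrightarrow> Q gs = (\<lambda>x. 0)" "length fs > m"
    for Q :: "'a polyvector" and m S x
    using len[OF that(1)] that(2,3) by (cases "card S = length fs") (simp_all add: P P')
  \<comment> \<open>Either \<open>P\<close> receives more than one argument, or \<open>Q\<close>
    receives at least \<open>length fs\<close> of them.\<close>
  have QP: "Q (P (nths fs S) # nths fs (- S)) x = 0"
    if "S \<subseteq> {..<length fs}" "\<And>gs. Q ((\<lambda>x. 0) # gs) = (\<lambda>x. 0)"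
      "\<And>gs. length gs > m \<Longrightarrow> Q gs = (\<lambda>x. 0)" "length fs > m"
    for Q :: "'a polyvector" and m S x
    using len[OF that(1)] that(2,3,4) by (cases "card S > 1") (simp_all add: P')
  show "R1 fs = (\<lambda>x. 0)" if "length fs > 2"
  proof
    fix x
    have "P (nths fs S) x * Q2 (nths fs (- S)) x = 0" if "S \<subseteq> {..<length fs}" for S
      using len[OF that] \<open>length fs > 2\<close> by (cases "card S > 1") (simp_all add: P' Q2')
    then show "R1 fs x = 0"
      using PQ[of _ 2 Q1] QP[of _ Q1 2] Q1 Q1' that by (auto simp: 1 mult.assoc intro!: sum.neutral)
  qed
  show "R2 fs = (\<lambda>x. 0)" if "length fs > 1"
    using PQ[of _ 1 Q2] QP[of _ Q2 1] Q2 Q2' that by (simp add: 2 fun_eq_iff)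
qed


section \<open>Affine and basic functions\<close>

context affine_bundle_space
begin

lemma smooth_totalI:
  assumes "\<And>W \<phi> \<psi> \<tau> \<theta> \<Psi> \<Theta>. bundle_chart A W \<phi> \<psi> \<tau> \<theta> \<Psi> \<Theta> \<Longrightarrow> smooth_on (\<phi> ` W \<times> UNIV) (\<lambda>z. c (\<Psi> z))"
  shows "c \<in> C"
proof (rule smooth_functionsI[OF atlas_total])
  fix y
  obtain W \<phi> \<psi> \<tau> \<theta> \<Psi> \<Theta> where W: "pr y \<in> W" "bundle_chart A W \<phi> \<psi> \<tau> \<theta> \<Psi> \<Theta>"
    by (rule bundle_chart_at)
  interpret bundle_chart A W \<phi> \<psi> \<tau> \<theta> \<Psi> \<Theta> by fact
  show "\<exists>U \<phi> \<psi>. y \<in> U \<and> local_chart (ab_total A) U \<phi> \<psi> \<and> smooth_on (\<phi> ` U) (\<lambda>z. c (\<psi> z))"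
    using W(1) chart_total assms[OF W(2)] unfolding image_total[symmetric] by blast
qed

lemma smooth_baseI:
  assumes "\<And>W \<phi> \<psi> \<tau> \<theta> \<Psi> \<Theta>. bundle_chart A W \<phi> \<psi> \<tau> \<theta> \<Psi> \<Theta> \<Longrightarrow> smooth_on (\<phi> ` W) (\<lambda>x. f (\<psi> x))"
  shows "f \<in> C\<^sub>M"
proof (rule smooth_functionsI[OF atlas_base])
  fix p
  obtain W \<phi> \<psi> \<tau> \<theta> \<Psi> \<Theta> where W: "p \<in> W" "bundle_chart A W \<phi> \<psi> \<tau> \<theta> \<Psi> \<Theta>"
    by (rule bundle_chart_at)
  interpret bundle_chart A W \<phi> \<psi> \<tau> \<theta> \<Psi> \<Theta> by fact
  show "\<exists>U \<phi> \<psi>. p \<in> U \<and> local_chart (ab_base A) U \<phi> \<psi> \<and> smooth_on (\<phi> ` U) (\<lambda>z. f (\<psi> z))"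
    using W(1) chart_base assms[OF W(2)] by blast
qed

lemma smooth_comp_proj:
  assumes f: "f \<in> C\<^sub>M"
  shows "f \<circ> pr \<in> C"
proof (rule smooth_totalI)
  fix W \<phi> \<psi> \<tau> \<theta> \<Psi> \<Theta>
  assume "bundle_chart A W \<phi> \<psi> \<tau> \<theta> \<Psi> \<Theta>"
  then interpret bundle_chart A W \<phi> \<psi> \<tau> \<theta> \<Psi> \<Theta> .
  from smooth_on_comp_fst[OF smooth_base[OF f]] show "smooth_on (\<phi> ` W \<times> UNIV) (\<lambda>z. (f \<circ> pr) (\<Psi> z))"
    by (rule smooth_on_cong[OF open_image_total, rotated]) (auto simp: proj_\<Psi> base_inverse)
qed

lemma fibre_nonempty: "\<exists>y. pr y = p"
proof -
  obtain W \<phi> \<psi> \<tau> \<theta> \<Psi> \<Theta> where W: "p \<in> W" "bundle_chart A W \<phi> \<psi> \<tau> \<theta> \<Psi> \<Theta>"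
    by (rule bundle_chart_at)
  interpret bundle_chart A W \<phi> \<psi> \<tau> \<theta> \<Psi> \<Theta> by fact
  show ?thesis using proj_\<Psi>[OF W(1)] by blast
qed

text \<open>In a bundle chart the induced function on the base is \<open>c\<close> along the slice
  \<open>u = 0\<close>, which gives its smoothness.\<close>

lemma basicI:
  assumes c: "c \<in> C" and "\<And>y y'. pr y = pr y' \<Longrightarrow> c y = c y'"
  shows "c \<in> B"
proof -
  define f where "f p = c (SOME y. pr y = p)" for p
  have f: "f (pr y) = c y" for y
    unfolding f_def by (rule assms(2)) (rule someI[of _ y], simp)
  have "f \<in> C\<^sub>M"
  proof (rule smooth_baseI)
    fix W \<phi> \<psi> \<tau> \<theta> \<Psi> \<Theta>
    assume "bundle_chart A W \<phi> \<psi> \<tau> \<theta> \<Psi> \<Theta>"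
    then interpret bundle_chart A W \<phi> \<psi> \<tau> \<theta> \<Psi> \<Theta> .
    from smooth_on_slice[OF smooth_total[OF c], of 0] show "smooth_on (\<phi> ` W) (\<lambda>x. f (\<psi> x))"
    proof (rule smooth_on_cong[OF open_image, rotated])
      fix x assume "x \<in> \<phi> ` W"
      then obtain p where "p \<in> W" "x = \<phi> p" by blast
      then show "c (\<Psi> (x, 0)) = f (\<psi> x)"
        using f[of "\<Psi> (\<phi> p, 0)"] by (simp add: proj_\<Psi> base_inverse)
    qed
  qed
  moreover have "c = f \<circ> pr" using f by auto
  ultimately show ?thesis by (auto simp: basic_functions_def)
qed

lemma basic_smooth: "b \<in> B \<Longrightarrow> b \<in> C"
  and basic_fibre: "b \<in> B \<Longrightarrow> pr y = pr y' \<Longrightarrow> b y = b y'"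
  by (auto simp: basic_functions_def smooth_comp_proj)

lemma affine_smooth: "a \<in> L \<Longrightarrow> a \<in> C"
  by (simp add: affine_functions_def)

lemma affineI:
  assumes "c \<in> C"
    "\<And>W \<phi> \<psi> \<tau> \<theta> \<Psi> \<Theta> p. bundle_chart A W \<phi> \<psi> \<tau> \<theta> \<Psi> \<Theta> \<Longrightarrow> p \<in> W \<Longrightarrow>
      \<exists>k l. linear l \<and> (\<forall>u. c (\<Psi> (\<phi> p, u)) = k + l u)"
  shows "c \<in> L"
  unfolding affine_functions_def
proof (intro CollectI conjI assms(1) allI)
  fix p
  obtain W \<phi> \<psi> \<tau> \<theta> \<Psi> \<Theta> where W: "p \<in> W" "bundle_chart A W \<phi> \<psi> \<tau> \<theta> \<Psi> \<Theta>"
    by (rule bundle_chart_at)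
  interpret bundle_chart A W \<phi> \<psi> \<tau> \<theta> \<Psi> \<Theta> by fact
  show "assoc_section A c p \<in> aff_fibre A p"
    using assms(2)[OF W(2,1)] assoc_sectionI[OF W(1)] by blast
qed

lemma basic_affine:
  assumes "b \<in> B"
  shows "b \<in> L"
proof (rule affineI[OF basic_smooth[OF assms]])
  fix W \<phi> \<psi> \<tau> \<theta> \<Psi> \<Theta> p
  assume "bundle_chart A W \<phi> \<psi> \<tau> \<theta> \<Psi> \<Theta>" and p: "p \<in> W"
  then interpret bundle_chart A W \<phi> \<psi> \<tau> \<theta> \<Psi> \<Theta> by simp
  show "\<exists>k l. linear l \<and> (\<forall>u. b (\<Psi> (\<phi> p, u)) = k + l u)"
    using basic_fibre[OF assms, of "\<Psi> (\<phi> p, _)" "\<Psi> (\<phi> p, 0)"] p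
    by (intro exI[of _ "b (\<Psi> (\<phi> p, 0))"] exI[of _ "\<lambda>u. 0"]) (auto simp: proj_\<Psi> linear_zero)
qed

lemmas smooth_const = smooth_functions_const[OF atlas_total]
  and smooth_add = smooth_functions_add[OF atlas_total]
  and smooth_mult = smooth_functions_mult[OF atlas_total]
  and smooth_sum = smooth_functions_sum[OF atlas_total]

lemma basic_const: "(\<lambda>y. k) \<in> B"
  by (auto intro: basicI smooth_const)

lemma basic_add: "f \<in> B \<Longrightarrow> g \<in> B \<Longrightarrow> (\<lambda>y. f y + g y) \<in> B"
  by (rule basicI, intro smooth_add basic_smooth) (assumption, assumption, metis basic_fibre)

lemma basic_mult: "f \<in> B \<Longrightarrow> g \<in> B \<Longrightarrow> (\<lambda>y. f y * g y) \<in> B"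
  by (rule basicI, intro smooth_mult basic_smooth) (assumption, assumption, metis basic_fibre)

lemma basic_minus: "f \<in> B \<Longrightarrow> (\<lambda>y. - f y) \<in> B"
  using basic_mult[OF basic_const[of "-1"]] by fastforce

lemma basic_diff: "f \<in> B \<Longrightarrow> g \<in> B \<Longrightarrow> (\<lambda>y. f y - g y) \<in> B"
  using basic_add[OF _ basic_minus] by fastforce

lemma affine_add:
  assumes a: "a \<in> L" and b: "b \<in> L"
  shows "(\<lambda>y. a y + b y) \<in> L"
proof (rule affineI)
  fix W \<phi> \<psi> \<tau> \<theta> \<Psi> \<Theta> p
  assume "bundle_chart A W \<phi> \<psi> \<tau> \<theta> \<Psi> \<Theta>" and p: "p \<in> W"
  then interpret bundle_chart A W \<phi> \<psi> \<tau> \<theta> \<Psi> \<Theta> by simp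
  obtain l where l: "linear l" "\<And>u. a (\<Psi> (\<phi> p, u)) = a (\<Psi> (\<phi> p, 0)) + l u"
    using affine_function_\<Psi>[OF p a] by metis
  obtain l' where l': "linear l'" "\<And>u. b (\<Psi> (\<phi> p, u)) = b (\<Psi> (\<phi> p, 0)) + l' u"
    using affine_function_\<Psi>[OF p b] by metis
  have "a (\<Psi> (\<phi> p, u)) + b (\<Psi> (\<phi> p, u)) = (a (\<Psi> (\<phi> p, 0)) + b (\<Psi> (\<phi> p, 0))) + (l u + l' u)" for u
    by (subst l(2), subst l'(2)) simp
  then show "\<exists>k l. linear l \<and> (\<forall>u. a (\<Psi> (\<phi> p, u)) + b (\<Psi> (\<phi> p, u)) = k + l u)"
    using linear_compose_add[OF l(1) l'(1)] by blast
qed (intro smooth_add affine_smooth a b)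

lemma affine_mult_basic:
  assumes f: "f \<in> B" and a: "a \<in> L"
  shows "(\<lambda>y. f y * a y) \<in> L"
proof (rule affineI)
  fix W \<phi> \<psi> \<tau> \<theta> \<Psi> \<Theta> p
  assume "bundle_chart A W \<phi> \<psi> \<tau> \<theta> \<Psi> \<Theta>" and p: "p \<in> W"
  then interpret bundle_chart A W \<phi> \<psi> \<tau> \<theta> \<Psi> \<Theta> by simp
  obtain l where l: "linear l" "\<And>u. a (\<Psi> (\<phi> p, u)) = a (\<Psi> (\<phi> p, 0)) + l u"
    using affine_function_\<Psi>[OF p a] by metis
  let ?f = "f (\<Psi> (\<phi> p, 0))"
  have "f (\<Psi> (\<phi> p, u)) * a (\<Psi> (\<phi> p, u)) = ?f * a (\<Psi> (\<phi> p, 0)) + ?f * l u" for u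
    using basic_fibre[OF f, of "\<Psi> (\<phi> p, u)" "\<Psi> (\<phi> p, 0)"] p
    by (subst l(2)) (simp add: proj_\<Psi> algebra_simps)
  moreover have "linear (\<lambda>u. ?f * l u)"
    using linear_compose_scale_right[OF l(1), of ?f] by simp
  ultimately show "\<exists>k l. linear l \<and> (\<forall>u. f (\<Psi> (\<phi> p, u)) * a (\<Psi> (\<phi> p, u)) = k + l u)"
    by blast
qed (intro smooth_mult affine_smooth basic_smooth f a)

lemma affine_minus: "a \<in> L \<Longrightarrow> (\<lambda>y. - a y) \<in> L"
  using affine_mult_basic[OF basic_const[of "-1"]] by fastforce

lemma affine_diff: "a \<in> L \<Longrightarrow> b \<in> L \<Longrightarrow> (\<lambda>y. a y - b y) \<in> L"
  using affine_add[OF _ affine_minus] by fastforce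

end

context bundle_chart
begin

text \<open>Supplies the global affine functions with prescribed behaviour on a fibre that later
  arguments test against. Over points outside \<open>W\<close> the function is zero on the whole
  fibre.\<close>

lemma affine_cutoff:
  assumes \<beta>: "\<beta> \<in> C\<^sub>M" and K: "supported_in \<beta> W"
    and G: "smooth_on (\<phi> ` W \<times> UNIV) G"
    and aff: "\<And>p. p \<in> W \<Longrightarrow> \<exists>k l. linear l \<and> (\<forall>u. G (\<phi> p, u) = k + l u)"
  shows "(\<lambda>y. \<beta> (pr y) * G (\<phi> (pr y), \<tau> y)) \<in> L" (is "?a \<in> L")
proof -
  have a: "?a \<in> C"
    by (rule smooth_cutoff_total[OF \<beta> K G smooth_comp_proj[OF \<beta>]])
  have "assoc_section A ?a p \<in> aff_fibre A p" for p
  proof (cases "p \<in> W")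
    case True
    then obtain k l where "linear l" "\<And>u. G (\<phi> p, u) = k + l u"
      using aff by blast
    then show ?thesis
      using True linear_compose_scale_right[of l "\<beta> p"]
      by (intro assoc_sectionI[of _ "\<lambda>u. \<beta> p * l u" _ "\<beta> p * k"]) (auto simp: proj_\<Psi> \<tau>_\<Psi> algebra_simps)
  next
    case False
    then have "\<beta> p = 0" using supported_inD[OF K] by simp
    obtain W' \<phi>' \<psi>' \<tau>' \<theta>' \<Psi>' \<Theta>' where W': "p \<in> W'" "bundle_chart A W' \<phi>' \<psi>' \<tau>' \<theta>' \<Psi>' \<Theta>'"
      by (rule bundle_chart_at)
    interpret c: bundle_chart A W' \<phi>' \<psi>' \<tau>' \<theta>' \<Psi>' \<Theta>' by fact
    show ?thesis
      using W'(1) \<open>\<beta> p = 0\<close> by (intro c.assoc_sectionI[of _ "\<lambda>u. 0" _ 0]) (auto simp: c.proj_\<Psi> linear_zero)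
  qed
  with a show ?thesis by (simp add: affine_functions_def)
qed

lemma bump_base:
  assumes "p \<in> W"
  obtains \<beta> where "\<beta> \<in> C\<^sub>M" "\<beta> p = 1" "supported_in \<beta> W"
  using smooth_bump[OF atlas_base open_W assms] by metis

text \<open>Sections realise every vertical direction at every point. The section is a bump times a
  constant vector in the chart and the zero section elsewhere; the two agree off the closed support
  \<open>K\<close>.\<close>

lemma section_through:
  assumes p: "p \<in> W"
  obtains X where "vb_section V X" "\<theta> (X p) = v"
proof -
  obtain \<beta> where \<beta>: "\<beta> \<in> C\<^sub>M" "\<beta> p = 1" and "supported_in \<beta> W"
    using bump_base[OF p] by metis
  then obtain K where K: "closed K" "K \<subseteq> W" "\<And>x. x \<notin> K \<Longrightarrow> \<beta> x = 0"
    by (auto simp: supported_in_def)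
  \<comment> \<open>The bundle record has no zero vectors; they are recovered by scaling any vector
    of the fibre by 0.\<close>
  define Z where "Z q = vb_scale V 0 (SOME w. vb_proj V w = q)" for q
  have Z: "vb_proj V (Z q) = q \<and> \<theta>' (Z q) = 0"
    if W': "bundle_chart A W' \<phi>' \<psi>' \<tau>' \<theta>' \<Psi>' \<Theta>'" and q: "q \<in> W'" for W' \<phi>' \<psi>' \<tau>' \<theta>' \<Psi>' \<Theta>' q
  proof -
    interpret c: bundle_chart A W' \<phi>' \<psi>' \<tau>' \<theta>' \<Psi>' \<Theta>' by (rule W')
    have "vb_proj V (SOME w. vb_proj V w = q) = q"
      by (rule someI[of _ "\<Theta>' (\<phi>' q, 0)"]) (rule c.proj_\<Theta>[OF q])
    then show ?thesis
      unfolding Z_def using c.scale_model[of "SOME w. vb_proj V w = q" 0] q by simp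
  qed
  define X where "X q = (if q \<in> W then \<Theta> (\<phi> q, \<beta> q *\<^sub>R v) else Z q)" for q
  have XZ: "X q = Z q" if "q \<notin> K" for q
  proof (cases "q \<in> W")
    case True
    have "\<Theta> (\<phi> q, 0) = Z q"
      using model_inverse[of "Z q"] Z[OF bundle_chart_axioms True] True by simp
    with True K(3)[OF that] show ?thesis by (simp add: X_def)
  qed (simp add: X_def)
  have Xp: "vb_proj V (X q) = q" for q
  proof (cases "q \<in> W")
    case False
    obtain W' \<phi>' \<psi>' \<tau>' \<theta>' \<Psi>' \<Theta>' where W': "q \<in> W'" "bundle_chart A W' \<phi>' \<psi>' \<tau>' \<theta>' \<Psi>' \<Theta>'"
      by (rule bundle_chart_at)
    show ?thesis using Z[OF W'(2,1)] False by (simp add: X_def)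
  qed (simp add: X_def proj_\<Theta>)
  have "smooth_map_on (ab_base A) (vb_total V) UNIV X"
  proof (rule smooth_map_onI[OF atlas_base atlas_model])
    fix q
    show "\<exists>U \<phi> \<psi> U' \<phi>' \<psi>'. q \<in> U \<and> U \<subseteq> UNIV \<and> local_chart (ab_base A) U \<phi> \<psi> \<and>
      local_chart (vb_total V) U' \<phi>' \<psi>' \<and> X ` U \<subseteq> U' \<and> smooth_on (\<phi> ` U) (\<phi>' \<circ> X \<circ> \<psi>)"
    proof (cases "q \<in> W")
      case True
      have "smooth_on (\<phi> ` W) (\<lambda>x. (x, \<beta> (\<psi> x) *\<^sub>R v))"
        by (intro smooth_intros open_image smooth_base \<beta>)
      then have "smooth_on (\<phi> ` W) ((\<lambda>X. (\<phi> (vb_proj V X), \<theta> X)) \<circ> X \<circ> \<psi>)"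
        by (rule smooth_on_cong[OF open_image, rotated]) (auto simp: X_def base_inverse proj_\<Theta> \<theta>_\<Theta>)
      moreover have "X ` W \<subseteq> vb_proj V -` W" by (auto simp: Xp)
      ultimately show ?thesis
        using True chart_base chart_model by blast
    next
      case False
      obtain W' \<phi>' \<psi>' \<tau>' \<theta>' \<Psi>' \<Theta>' where W': "q \<in> W'" "bundle_chart A W' \<phi>' \<psi>' \<tau>' \<theta>' \<Psi>' \<Theta>'"
        by (rule bundle_chart_at)
      interpret c: bundle_chart A W' \<phi>' \<psi>' \<tau>' \<theta>' \<Psi>' \<Theta>' by (rule W')
      have ch: "local_chart (ab_base A) (W' - K) \<phi>' \<psi>'"
        using c.open_W K(1) by (intro local_chart_subset[OF c.chart_base]) auto
      then have o: "open (\<phi>' ` (W' - K))" by (simp add: local_chart_def)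
      have "smooth_on (\<phi>' ` (W' - K)) (\<lambda>x. (x, 0 :: 'f))"
        by (intro smooth_intros o)
      then have "smooth_on (\<phi>' ` (W' - K)) ((\<lambda>X. (\<phi>' (vb_proj V X), \<theta>' X)) \<circ> X \<circ> \<psi>')"
        by (rule smooth_on_cong[OF o, rotated]) (auto simp: c.base_inverse XZ Z[OF W'(2)])
      moreover have "X ` (W' - K) \<subseteq> vb_proj V -` W'" by (auto simp: Xp)
      moreover have "q \<in> W' - K" using W'(1) False K(2) by auto
      ultimately show ?thesis
        using ch c.chart_model by blast
    qed
  qed
  then have "vb_section V X" by (simp add: vb_section_def Xp ab_base_def)
  moreover have "\<theta> (X p) = v" using p \<beta>(2) by (simp add: X_def \<theta>_\<Theta>)
  ultimately show ?thesis by (rule that)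
qed

end


section \<open>Vertical vector fields\<close>

context affine_bundle_space
begin

text \<open>Chart-free facts on the translation curve. Differentiability is stated because
  \<open>vertical_lift\<close> is defined by \<open>deriv\<close>, which by itself does not provide
  it.\<close>

lemma vertical_curve:
  assumes X: "vb_section V X"
  shows "ab_translate A y (vb_scale V 0 (X (pr y))) = y"
    and "pr (ab_translate A y (vb_scale V t (X (pr y)))) = pr y"
    and "c \<in> C \<Longrightarrow> ((\<lambda>t. c (ab_translate A y (vb_scale V t (X (pr y))))) has_real_derivative
      vert X c y) (at 0)"
proof -
  obtain W \<phi> \<psi> \<tau> \<theta> \<Psi> \<Theta> where W: "pr y \<in> W" "bundle_chart A W \<phi> \<psi> \<tau> \<theta> \<Psi> \<Theta>"
    by (rule bundle_chart_at)
  interpret bundle_chart A W \<phi> \<psi> \<tau> \<theta> \<Psi> \<Theta> by fact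
  have Xp: "vb_proj V (X (pr y)) = pr y" using X by (simp add: vb_section_def)
  have s: "vb_proj V (vb_scale V t (X (pr y))) = pr y" "\<theta> (vb_scale V t (X (pr y))) = t *\<^sub>R \<theta> (X (pr y))" for t
    using scale_model[of "X (pr y)" t] Xp W(1) by auto
  show "ab_translate A y (vb_scale V 0 (X (pr y))) = y"
    using translate_\<Psi>[OF W(1) s(1), of "\<tau> y" 0] total_inverse[OF W(1)] by (simp add: s(2))
  show "pr (ab_translate A y (vb_scale V t (X (pr y)))) = pr y"
    using translate[OF W(1) s(1)] by simp
  show "c \<in> C \<Longrightarrow> ((\<lambda>t. c (ab_translate A y (vb_scale V t (X (pr y))))) has_real_derivative
      vert X c y) (at 0)"
    using vertical_lift_DERIV[OF X _ W(1)] DERIV_imp_deriv[OF vertical_lift_DERIV[OF X _ W(1)]]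
    by (simp add: vertical_lift_def)
qed

lemma vertical_lift_smooth:
  assumes X: "vb_section V X" and c: "c \<in> C"
  shows "vert X c \<in> C"
proof (rule smooth_totalI)
  fix W \<phi> \<psi> \<tau> \<theta> \<Psi> \<Theta>
  assume "bundle_chart A W \<phi> \<psi> \<tau> \<theta> \<Psi> \<Theta>"
  then interpret bundle_chart A W \<phi> \<psi> \<tau> \<theta> \<Psi> \<Theta> .
  let ?D = "\<lambda>z. frechet_derivative (\<lambda>z. c (\<Psi> z)) (at z)"
  let ?v = "\<lambda>z::'e \<times> 'f. (0 :: 'e, \<theta> (X (\<psi> (fst z))))"
  \<comment> \<open>The direction \<open>?v z\<close> varies with the point, so it is expanded in
    fixed basis directions.\<close>
  from smooth_on_comp_fst[OF smooth_section[OF X]] have "smooth_on (\<phi> ` W \<times> UNIV) (\<lambda>z. \<Sum>b\<in>orthobasis. inner (?v z) b *\<^sub>R ?D z b)"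
    by (intro smooth_intros open_image_total smooth_on_frechet_derivative smooth_total[OF c]) simp_all
  then show "smooth_on (\<phi> ` W \<times> UNIV) (\<lambda>z. vert X c (\<Psi> z))"
  proof (rule smooth_on_cong[OF open_image_total, rotated])
    fix z assume z: "z \<in> \<phi> ` W \<times> (UNIV :: 'f set)"
    then obtain p u where p: "p \<in> W" "z = (\<phi> p, u)" by auto
    show "(\<Sum>b\<in>orthobasis. inner (?v z) b *\<^sub>R ?D z b) = vert X c (\<Psi> z)"
      using has_derivative_orthobasis[OF smooth_on_has_derivative[OF smooth_total[OF c] z], of "?v z"]
        vertical_lift_\<Psi>[OF X c p(1), of u] p by (simp add: base_inverse)
  qed
qed

lemma vertical_lift_derivation:
  assumes X: "vb_section V X"
  shows "derivation C (\<lambda>c. vert X c)"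
proof -
  have "vert X (\<lambda>x. f x + k * g x) y = vert X f y + k * vert X g y"
    "vert X (\<lambda>x. f x * g x) y = f y * vert X g y + vert X f y * g y"
    if fg: "f \<in> C" "g \<in> C" for f g k y
  proof -
    note d = vertical_curve(3)[OF X, of _ y] and v = vertical_curve(1)[OF X, of y]
    have "(\<lambda>x. f x + k * g x) \<in> C" "(\<lambda>x. f x * g x) \<in> C"
      using smooth_add[OF fg(1) smooth_mult[OF smooth_const[of k] fg(2)]] smooth_mult[OF fg] by auto
    note d1 = this[THEN d]
    show "vert X (\<lambda>x. f x + k * g x) y = vert X f y + k * vert X g y"
      by (rule DERIV_unique[OF d1(1)]) (intro DERIV_add DERIV_cmult d fg)
    have "((\<lambda>t. f (ab_translate A y (vb_scale V t (X (pr y)))) * g (ab_translate A y (vb_scale V t (X (pr y)))))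
        has_real_derivative (vert X f y * g y + vert X g y * f y)) (at 0)"
      using DERIV_mult[OF d[OF fg(1)] d[OF fg(2)]] by (simp only: v)
    from DERIV_unique[OF d1(2) this]
    show "vert X (\<lambda>x. f x * g x) y = f y * vert X g y + vert X f y * g y"
      by (simp add: mult_ac)
  qed
  then show ?thesis
    by (auto simp: derivation_def vertical_lift_smooth[OF X])
qed

lemma vertical_lift_basic:
  assumes X: "vb_section V X" and b: "b \<in> B"
  shows "vert X b = (\<lambda>y. 0)"
proof
  fix y
  have "(\<lambda>t. b (ab_translate A y (vb_scale V t (X (pr y))))) = (\<lambda>t. b y)"
    using basic_fibre[OF b vertical_curve(2)[OF X]] by auto
  with vertical_curve(3)[OF X basic_smooth[OF b], of y] show "vert X b y = 0"
    using DERIV_unique[OF _ DERIV_const] by metis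
qed

lemma fibre_derivative:
  assumes c: "c \<in> C" and W: "bundle_chart A W \<phi> \<psi> \<tau> \<theta> \<Psi> \<Theta>" and p: "p \<in> W"
  obtains D where "\<And>u. ((\<lambda>u. c (\<Psi> (\<phi> p, u))) has_derivative D u) (at u)"
    "\<And>u X. vb_section V X \<Longrightarrow> vert X c (\<Psi> (\<phi> p, u)) = D u (\<theta> (X p))"
proof -
  interpret bundle_chart A W \<phi> \<psi> \<tau> \<theta> \<Psi> \<Theta> by (rule W)
  show ?thesis
    using that[OF smooth_fibre[OF c p] vertical_lift_\<Psi>[OF _ c p]] .
qed

lemma vertical_lift_affine:
  assumes X: "vb_section V X" and a: "a \<in> L"
  shows "vert X a \<in> B"
proof (rule basicI[OF vertical_lift_smooth[OF X affine_smooth[OF a]]])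
  fix y y' assume y': "pr y = pr y'"
  obtain W \<phi> \<psi> \<tau> \<theta> \<Psi> \<Theta> where W: "pr y \<in> W" "bundle_chart A W \<phi> \<psi> \<tau> \<theta> \<Psi> \<Theta>"
    by (rule bundle_chart_at)
  interpret bundle_chart A W \<phi> \<psi> \<tau> \<theta> \<Psi> \<Theta> by fact
  obtain l where l: "linear l" "\<And>u. a (\<Psi> (\<phi> (pr y), u)) = a (\<Psi> (\<phi> (pr y), 0)) + l u"
    using affine_function_\<Psi>[OF W(1) a] by metis
  obtain D where D: "\<And>u. ((\<lambda>u. a (\<Psi> (\<phi> (pr y), u))) has_derivative D u) (at u)"
    "\<And>u X. vb_section V X \<Longrightarrow> vert X a (\<Psi> (\<phi> (pr y), u)) = D u (\<theta> (X (pr y)))"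
    using fibre_derivative[OF affine_smooth[OF a] W(2,1)] by metis
  have "((\<lambda>u. a (\<Psi> (\<phi> (pr y), 0)) + l u) has_derivative l) (at u)" for u
    by (auto intro!: derivative_eq_intros linear_fin_euclidean_bounded[OF l(1)] bounded_linear_imp_has_derivative)
  then have "D u = l" for u
    using has_derivative_unique[OF D(1)[of u]] by (simp only: l(2)[symmetric])
  then show "vert X a y = vert X a y'"
    using D(2)[OF X, of "\<tau> y"] D(2)[OF X, of "\<tau> y'"] total_inverse[of y] total_inverse[of y'] W(1) y' by simp
qed

text \<open>Sections through a point exhaust the vertical directions, so the derivative of
  \<open>c\<close> along the fibre vanishes identically; in the chart the fibre is a vector space,
  hence \<open>c\<close> is constant on it.\<close>

lemma basic_if_vertical_zero:
  assumes c: "c \<in> C" and zero: "\<And>X. vb_section V X \<Longrightarrow> vert X c = (\<lambda>y. 0)"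
  shows "c \<in> B"
proof (rule basicI[OF c])
  fix y y' assume y': "pr y = pr y'"
  obtain W \<phi> \<psi> \<tau> \<theta> \<Psi> \<Theta> where W: "pr y \<in> W" "bundle_chart A W \<phi> \<psi> \<tau> \<theta> \<Psi> \<Theta>"
    by (rule bundle_chart_at)
  interpret bundle_chart A W \<phi> \<psi> \<tau> \<theta> \<Psi> \<Theta> by fact
  obtain D where D: "\<And>u. ((\<lambda>u. c (\<Psi> (\<phi> (pr y), u))) has_derivative D u) (at u)"
    "\<And>u X. vb_section V X \<Longrightarrow> vert X c (\<Psi> (\<phi> (pr y), u)) = D u (\<theta> (X (pr y)))"
    using fibre_derivative[OF c W(2,1)] by metis
  have "D u v = 0" for u v
  proof -
    obtain X where "vb_section V X" "\<theta> (X (pr y)) = v"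
      by (rule section_through[OF W(1)])
    then show ?thesis using D(2)[of X u] zero by simp
  qed
  then have "D u = (\<lambda>v. 0)" for u by auto
  then have "\<exists>k. \<forall>u\<in>UNIV. c (\<Psi> (\<phi> (pr y), u)) = k"
    using D(1) by (intro has_derivative_zero_constant) auto
  then show "c y = c y'"
    using total_inverse[of y] total_inverse[of y'] W(1) y' by (metis UNIV_I)
qed

text \<open>The fibre derivative does not depend on the point of the fibre; subtracting this one
  linear map leaves a function with zero derivative.\<close>

lemma affine_if_vertical_basic:
  assumes c: "c \<in> C" and bas: "\<And>X. vb_section V X \<Longrightarrow> vert X c \<in> B"
  shows "c \<in> L"
proof (rule affineI[OF c])
  fix W \<phi> \<psi> \<tau> \<theta> \<Psi> \<Theta> p
  assume W: "bundle_chart A W \<phi> \<psi> \<tau> \<theta> \<Psi> \<Theta>" and p: "p \<in> W"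
  then interpret bundle_chart A W \<phi> \<psi> \<tau> \<theta> \<Psi> \<Theta> by simp
  obtain D where D: "\<And>u. ((\<lambda>u. c (\<Psi> (\<phi> p, u))) has_derivative D u) (at u)"
    "\<And>u X. vb_section V X \<Longrightarrow> vert X c (\<Psi> (\<phi> p, u)) = D u (\<theta> (X p))"
    using fibre_derivative[OF c W p] by metis
  have "D u v = D 0 v" for u v
  proof -
    obtain X where X: "vb_section V X" "\<theta> (X p) = v"
      by (rule section_through[OF p])
    have "vert X c (\<Psi> (\<phi> p, u)) = vert X c (\<Psi> (\<phi> p, 0))"
      by (rule basic_fibre[OF bas[OF X(1)]]) (simp add: proj_\<Psi> p)
    then show ?thesis using D(2)[OF X(1)] X(2) by simp
  qed
  then have D0: "D u = D 0" for u by auto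
  have l: "linear (D 0)" using D(1) has_derivative_linear by blast
  have "((\<lambda>u. c (\<Psi> (\<phi> p, u)) - D 0 u) has_derivative (\<lambda>v. 0)) (at u)" for u
    using has_derivative_diff[OF D(1)[of u, unfolded D0[of u]] bounded_linear_imp_has_derivative[OF linear_fin_euclidean_bounded[OF l]]]
    by simp
  then have "\<exists>k. \<forall>u\<in>UNIV. c (\<Psi> (\<phi> p, u)) - D 0 u = k"
    by (intro has_derivative_zero_constant) auto
  then obtain k where k: "\<And>u. c (\<Psi> (\<phi> p, u)) - D 0 u = k" by blast
  have "c (\<Psi> (\<phi> p, u)) = k + D 0 u" for u using k[of u] by simp
  then show "\<exists>k l. linear l \<and> (\<forall>u. c (\<Psi> (\<phi> p, u)) = k + l u)"
    using l by blast
qed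

text \<open>Positive rank enters here: it gives a vector \<open>v \<noteq> 0\<close>, a section with
  value \<open>v\<close> at the point and the affine function that is \<open>inner u v\<close> on
  the fibre, whose vertical derivative is \<open>inner v v\<close>.\<close>

lemma zero_if_mult_vertical_zero:
  assumes rank: "ab_rank A > 0"
    and zero: "\<And>X a. vb_section V X \<Longrightarrow> a \<in> L \<Longrightarrow> f y * vert X a y = 0"
  shows "f y = (0 :: real)"
proof -
  obtain W \<phi> \<psi> \<tau> \<theta> \<Psi> \<Theta> where W: "pr y \<in> W" "bundle_chart A W \<phi> \<psi> \<tau> \<theta> \<Psi> \<Theta>"
    by (rule bundle_chart_at)
  interpret bundle_chart A W \<phi> \<psi> \<tau> \<theta> \<Psi> \<Theta> by fact
  let ?p = "pr y"
  obtain v :: 'f where v: "v \<noteq> 0"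
  proof -
    have "dim {0 :: 'f} = card ({} :: 'f set)"
      by (rule real_vector.dim_eq_card) (simp_all add: real_vector.independent_empty)
    then have "(UNIV :: 'f set) \<noteq> {0}"
      using rank unfolding ab_rank_def by (metis card.empty less_numeral_extra(3))
    then show thesis using that by blast
  qed
  obtain X where X: "vb_section V X" "\<theta> (X ?p) = v"
    by (rule section_through[OF W(1)])
  obtain \<beta> where \<beta>: "\<beta> \<in> C\<^sub>M" "\<beta> ?p = 1" and K: "supported_in \<beta> W"
    using bump_base[OF W(1)] by metis
  define a where "a y = \<beta> (pr y) * inner (snd (\<phi> (pr y), \<tau> y)) v" for y
  have lin: "linear (\<lambda>u. inner u v)" by (rule bounded_linear.linear[OF bounded_linear_inner_left])
  have a: "a \<in> L"
    unfolding a_def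
    by (rule affine_cutoff[OF \<beta>(1) K]) (auto intro!: smooth_intros open_image_total exI[of _ 0] lin)
  obtain D where D: "\<And>u. ((\<lambda>u. a (\<Psi> (\<phi> ?p, u))) has_derivative D u) (at u)"
    "\<And>u X. vb_section V X \<Longrightarrow> vert X a (\<Psi> (\<phi> ?p, u)) = D u (\<theta> (X ?p))"
    using fibre_derivative[OF affine_smooth[OF a] W(2,1)] by metis
  have "(\<lambda>u. a (\<Psi> (\<phi> ?p, u))) = (\<lambda>u. inner u v)"
    by (simp add: a_def proj_\<Psi> \<tau>_\<Psi> W(1) \<beta>(2))
  then have "D u = (\<lambda>u. inner u v)" for u
    using has_derivative_unique[OF D(1)[of u]] bounded_linear_imp_has_derivative[OF bounded_linear_inner_left] by metis
  then have "vert X a y = inner v v"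
    using D(2)[OF X(1), of "\<tau> y"] X(2) total_inverse[OF W(1)] by simp
  with zero[OF X(1) a] v show ?thesis by simp
qed

section \<open>Derivations tested on affine functions\<close>

text \<open>Hadamard's formula holds on a small ball only. Multiplied by the cutoff
  \<open>\<gamma>\<close> it becomes the global identity \<gamma> c = \<Sum> a_b g_b + c(y0)
  \<gamma> with affine a_b vanishing at y0. The product rule at y0 then kills the sum, so no
  separate proof that derivations are local is required.\<close>

lemma derivation_zero_if_affine_zero:
  assumes \<delta>: "derivation C \<delta>" and zero: "\<And>a. a \<in> L \<Longrightarrow> \<delta> a = (\<lambda>y. 0)" and c: "c \<in> C"
  shows "\<delta> c = (\<lambda>y. 0)"
proof
  fix y0
  obtain W \<phi> \<psi> \<tau> \<theta> \<Psi> \<Theta> where W: "pr y0 \<in> W" "bundle_chart A W \<phi> \<psi> \<tau> \<theta> \<Psi> \<Theta>"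
    by (rule bundle_chart_at)
  interpret bundle_chart A W \<phi> \<psi> \<tau> \<theta> \<Psi> \<Theta> by fact
  let ?\<Phi> = "\<lambda>y. (\<phi> (pr y), \<tau> y)"
  define z0 where "z0 = ?\<Phi> y0"
  have "z0 \<in> \<phi> ` W \<times> UNIV" using W(1) by (simp add: z0_def)
  then obtain r where r: "r > 0" "ball z0 r \<subseteq> \<phi> ` W \<times> (UNIV :: 'f set)"
    using open_image_total openE by blast
  obtain G :: "'e \<times> 'f \<Rightarrow> 'e \<times> 'f \<Rightarrow> real" where G: "\<And>b. smooth_on (ball z0 r) (G b)"
    "\<And>z. z \<in> ball z0 r \<Longrightarrow> c (\<Psi> z) = c (\<Psi> z0) + (\<Sum>b\<in>orthobasis. inner (z - z0) b * G b z)"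
    by (rule hadamard[OF smooth_on_subset[OF smooth_total[OF c] r(2)]]) blast
  define N where "N = pr -` W \<inter> ?\<Phi> -` ball z0 r"
  have "continuous_on (pr -` W) ?\<Phi>"
    using chart_total unfolding local_chart_def homeomorphism_def by blast
  then have oN: "open N"
    unfolding N_def by (intro continuous_open_preimage vimage_proj_open open_W open_ball)
  have y0: "y0 \<in> N" using W(1) r(1) by (simp add: N_def z0_def)
  have N: "local_chart (ab_total A) N ?\<Phi> \<Psi>"
    by (rule local_chart_subset[OF chart_total oN]) (simp add: N_def)
  obtain \<beta> where \<beta>: "\<beta> \<in> C" "\<beta> y0 = 1" and K: "supported_in \<beta> N"
    using smooth_bump[OF atlas_total oN y0] by metis
  obtain \<beta>' where \<beta>': "\<beta>' \<in> C\<^sub>M" "\<beta>' (pr y0) = 1"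
    and K': "supported_in \<beta>' W"
    using bump_base[OF W(1)] by metis
  \<comment> \<open>The shifted coordinates must stay affine, so their cutoff comes from the base;
    the Hadamard coefficients make sense only on \<open>N\<close> and are cut off by
    \<open>\<beta>\<close>.\<close>
  define a where "a b y = \<beta>' (pr y) * inner (?\<Phi> y - z0) b" for b y
  define g where "g b y = \<beta> y * G b (?\<Phi> y)" for b y
  define \<gamma> where "\<gamma> y = \<beta>' (pr y) * \<beta> y" for y
  have a: "a b \<in> L" for b
    unfolding a_def
  proof (rule affine_cutoff[OF \<beta>'(1) K'])
    show "smooth_on (\<phi> ` W \<times> UNIV) (\<lambda>z. inner (z - z0) b)"
      by (intro smooth_intros open_image_total)
    fix p
    have "linear (\<lambda>u. inner u (snd b))" by (rule bounded_linear.linear[OF bounded_linear_inner_left])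
    moreover have "inner ((\<phi> p, u) - z0) b = (inner (\<phi> p - fst z0) (fst b) - inner (snd z0) (snd b)) + inner u (snd b)" for u
      by (simp add: inner_prod_def inner_diff_left)
    ultimately show "\<exists>k l. linear l \<and> (\<forall>u. inner ((\<phi> p, u) - z0) b = k + l u)" by blast
  qed
  have g: "g b \<in> C" for b
    unfolding g_def
    by (rule smooth_cutoff[OF atlas_total \<beta>(1) K N]) (rule smooth_on_subset[OF G(1)], auto simp: N_def)
  have \<gamma>: "\<gamma> \<in> C"
    using smooth_mult[OF smooth_comp_proj[OF \<beta>'(1)] \<beta>(1)] by (simp add: \<gamma>_def[abs_def])
  have \<gamma>0: "\<gamma> y0 = 1" by (simp add: \<gamma>_def \<beta>(2) \<beta>'(2))
  have eq: "(\<lambda>y. \<gamma> y * c y) = (\<lambda>y. (\<Sum>b\<in>orthobasis. a b y * g b y) + c y0 * \<gamma> y)"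
  proof
    fix y
    show "\<gamma> y * c y = (\<Sum>b\<in>orthobasis. a b y * g b y) + c y0 * \<gamma> y"
    proof (cases "y \<in> N")
      case True
      then have "c y = c y0 + (\<Sum>b\<in>orthobasis. inner (?\<Phi> y - z0) b * G b (?\<Phi> y))"
        using G(2)[of "?\<Phi> y"] total_inverse[of y] total_inverse[OF W(1)] by (simp add: N_def z0_def)
      then have "\<gamma> y * c y = c y0 * \<gamma> y + \<gamma> y * (\<Sum>b\<in>orthobasis. inner (?\<Phi> y - z0) b * G b (?\<Phi> y))"
        by (simp add: algebra_simps)
      also have "\<gamma> y * (\<Sum>b\<in>orthobasis. inner (?\<Phi> y - z0) b * G b (?\<Phi> y)) = (\<Sum>b\<in>orthobasis. a b y * g b y)"
        unfolding sum_distrib_left by (intro sum.cong refl) (simp add: a_def g_def \<gamma>_def mult_ac)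
      finally show ?thesis by simp
    next
      case False
      then have "\<beta> y = 0" by (rule supported_inD[OF K])
      then show ?thesis by (simp add: \<gamma>_def g_def)
    qed
  qed
  have ag: "(\<lambda>y. a b y * g b y) \<in> C" for b
    by (intro smooth_mult affine_smooth a g)
  have "\<delta> (\<lambda>y. \<gamma> y * c y) y0 = (\<Sum>b\<in>orthobasis. \<delta> (\<lambda>y. a b y * g b y) y0) + c y0 * \<delta> \<gamma> y0"
    unfolding eq
    by (subst derivation_lin[OF \<delta> smooth_sum[OF ag] \<gamma>], subst derivation_sum[OF \<delta> smooth_const smooth_add ag]) auto
  also have "(\<Sum>b\<in>orthobasis. \<delta> (\<lambda>y. a b y * g b y) y0) = 0"
  proof (intro sum.neutral ballI)
    fix b
    have "a b y0 = 0" by (simp add: a_def z0_def)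
    then show "\<delta> (\<lambda>y. a b y * g b y) y0 = 0"
      using derivation_mult[OF \<delta> affine_smooth[OF a[of b]] g[of b]] zero[OF a] by simp
  qed
  \<comment> \<open>On the left the product rule also yields
    \<open>c y0 * \<delta> \<gamma> y0\<close>; the two occurrences cancel.\<close>
  finally show "\<delta> c y0 = 0"
    using fun_cong[OF derivation_mult[OF \<delta> \<gamma> c], of y0] \<gamma>0 by simp
qed

text \<open>Near the fibre, \<open>a\<close> is a combination of fibre coordinates plus a constant
  term, with basic coefficients. The derivation kills these coefficients, and those of the
  coordinates vanish at \<open>y0\<close> since \<open>a\<close> is zero on the fibre. It follows
  that \<open>\<delta> a y0\<close> depends only on the restriction of \<open>a\<close> to the
  fibre.\<close>

lemma derivation_fibre_zero:
  assumes \<delta>: "derivation C \<delta>" and zero: "\<And>b. b \<in> B \<Longrightarrow> \<delta> b = (\<lambda>y. 0)"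
    and a: "a \<in> L" and a0: "\<And>y. pr y = pr y0 \<Longrightarrow> a y = 0"
  shows "\<delta> a y0 = 0"
proof -
  obtain W \<phi> \<psi> \<tau> \<theta> \<Psi> \<Theta> where W: "pr y0 \<in> W" "bundle_chart A W \<phi> \<psi> \<tau> \<theta> \<Psi> \<Theta>"
    by (rule bundle_chart_at)
  interpret bundle_chart A W \<phi> \<psi> \<tau> \<theta> \<Psi> \<Theta> by fact
  obtain \<beta> where \<beta>: "\<beta> \<in> C\<^sub>M" "\<beta> (pr y0) = 1" and K: "supported_in \<beta> W"
    using bump_base[OF W(1)] by metis
  define F where "F u x = a (\<Psi> (x, u))" for u x
  have F: "smooth_on (\<phi> ` W) (F u)" for u
    unfolding F_def
    by (rule smooth_on_slice[OF smooth_total[OF affine_smooth[OF a]]])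
  have coeff: "(\<lambda>p. \<beta> p * (F u (\<phi> p) - k * F 0 (\<phi> p))) \<circ> pr \<in> B" for u k
  proof -
    have "(\<lambda>p. \<beta> p * (F u (\<phi> p) - k * F 0 (\<phi> p))) \<in> C\<^sub>M"
      by (rule smooth_cutoff[where G="\<lambda>x. F u x - k * F 0 x", OF atlas_base \<beta>(1) K chart_base])
        (intro smooth_intros F open_image)
    then show ?thesis by (auto simp: basic_functions_def)
  qed
  \<comment> \<open>\<open>f u\<close> is the linear part of \<open>a\<close> at the basis vector
    \<open>u\<close>, \<open>k\<close> the value of \<open>a\<close> at the origin of the chart, and
    \<open>t b\<close> a fibre coordinate, all cut off. The factors 1 and 0 match the shape of
    \<open>coeff\<close>.\<close>
  define f where "f u y = \<beta> (pr y) * (F u (\<phi> (pr y)) - 1 * F 0 (\<phi> (pr y)))" for u y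
  define k where "k y = \<beta> (pr y) * (F 0 (\<phi> (pr y)) - 0 * F 0 (\<phi> (pr y)))" for y
  define t where "t b y = \<beta> (pr y) * inner (snd (\<phi> (pr y), \<tau> y)) b" for b y
  have f: "f u \<in> B" for u using coeff[of u 1] by (simp add: f_def[abs_def] o_def)
  have k: "k \<in> B" using coeff[of 0 0] by (simp add: k_def[abs_def] o_def)
  have t: "t b \<in> C" for b
    unfolding t_def
    by (rule smooth_cutoff_total[OF \<beta>(1) K _ smooth_comp_proj[OF \<beta>(1)]])
      (intro smooth_intros open_image_total)
  let ?b = "\<beta> \<circ> pr"
  have b: "?b \<in> B" using \<beta>(1) by (auto simp: basic_functions_def)
  \<comment> \<open>The square of the bump is needed because coefficient and coordinate each absorb
    one factor.\<close>
  have eq: "(\<lambda>y. (?b y * ?b y) * a y) = (\<lambda>y. (\<Sum>u\<in>orthobasis. f u y * t u y) + 1 * (k y * ?b y))"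
  proof
    fix y
    show "(?b y * ?b y) * a y = (\<Sum>u\<in>orthobasis. f u y * t u y) + 1 * (k y * ?b y)"
    proof (cases "pr y \<in> W")
      case True
      obtain l where l: "linear l" "\<And>u. a (\<Psi> (\<phi> (pr y), u)) = a (\<Psi> (\<phi> (pr y), 0)) + l u"
        using affine_function_\<Psi>[OF True a] by metis
      have lF: "l u = F u (\<phi> (pr y)) - F 0 (\<phi> (pr y))" for u
        using l(2)[of u] by (simp add: F_def)
      have "l (\<tau> y) = (\<Sum>u\<in>orthobasis. inner (\<tau> y) u * l u)"
        using has_derivative_orthobasis[OF bounded_linear_imp_has_derivative[OF linear_fin_euclidean_bounded[OF l(1)]], of "\<tau> y"]
        by simp
      moreover have "a y = F 0 (\<phi> (pr y)) + l (\<tau> y)"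
        using l(2)[of "\<tau> y"] total_inverse[OF True] by (simp add: F_def)
      ultimately have "(?b y * ?b y) * a y = k y * ?b y + (?b y * ?b y) * (\<Sum>u\<in>orthobasis. inner (\<tau> y) u * l u)"
        by (simp add: k_def algebra_simps)
      also have "(?b y * ?b y) * (\<Sum>u\<in>orthobasis. inner (\<tau> y) u * l u) = (\<Sum>u\<in>orthobasis. f u y * t u y)"
        unfolding sum_distrib_left by (intro sum.cong refl) (simp add: f_def t_def lF mult_ac)
      finally show ?thesis by simp
    next
      case False
      then have "\<beta> (pr y) = 0" by (rule supported_inD[OF K])
      then show ?thesis by (simp add: f_def k_def)
    qed
  qed
  have ft: "(\<lambda>y. f u y * t u y) \<in> C" for u
    by (intro smooth_mult basic_smooth f t)
  have "\<delta> (\<lambda>y. (?b y * ?b y) * a y) y0 = (\<Sum>u\<in>orthobasis. \<delta> (\<lambda>y. f u y * t u y) y0) + 1 * \<delta> (\<lambda>y. k y * ?b y) y0"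
    unfolding eq
    by (subst derivation_lin[OF \<delta> smooth_sum[OF ft] basic_smooth[OF basic_mult[OF k b]]],
        subst derivation_sum[OF \<delta> smooth_const smooth_add ft]) auto
  also have "(\<Sum>u\<in>orthobasis. \<delta> (\<lambda>y. f u y * t u y) y0) = 0"
  proof (intro sum.neutral ballI)
    fix u
    have "f u y0 = 0"
      using a0[of "\<Psi> (\<phi> (pr y0), _)"] by (simp add: f_def F_def proj_\<Psi> W(1))
    then show "\<delta> (\<lambda>y. f u y * t u y) y0 = 0"
      using derivation_mult[OF \<delta> basic_smooth[OF f[of u]] t[of u]] zero[OF f] by simp
  qed
  also have "\<delta> (\<lambda>y. k y * ?b y) = (\<lambda>y. 0)"
    by (rule zero[OF basic_mult[OF k b]])
  finally show ?thesis
    using derivation_mult[OF \<delta> basic_smooth[OF basic_mult[OF b b]] affine_smooth[OF a]] zero[OF basic_mult[OF b b]]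
    by (simp add: \<beta>(2))
qed

lemma aff_fibre_extend:
  assumes "\<alpha> \<in> aff_fibre A p"
  obtains a where "a \<in> L" "assoc_section A a p = \<alpha>"
proof -
  obtain W \<phi> \<psi> \<tau> \<theta> \<Psi> \<Theta> where W: "p \<in> W" "bundle_chart A W \<phi> \<psi> \<tau> \<theta> \<Psi> \<Theta>"
    by (rule bundle_chart_at)
  interpret bundle_chart A W \<phi> \<psi> \<tau> \<theta> \<Psi> \<Theta> by fact
  obtain l where l: "linear l" "\<And>u. \<alpha> (\<Psi> (\<phi> p, u)) = \<alpha> (\<Psi> (\<phi> p, 0)) + l u"
    using aff_fibre_\<Psi>[OF W(1) assms] by metis
  obtain \<beta> where \<beta>: "\<beta> \<in> C\<^sub>M" "\<beta> p = 1" and K: "supported_in \<beta> W"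
    using bump_base[OF W(1)] by metis
  define a where "a y = \<beta> (pr y) * (\<alpha> (\<Psi> (\<phi> p, 0)) + l (snd (\<phi> (pr y), \<tau> y)))" for y
  have "a \<in> L"
    unfolding a_def
  proof (rule affine_cutoff[where G="\<lambda>z. \<alpha> (\<Psi> (\<phi> p, 0)) + l (snd z)", OF \<beta>(1) K])
    show "smooth_on (\<phi> ` W \<times> UNIV) (\<lambda>z. \<alpha> (\<Psi> (\<phi> p, 0)) + l (snd z))"
      by (intro smooth_on_add smooth_on_const smooth_on_bounded_linear[OF _ linear_fin_euclidean_bounded[OF l(1)]]
          smooth_on_snd smooth_on_id open_image_total)
    show "\<exists>k l'. linear l' \<and> (\<forall>u. \<alpha> (\<Psi> (\<phi> p, 0)) + l (snd (\<phi> q, u)) = k + l' u)" for q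
      using l(1) unfolding snd_conv by blast
  qed
  moreover have "assoc_section A a p = \<alpha>"
  proof
    fix y
    show "assoc_section A a p y = \<alpha> y"
    proof (cases "pr y = p")
      case True
      then have "\<alpha> y = \<alpha> (\<Psi> (\<phi> p, 0)) + l (\<tau> y)"
        using l(2)[of "\<tau> y"] total_inverse[of y] W(1) by simp
      with True show ?thesis by (simp add: assoc_section_def ab_fibre_def a_def \<beta>(2))
    next
      case False
      then show ?thesis
        using assms by (auto simp: assoc_section_def ab_fibre_def aff_fibre_def extensional_def)
    qed
  qed
  ultimately show ?thesis by (rule that)
qed

end


section \<open>Operators generated by vertical lifts\<close>

context affine_bundle_space
begin

lemma smooth_lin: "f \<in> C \<Longrightarrow> g \<in> C \<Longrightarrow> (\<lambda>y. f y + k * g y) \<in> C"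
  using smooth_add[OF _ smooth_mult[OF smooth_const[of k]]] .

lemma derivation_smooth_zero: "derivation C \<delta> \<Longrightarrow> \<delta> (\<lambda>y. 0) = (\<lambda>y. 0)"
  by (rule derivation_zero[OF _ smooth_const])

lemma derivation_combination:
  assumes "derivation C \<delta>" "derivation C \<epsilon>"
  shows "derivation C (\<lambda>f y. k * \<delta> f y + k' * \<epsilon> f y)"
  unfolding derivation_def
proof (intro conjI ballI allI)
  fix f g c assume f: "f \<in> C" and g: "g \<in> C"
  show "(\<lambda>y. k * \<delta> f y + k' * \<epsilon> f y) \<in> C"
    by (intro smooth_lin smooth_mult smooth_const derivation_closed[OF assms(1)] derivation_closed[OF assms(2)] f)
qed (simp_all add: derivation_lin[OF assms(1)] derivation_lin[OF assms(2)] derivation_mult[OF assms(1)]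
    derivation_mult[OF assms(2)] algebra_simps)

lemma derivation_diff:
  "derivation C \<delta> \<Longrightarrow> derivation C \<epsilon> \<Longrightarrow> derivation C (\<lambda>f y. \<delta> f y - \<epsilon> f y)"
  using derivation_combination[of \<delta> \<epsilon> 1 "-1"] by simp

text \<open>The mixed terms \<delta>(f) \<epsilon>(g) and \<epsilon>(f) \<delta>(g) of the two
  product rules cancel in the difference.\<close>

lemma derivation_commutator:
  assumes \<delta>: "derivation C \<delta>" and \<epsilon>: "derivation C \<epsilon>"
  shows "derivation C (\<lambda>f y. \<delta> (\<epsilon> f) y - \<epsilon> (\<delta> f) y)"
  unfolding derivation_def
proof (intro conjI ballI allI)
  note cl = derivation_closed[OF \<delta>] derivation_closed[OF \<epsilon>]
  note lin = derivation_lin[OF \<delta>] derivation_lin[OF \<epsilon>]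
  note mul = derivation_mult[OF \<delta>] derivation_mult[OF \<epsilon>]
  note add = derivation_add[OF \<delta>] derivation_add[OF \<epsilon>]
  fix f g c assume f: "f \<in> C" and g: "g \<in> C"
  show "(\<lambda>y. \<delta> (\<epsilon> f) y - \<epsilon> (\<delta> f) y) \<in> C"
    using smooth_lin[of "\<delta> (\<epsilon> f)" "\<epsilon> (\<delta> f)" "-1"] f by (simp add: cl)
  show "(\<lambda>y. \<delta> (\<epsilon> (\<lambda>x. f x + c * g x)) y - \<epsilon> (\<delta> (\<lambda>x. f x + c * g x)) y) =
      (\<lambda>x. \<delta> (\<epsilon> f) x - \<epsilon> (\<delta> f) x + c * (\<delta> (\<epsilon> g) x - \<epsilon> (\<delta> g) x))"
    using f g by (simp add: lin cl algebra_simps)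
  show "(\<lambda>y. \<delta> (\<epsilon> (\<lambda>x. f x * g x)) y - \<epsilon> (\<delta> (\<lambda>x. f x * g x)) y) =
      (\<lambda>x. f x * (\<delta> (\<epsilon> g) x - \<epsilon> (\<delta> g) x) + (\<delta> (\<epsilon> f) x - \<epsilon> (\<delta> f) x) * g x)"
    using f g by (simp add: mul cl add smooth_mult algebra_simps)
qed

text \<open>The only properties of the elements of \<open>vertical_lifts\<close> that are needed to verify that
  brackets with them vanish.\<close>

definition vertical_operator :: "'a polydiffop \<Rightarrow> bool" where
  "vertical_operator D \<longleftrightarrow> snd D = (\<lambda>fs x. 0) \<and> fst D [] \<in> B \<and> derivation C (\<lambda>f. fst D [f]) \<and>
     (\<forall>f. f \<notin> C \<longrightarrow> fst D [f] = (\<lambda>x. 0)) \<and> (\<forall>b\<in>B. fst D [b] = (\<lambda>x. 0)) \<and> (\<forall>a\<in>L. fst D [a] \<in> B) \<and>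
     (\<forall>fs. length fs > 1 \<longrightarrow> fst D fs = (\<lambda>x. 0))"

lemma vertical_lifts_vertical_operator:
  assumes "D \<in> vertical_lifts A"
  shows "vertical_operator D"
  using assms
proof induction
  case (section_lift X)
  have "vertical_lift A X [] \<in> B"
    using basic_const[of 0] by (simp add: vertical_lift_def[abs_def])
  then show ?case
    using vertical_lift_derivation[OF section_lift] vertical_lift_basic[OF section_lift]
      vertical_lift_affine[OF section_lift]
    by (auto simp: vertical_operator_def) (auto simp: vertical_lift_def fun_eq_iff)
next
  case (function_lift f)
  have lift: "function_lift A f [] = f \<circ> pr" "fs \<noteq> [] \<Longrightarrow> function_lift A f fs = (\<lambda>y. 0)" for fs
    by (auto simp: function_lift_def fun_eq_iff)
  have "f \<circ> pr \<in> B"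
    using function_lift by (auto simp: basic_functions_def)
  moreover have "derivation C (\<lambda>f y. 0)"
    by (simp add: derivation_def smooth_const)
  ultimately show ?case
    using basic_const[of 0] lift(2)[OF length_greater_0_conv[THEN iffD1, OF less_trans[OF zero_less_Suc]]]
    by (auto simp: vertical_operator_def lift)
next
  case (linear_combination D D' c c')
  have "(\<lambda>x. c * fst D fs x + c' * fst D' fs x) \<in> B" if "fst D fs \<in> B" "fst D' fs \<in> B" for fs
    by (intro basic_add basic_mult basic_const that)
  with linear_combination.IH show ?case
    by (auto simp: vertical_operator_def intro: derivation_combination)
qed

end


section \<open>Bivector fields and vector fields on an affine bundle\<close>

locale affine_bundle_fields = affine_bundle_space A
  for A :: "('a::{t2_space, second_countable_topology}, 'w::{t2_space, second_countable_topology},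
      'm::{t2_space, second_countable_topology}, 'e::fin_euclidean, 'f::fin_euclidean) affine_bundle" +
  fixes \<Lambda> E :: "'a polyvector"
  assumes rank: "ab_rank A > 0"
    and bivector: "multivector_field 2 (ab_total A) \<Lambda>"
    and vector: "multivector_field 1 (ab_total A) E"
begin

lemmas E_derivation = vector_field_derivation[OF vector]
lemmas \<Lambda>_derivation = bivector_field_derivation2[OF bivector]
lemmas \<Lambda>_derivation1 = bivector_field_derivation1[OF bivector]

lemma E_support: "\<not> (length fs = 1 \<and> set fs \<subseteq> C) \<Longrightarrow> E fs = (\<lambda>x. 0)"
  by (rule vector_field_support[OF vector])

lemma \<Lambda>_support: "\<not> (length fs = 2 \<and> set fs \<subseteq> C) \<Longrightarrow> \<Lambda> fs = (\<lambda>x. 0)"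
  by (rule bivector_field_support[OF bivector])

lemma E_zero: "E ((\<lambda>x. 0) # gs) = (\<lambda>x. 0)"
  using derivation_smooth_zero[OF E_derivation] E_support[of "(\<lambda>x. 0) # gs"] by (cases gs) auto

lemma \<Lambda>_zero: "\<Lambda> ((\<lambda>x. 0) # gs) = (\<lambda>x. 0)"
proof (cases "length gs = 1 \<and> set gs \<subseteq> C")
  case True
  then obtain g where "gs = [g]" "g \<in> C" by (auto simp: length_Suc_conv)
  then show ?thesis using derivation_smooth_zero[OF \<Lambda>_derivation1] by simp
next
  case False
  then show ?thesis by (intro \<Lambda>_support) auto
qed

lemma \<Lambda>_antisym: "\<Lambda> [f, g] = (\<lambda>y. - \<Lambda> [g, f] y)"
proof (cases "f \<in> C \<and> g \<in> C")
  case True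
  then show ?thesis
    by (intro bivector_field_antisym[OF bivector]) (auto intro: smooth_add)
next
  case False
  then show ?thesis using \<Lambda>_support[of "[f, g]"] \<Lambda>_support[of "[g, f]"] by auto
qed

lemma \<Lambda>_one: "a \<in> C \<Longrightarrow> \<Lambda> [\<lambda>y. 1, a] = (\<lambda>y. 0)"
  by (rule derivation_const[OF \<Lambda>_derivation1 smooth_const])

lemma E_one: "E [\<lambda>y. 1] = (\<lambda>y. 0)"
  by (rule derivation_const[OF E_derivation smooth_const])

section \<open>Tests for basic and for vanishing functions\<close>

text \<open>With k = X^v(h) basic, differentiating h^2 twice along X^v gives 2 k^2. This must be
  zero because h^2 is affine.\<close>

lemma basic_if_square_affine:
  assumes h: "h \<in> L" and hh: "(\<lambda>y. h y * h y) \<in> L"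
  shows "h \<in> B"
proof (rule basic_if_vertical_zero[OF affine_smooth[OF h]])
  fix X assume X: "vb_section V X"
  note D = vertical_lift_derivation[OF X]
  let ?k = "vert X h"
  have k: "?k \<in> B" by (rule vertical_lift_affine[OF X h])
  have hk: "(\<lambda>y. h y * ?k y) \<in> C"
    by (intro smooth_mult affine_smooth[OF h] basic_smooth[OF k])
  have "vert X (\<lambda>y. h y * h y) = (\<lambda>y. h y * ?k y + h y * ?k y)"
    using derivation_mult[OF D affine_smooth[OF h] affine_smooth[OF h]] by (simp add: mult.commute)
  then have "vert X (\<lambda>y. h y * ?k y + h y * ?k y) = (\<lambda>y. 0)"
    using vertical_lift_basic[OF X vertical_lift_affine[OF X hh]] by simp
  then show "?k = (\<lambda>y. 0)"
    unfolding derivation_add[OF D hk hk] derivation_mult[OF D affine_smooth[OF h] basic_smooth[OF k]]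
      vertical_lift_basic[OF X k]
    by (auto simp: fun_eq_iff)
qed

text \<open>Applying X^v to the basic function f a leaves f X^v(a) = 0; positive rank does the
  rest.\<close>

lemma zero_if_multiples_basic:
  assumes f: "f \<in> B" and fa: "\<And>a. a \<in> L \<Longrightarrow> (\<lambda>y. f y * a y) \<in> B"
  shows "f = (\<lambda>y. 0)"
proof
  fix y
  show "f y = 0"
  proof (rule zero_if_mult_vertical_zero[OF rank])
    fix X a assume X: "vb_section V X" and a: "a \<in> L"
    show "f y * vert X a y = 0"
      using derivation_mult[OF vertical_lift_derivation[OF X] basic_smooth[OF f] affine_smooth[OF a]]
        vertical_lift_basic[OF X f] vertical_lift_basic[OF X fa[OF a]] by (simp add: fun_eq_iff)
  qed
qed

section \<open>Fibre compatibility and its consequences\<close>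

definition fibre_compatible :: bool where
  "fibre_compatible \<longleftrightarrow> (\<forall>b\<in>B. E [b] = (\<lambda>y. 0)) \<and> (\<forall>a\<in>L. E [a] \<in> B) \<and> (\<forall>a\<in>L. \<forall>b\<in>L. \<Lambda> [a, b] \<in> L)"

text \<open>The difference E(b a) - b E(a) = E(b) a is basic for every affine a.\<close>

lemma E_basic_zero:
  assumes E: "\<And>a. a \<in> L \<Longrightarrow> E [a] \<in> B" and b: "b \<in> B"
  shows "E [b] = (\<lambda>y. 0)"
proof (rule zero_if_multiples_basic)
  show "E [b] \<in> B" by (rule E[OF basic_affine[OF b]])
  fix a assume a: "a \<in> L"
  have "E [\<lambda>y. b y * a y] \<in> B" by (rule E[OF affine_mult_basic[OF b a]])
  then have "(\<lambda>y. (b y * E [a] y + E [b] y * a y) - b y * E [a] y) \<in> B"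
    unfolding derivation_mult[OF E_derivation basic_smooth[OF b] affine_smooth[OF a]]
    by (intro basic_diff basic_mult b E a)
  then show "(\<lambda>y. E [b] y * a y) \<in> B" by simp
qed

text \<open>The bracket differs from \<Lambda>(da, db) by a E(b) and b E(a), which are affine once
  the values of E are basic. This is the common entry from conditions (iii), (iv) and (v).\<close>

lemma fibre_compatibleI:
  assumes E: "\<And>a. a \<in> L \<Longrightarrow> E [a] \<in> B" and jac: "affine_jacobi A \<Lambda> E"
  shows fibre_compatible
proof -
  have "\<Lambda> [a, b] \<in> L" if a: "a \<in> L" and b: "b \<in> L" for a b
  proof -
    have "jacobi_bracket \<Lambda> E a b \<in> L" using jac a b by (simp add: affine_jacobi_def)
    from affine_add[OF affine_diff[OF this affine_mult_basic[OF E[OF b] a]] affine_mult_basic[OF E[OF a] b]]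
    show ?thesis by (simp add: jacobi_bracket_def mult.commute)
  qed
  then show ?thesis using E E_basic_zero[OF E] by (simp add: fibre_compatible_def)
qed

lemma
  assumes fibre_compatible
  shows compatible_E_basic: "b \<in> B \<Longrightarrow> E [b] = (\<lambda>y. 0)"
    and compatible_E_affine: "a \<in> L \<Longrightarrow> E [a] \<in> B"
    and compatible_affine: "a \<in> L \<Longrightarrow> a' \<in> L \<Longrightarrow> \<Lambda> [a, a'] \<in> L"
  using assms by (auto simp: fibre_compatible_def)

lemma compatible_basic_affine:
  assumes comp: fibre_compatible and f: "f \<in> B" and a: "a \<in> L"
  shows "\<Lambda> [f, a] \<in> B"
proof (rule basic_if_square_affine)
  let ?h = "\<Lambda> [f, a]"
  show h: "?h \<in> L" by (rule compatible_affine[OF comp basic_affine[OF f] a])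
  have "\<Lambda> [\<lambda>y. f y * ?h y, a] \<in> L"
    by (intro compatible_affine[OF comp] affine_mult_basic f h a)
  then have "(\<lambda>y. (f y * \<Lambda> [?h, a] y + ?h y * ?h y) - f y * \<Lambda> [?h, a] y) \<in> L"
    unfolding derivation_mult[OF \<Lambda>_derivation1[OF affine_smooth[OF a]] basic_smooth[OF f] affine_smooth[OF h]]
    by (intro affine_diff affine_mult_basic f compatible_affine[OF comp] h a)
  then show "(\<lambda>y. ?h y * ?h y) \<in> L" by simp
qed

text \<open>The argument of \<open>E_basic_zero\<close> for the derivation
  \<open>\<Lambda> [f, _]\<close>, which maps affine functions to basic ones by
  \<open>compatible_basic_affine\<close>.\<close>

lemma compatible_basic_basic:
  assumes comp: fibre_compatible and f: "f \<in> B" and g: "g \<in> B"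
  shows "\<Lambda> [f, g] = (\<lambda>y. 0)"
proof (rule zero_if_multiples_basic)
  note BL = compatible_basic_affine[OF comp f]
  show "\<Lambda> [f, g] \<in> B" by (rule BL[OF basic_affine[OF g]])
  fix a assume a: "a \<in> L"
  have "\<Lambda> [f, \<lambda>y. g y * a y] \<in> B" by (rule BL[OF affine_mult_basic[OF g a]])
  then have "(\<lambda>y. (g y * \<Lambda> [f, a] y + \<Lambda> [f, g] y * a y) - g y * \<Lambda> [f, a] y) \<in> B"
    unfolding derivation_mult[OF \<Lambda>_derivation[OF basic_smooth[OF f]] basic_smooth[OF g] affine_smooth[OF a]]
    by (intro basic_diff basic_mult g BL a)
  then show "(\<lambda>y. \<Lambda> [f, g] y * a y) \<in> B" by simp
qed

section \<open>Single and double brackets with vertical operators\<close>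

lemma vertical_operator_zero: "vertical_operator (P, Z) \<Longrightarrow> P ((\<lambda>x. 0) # gs) = (\<lambda>x. 0)"
  using derivation_smooth_zero[of "\<lambda>f. P [f]"] by (cases gs) (auto simp: vertical_operator_def)

text \<open>With \<open>P\<close> viewed as a function plus a vector field, the degree-two part is
  the Lie derivative of \<open>\<Lambda>\<close>, the degree-one part its contraction with the
  function corrected by \<open>E\<close>, and the second component holds the Lie derivative of
  \<open>E\<close>. The vanishing statements at the end are what allows the bracket formula to be
  applied once more.\<close>

lemma bracket_once:
  assumes D: "vertical_operator (P, \<lambda>fs x. 0)"
  defines "R \<equiv> schouten_jacobi (P, \<lambda>fs x. 0) (\<Lambda>, E)"
  shows "fst R [] = (\<lambda>x. 0)"
    and "fst R [g] = (\<lambda>x. - (\<Lambda> [P [], g] x + P [] x * E [g] x))"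
    and "fst R [g, h] = (\<lambda>x. P [\<Lambda> [g, h]] x - \<Lambda> [P [g], h] x - \<Lambda> [g, P [h]] x)"
    and "length fs > 2 \<Longrightarrow> fst R fs = (\<lambda>x. 0)"
    and "snd R [] = E [P []]"
    and "snd R [g] = (\<lambda>x. P [E [g]] x - E [P [g]] x)"
    and "length fs > 1 \<Longrightarrow> snd R fs = (\<lambda>x. 0)"
    and "fst R ((\<lambda>x. 0) # gs) = (\<lambda>x. 0)"
    and "snd R ((\<lambda>x. 0) # gs) = (\<lambda>x. 0)"
proof -
  note P0 = vertical_operator_zero[OF D]
  have P': "P gs = (\<lambda>x. 0)" if "length gs > 1" for gs
    using D that by (simp add: vertical_operator_def)
  have L': "\<Lambda> gs = (\<lambda>x. 0)" if "length gs > 2" for gs using that by (intro \<Lambda>_support) auto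
  have E': "E gs = (\<lambda>x. 0)" if "length gs > 1" for gs using that by (intro E_support) auto
  note F = schouten_jacobi_order1[of P \<Lambda> E, OF P0 \<Lambda>_zero E_zero P' L' E', folded R_def, simplified]
  have short: "\<Lambda> [] = (\<lambda>x. 0)" "\<Lambda> [g] = (\<lambda>x. 0)" "E [] = (\<lambda>x. 0)" "E [g, h] = (\<lambda>x. 0)" for g h
    by (simp_all add: \<Lambda>_support E_support)
  show 0: "fst R [] = (\<lambda>x. 0)" by (simp add: F short P0)
  show 1: "fst R [g] = (\<lambda>x. - (\<Lambda> [P [], g] x + P [] x * E [g] x))" for g by (simp add: F short P0)
  show 2: "fst R [g, h] = (\<lambda>x. P [\<Lambda> [g, h]] x - \<Lambda> [P [g], h] x - \<Lambda> [g, P [h]] x)" for g h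
    using \<Lambda>_antisym[of g "P [h]"] by (simp add: F)
  show 3: "length fs > 2 \<Longrightarrow> fst R fs = (\<lambda>x. 0)" for fs by (simp add: F)
  show "snd R [] = E [P []]" by (simp add: F short P0)
  show 4: "snd R [g] = (\<lambda>x. P [E [g]] x - E [P [g]] x)" for g by (simp add: F)
  show 5: "length fs > 1 \<Longrightarrow> snd R fs = (\<lambda>x. 0)" for fs by (simp add: F)
  have \<Lambda>0: "\<Lambda> [g, \<lambda>x. 0] = (\<lambda>x. 0)" for g
    using \<Lambda>_antisym[of g "\<lambda>x. 0"] by (simp add: \<Lambda>_zero)
  show "snd R ((\<lambda>x. 0) # gs) = (\<lambda>x. 0)"
    by (cases gs) (simp_all add: 4 5 P0 E_zero)
  consider "gs = []" | h where "gs = [h]" | "length gs > 1"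
    by (cases gs; cases "tl gs") auto
  then show "fst R ((\<lambda>x. 0) # gs) = (\<lambda>x. 0)"
    by cases (simp_all add: 1 2 3 P0 \<Lambda>_zero \<Lambda>0 E_zero)
qed

text \<open>The degree-zero part is the Jacobi bracket of the two functions \<open>P []\<close> and
  \<open>P' []\<close>; this is how homogeneity gives access to the bracket of basic
  functions.\<close>

lemma bracket_twice:
  assumes D: "vertical_operator (P, \<lambda>fs x. 0)" and D': "vertical_operator (P', \<lambda>fs x. 0)"
  defines "R \<equiv> schouten_jacobi (P, \<lambda>fs x. 0) (\<Lambda>, E)"
  defines "T \<equiv> schouten_jacobi (P', \<lambda>fs x. 0) R"
  shows "fst T [] = (\<lambda>x. \<Lambda> [P [], P' []] x + P [] x * E [P' []] x - P' [] x * E [P []] x)"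
    and "fst T [g] = (\<lambda>x. P' [fst R [g]] x - fst R [P' [g]] x - fst R [P' [], g] x - P' [] x * snd R [g] x)" (is "PROP ?a")
    and "fst T [g, h] = (\<lambda>x. P' [fst R [g, h]] x - fst R [P' [g], h] x + fst R [P' [h], g] x)" (is "PROP ?b")
    and "length fs > 2 \<Longrightarrow> fst T fs = (\<lambda>x. 0)" (is "PROP ?c")
    and "snd T [] = (\<lambda>x. P' [snd R []] x + snd R [P' []] x)" (is "PROP ?d")
    and "snd T [g] = (\<lambda>x. P' [snd R [g]] x - snd R [P' [g]] x)" (is "PROP ?e")
    and "length fs > 1 \<Longrightarrow> snd T fs = (\<lambda>x. 0)" (is "PROP ?f")
proof -
  note R = bracket_once[OF D, folded R_def]
  have P': "P' gs = (\<lambda>x. 0)" if "length gs > 1" for gs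
    using D' that by (simp add: vertical_operator_def)
  note F = schouten_jacobi_order1[of P' "fst R" "snd R", OF vertical_operator_zero[OF D'] R(8,9) P' R(4,7),
      unfolded prod.collapse, folded T_def, simplified]
  show "fst T [] = (\<lambda>x. \<Lambda> [P [], P' []] x + P [] x * E [P' []] x - P' [] x * E [P []] x)"
    by (simp add: F R(1,2,5) vertical_operator_zero[OF D'] fun_eq_iff)
  show "PROP ?a" "PROP ?b" "PROP ?c" "PROP ?d" "PROP ?e" "PROP ?f"
    by (simp_all add: F)
qed

lemma polydiffop_zeroI:
  assumes "fst F [] = (\<lambda>x. 0)" "\<And>g. fst F [g] = (\<lambda>x. 0)" "\<And>g h. fst F [g, h] = (\<lambda>x. 0)"
    "\<And>fs. length fs > 2 \<Longrightarrow> fst F fs = (\<lambda>x. 0)"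
    "snd F [] = (\<lambda>x. 0)" "\<And>g. snd F [g] = (\<lambda>x. 0)" "\<And>fs. length fs > 1 \<Longrightarrow> snd F fs = (\<lambda>x. 0)"
  shows "F = zero_polydiffop"
proof -
  have "fst F fs = (\<lambda>x. 0)" for fs
  proof -
    consider "fs = []" | g where "fs = [g]" | g h where "fs = [g, h]" | "length fs > 2"
      by (cases fs; cases "tl fs"; cases "tl (tl fs)") auto
    then show ?thesis by cases (simp_all add: assms)
  qed
  moreover have "snd F fs = (\<lambda>x. 0)" for fs
  proof -
    consider "fs = []" | g where "fs = [g]" | "length fs > 1"
      by (cases fs; cases "tl fs") auto
    then show ?thesis by cases (simp_all add: assms)
  qed
  ultimately show ?thesis by (simp add: zero_polydiffop_def prod_eq_iff fun_eq_iff)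
qed

lemma vertical_operatorD:
  assumes "vertical_operator (P, Z)"
  shows "P [] \<in> B" "derivation C (\<lambda>f. P [f])" "f \<notin> C \<Longrightarrow> P [f] = (\<lambda>x. 0)"
    "b \<in> B \<Longrightarrow> P [b] = (\<lambda>x. 0)" "a \<in> L \<Longrightarrow> P [a] \<in> B"
    "length fs > 1 \<Longrightarrow> P fs = (\<lambda>x. 0)"
  using assms by (auto simp: vertical_operator_def)

lemma vertical_lifts_obtain:
  assumes "D \<in> vertical_lifts A"
  obtains P where "D = (P, \<lambda>fs x. 0)" "vertical_operator (P, \<lambda>fs x. 0)"
  using vertical_lifts_vertical_operator[OF assms] that[of "fst D"]
  by (cases D) (auto simp: vertical_operator_def)

section \<open>Compatibility implies homogeneity\<close>

text \<open>On affine functions both composites vanish: each factor maps affine to basic and kills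
  basic functions. For nonsmooth \<open>g\<close> both sides are the default value 0.\<close>

lemma compatible_commutes_E:
  assumes comp: fibre_compatible and D: "vertical_operator (P, \<lambda>fs x. 0)"
  shows "P [E [g]] = E [P [g]]"
proof (cases "g \<in> C")
  case True
  have "(\<lambda>y. P [E [g]] y - E [P [g]] y) = (\<lambda>y. 0)"
    by (rule derivation_zero_if_affine_zero[OF derivation_commutator[OF vertical_operatorD(2)[OF D] E_derivation] _ True])
      (simp add: vertical_operatorD(4,5)[OF D] compatible_E_affine[OF comp] compatible_E_basic[OF comp])
  then show ?thesis by (simp add: fun_eq_iff)
next
  case False
  then show ?thesis
    by (simp add: vertical_operatorD(3)[OF D] E_support E_zero vertical_operator_zero[OF D])
qed

text \<open>After one bracket the second component is already zero, while the first kills basic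
  arguments in degree two and maps affine pairs to basic functions. The second bracket
  differentiates these basic functions or inserts basic arguments, so it vanishes on affine
  arguments, and then on smooth ones because it is a derivation in each slot.\<close>

lemma compatible_imp_homogeneous:
  assumes comp: fibre_compatible
  shows "affine_homogeneous_jacobi A \<Lambda> E"
  unfolding affine_homogeneous_jacobi_def
proof (intro ballI)
  fix D1 D2 assume "D1 \<in> vertical_lifts A" "D2 \<in> vertical_lifts A"
  then obtain P P' where D2: "D2 = (P, \<lambda>fs x. 0)" and D: "vertical_operator (P, \<lambda>fs x. 0)"
    and D1: "D1 = (P', \<lambda>fs x. 0)" and D': "vertical_operator (P', \<lambda>fs x. 0)"
    by (metis vertical_lifts_obtain)
  define R where "R = schouten_jacobi (P, \<lambda>fs x. 0) (\<Lambda>, E)"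
  note R = bracket_once[OF D, folded R_def] and T = bracket_twice[OF D D', folded R_def]
  note P = vertical_operatorD[OF D] and P' = vertical_operatorD[OF D']
  note BB = compatible_basic_basic[OF comp] and BL = compatible_basic_affine[OF comp]
  have \<Lambda>0: "\<Lambda> [g, \<lambda>x. 0] = (\<lambda>x. 0)" for g
    using \<Lambda>_antisym[of g "\<lambda>x. 0"] by (simp add: \<Lambda>_zero)
  have LB: "\<Lambda> [a, b] \<in> B" if "a \<in> L" "b \<in> B" for a b
    unfolding \<Lambda>_antisym[of a b] by (intro basic_minus BL that)
  have P0: "P [\<lambda>x. 0] = (\<lambda>x. 0)" and P'0: "P' [\<lambda>x. 0] = (\<lambda>x. 0)"
    using vertical_operator_zero[OF D] vertical_operator_zero[OF D'] by auto
  have R2: "snd R fs = (\<lambda>x. 0)" for fs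
  proof -
    consider "fs = []" | g where "fs = [g]" | "length fs > 1"
      by (cases fs; cases "tl fs") auto
    then show ?thesis
      by cases (simp_all add: R(5,6,7) compatible_E_basic[OF comp P(1)] compatible_commutes_E[OF comp D])
  qed
  have R1_nonsmooth: "fst R [g, h] = (\<lambda>x. 0)" if "g \<notin> C \<or> h \<notin> C" for g h
    using that by (auto simp: R(3) \<Lambda>_support P(3) P0 \<Lambda>_zero \<Lambda>0)
  have R1_antisym: "fst R [g, h] = (\<lambda>x. - fst R [h, g] x)" for g h
  proof -
    have "P [\<Lambda> [g, h]] = (\<lambda>x. - P [\<Lambda> [h, g]] x)"
    proof (cases "g \<in> C \<and> h \<in> C")
      case True
      \<comment> \<open>The sign is pulled out in the form \<open>f + c * g\<close>, the only
        linearity that \<open>derivation\<close> records.\<close>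
      have "P [\<lambda>x. 0 + (-1) * \<Lambda> [h, g] x] = (\<lambda>x. P [\<lambda>x. 0] x + (-1) * P [\<Lambda> [h, g]] x)"
        by (rule derivation_lin[OF P(2) smooth_const]) (use True derivation_closed[OF \<Lambda>_derivation] in blast)
      then show ?thesis by (simp add: P0 \<Lambda>_antisym[of g h])
    qed (auto simp: \<Lambda>_support P0)
    then show ?thesis
      using \<Lambda>_antisym[of "P [g]" h] \<Lambda>_antisym[of g "P [h]"] by (simp add: R(3) fun_eq_iff)
  qed
  have R1_derivation: "derivation C (\<lambda>h. fst R [g, h])" if g: "g \<in> C" for g
  proof -
    have "derivation C (\<lambda>h y. (P [\<Lambda> [g, h]] y - \<Lambda> [g, P [h]] y) - \<Lambda> [P [g], h] y)"
      by (intro derivation_diff derivation_commutator P(2) \<Lambda>_derivation g derivation_closed[OF P(2)])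
    then show ?thesis by (simp add: R(3) algebra_simps)
  qed
  have R1_basic: "fst R [b, h] = (\<lambda>x. 0)" if b: "b \<in> B" for b h
  proof (cases "h \<in> C")
    case True
    show ?thesis
      by (rule derivation_zero_if_affine_zero[OF R1_derivation[OF basic_smooth[OF b]] _ True])
        (simp add: R(3) P(4,5) b BB BL \<Lambda>_zero)
  qed (simp add: R1_nonsmooth)
  have R1_affine: "fst R [a, a'] \<in> B" if "a \<in> L" "a' \<in> L" for a a'
    unfolding R(3) by (intro basic_diff P(5) compatible_affine[OF comp] BL LB that)
  \<comment> \<open>Up to sign, the degree-one part of the first bracket: a derivation that takes
    affine functions to basic ones and basic ones to zero.\<close>
  define H where "H g = (\<lambda>y. \<Lambda> [P [], g] y + P [] y * E [g] y)" for g
  have H_derivation: "derivation C H"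
    unfolding derivation_def H_def
    using derivation_closed[OF \<Lambda>_derivation[OF basic_smooth[OF P(1)]]] derivation_closed[OF E_derivation] basic_smooth[OF P(1)]
    by (auto simp: derivation_lin[OF \<Lambda>_derivation[OF basic_smooth[OF P(1)]]] derivation_mult[OF \<Lambda>_derivation[OF basic_smooth[OF P(1)]]]
        derivation_lin[OF E_derivation] derivation_mult[OF E_derivation] algebra_simps intro!: smooth_add smooth_mult)
  have H_comm: "P' [H g] = H (P' [g])" for g
  proof (cases "g \<in> C")
    case True
    have "H a \<in> B" "H (P' [a]) = (\<lambda>y. 0)" if "a \<in> L" for a
      unfolding H_def using that
      by (auto intro!: basic_add basic_mult BL P(1) compatible_E_affine[OF comp]
          simp: BB P(1) P'(5) compatible_E_basic[OF comp])
    then have "(\<lambda>y. P' [H g] y - H (P' [g]) y) = (\<lambda>y. 0)"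
      by (intro derivation_zero_if_affine_zero[OF derivation_commutator[OF P'(2) H_derivation] _ True])
        (simp add: P'(4))
    then show ?thesis by (simp add: fun_eq_iff)
  next
    case False
    then show ?thesis by (simp add: H_def \<Lambda>_support E_support P'(3) \<Lambda>0 E_zero P'0)
  qed
  \<comment> \<open>The Lie derivative along \<open>P'\<close> of the degree-two part of
    \<open>R\<close>, written so that its antisymmetry is visible.\<close>
  define K where "K g h = (\<lambda>x. P' [fst R [g, h]] x - fst R [P' [g], h] x - fst R [g, P' [h]] x)" for g h
  have K_derivation: "derivation C (K g)" if g: "g \<in> C" for g
  proof -
    have "derivation C (\<lambda>h y. (P' [fst R [g, h]] y - fst R [g, P' [h]] y) - fst R [P' [g], h] y)"
      by (intro derivation_diff derivation_commutator P'(2) R1_derivation g derivation_closed[OF P'(2)])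
    then show ?thesis by (simp add: K_def[abs_def] algebra_simps)
  qed
  have K_antisym: "K g h = (\<lambda>x. - K h g x)" if "g \<in> C" "h \<in> C" for g h
  proof -
    have "P' [\<lambda>x. 0 + (-1) * fst R [h, g] x] = (\<lambda>x. P' [\<lambda>x. 0] x + (-1) * P' [fst R [h, g]] x)"
      by (rule derivation_lin[OF P'(2) smooth_const derivation_closed[OF R1_derivation]]) (use that in auto)
    then have "P' [fst R [g, h]] = (\<lambda>x. - P' [fst R [h, g]] x)"
      by (simp add: P'0 R1_antisym[of g h])
    then show ?thesis
      using R1_antisym[of "P' [g]" h] R1_antisym[of g "P' [h]"] by (simp add: K_def fun_eq_iff)
  qed
  have R1_basic2: "fst R [h, b] = (\<lambda>x. 0)" if "b \<in> B" for b h
    using R1_antisym[of h b] R1_basic[OF that] by simp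
  have K1: "K a h = (\<lambda>x. 0)" if a: "a \<in> L" and h: "h \<in> C" for a h
    by (rule derivation_zero_if_affine_zero[OF K_derivation[OF affine_smooth[OF a]] _ h])
      (simp add: K_def P'(4,5) a R1_basic R1_basic2 R1_affine)
  \<comment> \<open>The passage from affine to smooth arguments is made one slot at a time;
    antisymmetry lets \<open>K1\<close> act on the other slot.\<close>
  have K2: "K g h = (\<lambda>x. 0)" if g: "g \<in> C" and h: "h \<in> C" for g h
  proof -
    have "K h g = (\<lambda>x. 0)"
    proof (rule derivation_zero_if_affine_zero[OF K_derivation[OF h] _ g])
      show "K h a = (\<lambda>x. 0)" if "a \<in> L" for a
        unfolding K_antisym[OF h affine_smooth[OF that]] by (simp add: K1[OF that h])
    qed
    then show ?thesis using K_antisym[OF g h] by simp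
  qed
  have fstR: "fst R [g] = (\<lambda>x. - H g x)" for g by (simp add: R(2) H_def)
  let ?T = "schouten_jacobi (P', \<lambda>fs x. 0) R"
  have "?T = zero_polydiffop"
  proof (rule polydiffop_zeroI)
    show "fst (?T) [] = (\<lambda>x. 0)"
      by (simp add: T BB P(1) P'(1) compatible_E_basic[OF comp])
    show "fst (?T) [g] = (\<lambda>x. 0)" for g
    proof -
      have "P' [\<lambda>x. - H g x] = (\<lambda>x. - P' [H g] x)"
      proof (cases "g \<in> C")
        case True
        then show ?thesis
          using derivation_lin[OF P'(2) smooth_const[of 0] derivation_closed[OF H_derivation], of g "-1"] by (simp add: P'0)
      next
        case False
        then show ?thesis by (simp add: H_def \<Lambda>_support E_support P'0)
      qed
      then show ?thesis
        by (simp add: T(2) R1_basic[OF P'(1)] R2 fstR H_comm)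
    qed
    show "fst (?T) [g, h] = (\<lambda>x. 0)" for g h
    proof (cases "g \<in> C \<and> h \<in> C")
      case True
      then show ?thesis
        using K2[of g h] R1_antisym[of "P' [h]" g] by (simp add: T(3) K_def)
    next
      case False
      have "\<And>h. fst R [\<lambda>x. 0, h] = (\<lambda>x. 0)" using R(8) by simp
      with False show ?thesis
        by (auto simp: T(3) R1_nonsmooth P'0 P'(3))
    qed
    show "length fs > 2 \<Longrightarrow> fst (?T) fs = (\<lambda>x. 0)" for fs by (rule T(4))
    show "snd (?T) [] = (\<lambda>x. 0)" by (simp add: T(5) R2 P'0)
    show "snd (?T) [g] = (\<lambda>x. 0)" for g by (simp add: T(6) R2 P'0)
    show "length fs > 1 \<Longrightarrow> snd (?T) fs = (\<lambda>x. 0)" for fs by (rule T(7))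
  qed
  then show "schouten_jacobi D1 (schouten_jacobi D2 (\<Lambda>, E)) = zero_polydiffop"
    by (simp add: D1 D2 R_def)
qed

section \<open>Homogeneity implies compatibility\<close>

text \<open>X^v(E(a)) = E(X^v(a)) is zero because X^v(a) is basic.\<close>

lemma E_affine_basic_if_commutes:
  assumes "\<And>X a. vb_section V X \<Longrightarrow> a \<in> L \<Longrightarrow> vert X (E [a]) = E [vert X a]"
    and "\<And>b. b \<in> B \<Longrightarrow> E [b] = (\<lambda>y. 0)" and a: "a \<in> L"
  shows "E [a] \<in> B"
  using assms vertical_lift_affine derivation_closed[OF E_derivation affine_smooth[OF a]]
  by (intro basic_if_vertical_zero) auto

text \<open>The condition is tested on generators. Two functions control basic pairs, a function
  with a section gives commutation with vertical lifts, and two sections bound the fibre degree of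
  \<Lambda>(da, da').\<close>

lemma homogeneous_imp_compatible:
  assumes hom: "affine_homogeneous_jacobi A \<Lambda> E"
  shows fibre_compatible
proof -
  have sec: "vertical_operator (vertical_lift A X, \<lambda>fs x. 0)" if "vb_section V X" for X
    by (intro vertical_lifts_vertical_operator vertical_lifts.section_lift that)
  have fn: "vertical_operator (function_lift A f, \<lambda>fs x. 0)" if "f \<in> C\<^sub>M" for f
    by (intro vertical_lifts_vertical_operator vertical_lifts.function_lift that)
  have fl: "function_lift A f [] = f \<circ> pr" "function_lift A f [g] = (\<lambda>y. 0)" for f g
    by (auto simp: function_lift_def fun_eq_iff)
  have vl: "vertical_lift A X [] = (\<lambda>y. 0)" for X
    by (auto simp: vertical_lift_def)
  have zero: "schouten_jacobi D1 (schouten_jacobi D2 (\<Lambda>, E)) = zero_polydiffop"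
    if "D1 \<in> vertical_lifts A" "D2 \<in> vertical_lifts A" for D1 D2
    using hom that by (simp add: affine_homogeneous_jacobi_def)
  note lifts = vertical_lifts.section_lift vertical_lifts.function_lift
  have one: "(\<lambda>p. 1) \<in> C\<^sub>M"
    by (rule smooth_functions_const[OF atlas_base])
  \<comment> \<open>Degree-zero part of the double bracket with two function lifts.\<close>
  have BB: "\<Lambda> [f, g] x + f x * E [g] x - g x * E [f] x = 0" if fg: "f \<in> B" "g \<in> B" for f g x
  proof -
    obtain f' g' where f': "f = f' \<circ> pr" "f' \<in> C\<^sub>M"
      and g': "g = g' \<circ> pr" "g' \<in> C\<^sub>M"
      using fg unfolding basic_functions_def by blast
    have "fst zero_polydiffop [] x = 0" by (simp add: zero_polydiffop_def)
    then show ?thesis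
      using bracket_twice(1)[OF fn[OF f'(2)] fn[OF g'(2)]]
        zero[OF lifts(2)[OF g'(2)] lifts(2)[OF f'(2)]] f'(1) g'(1) by (simp add: fl)
  qed
  \<comment> \<open>The Jacobi bracket of the constant 1 with \<open>b\<close> is
    \<open>E [b]\<close>, since derivations kill constants.\<close>
  have EB: "E [b] = (\<lambda>y. 0)" if b: "b \<in> B" for b
    using BB[OF basic_const[of 1] b] by (simp add: \<Lambda>_one[OF basic_smooth[OF b]] E_one fun_eq_iff)
  have \<Lambda>BB: "\<Lambda> [f, g] = (\<lambda>y. 0)" if "f \<in> B" "g \<in> B" for f g
    using BB[OF that] that by (simp add: EB fun_eq_iff)
  \<comment> \<open>Degree-one part, with the section in the inner and the function in the outer
    bracket. The choice \<open>f = 1\<close> isolates \<open>E\<close>, after which the remainder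
    concerns \<open>\<Lambda>\<close> alone.\<close>
  have comm: "vert X (\<Lambda> [f, g]) y - \<Lambda> [f, vert X g] y
      + f y * (vert X (E [g]) y - E [vert X g] y) = 0"
    if X: "vb_section V X" and f: "f \<in> B" for X f g y
  proof -
    obtain f' where f': "f = f' \<circ> pr" "f' \<in> C\<^sub>M"
      using f by (auto simp: basic_functions_def)
    have "fst zero_polydiffop [g] y = 0" by (simp add: zero_polydiffop_def)
    then show ?thesis
      using bracket_twice(2)[OF sec[OF X] fn[OF f'(2)], of g] zero[OF lifts(2)[OF f'(2)] lifts(1)[OF X]]
        f'(1) vertical_lift_basic[OF X f]
      by (simp add: fl vl bracket_once[OF sec[OF X]] \<Lambda>_zero E_zero)
  qed
  have EX: "vert X (E [g]) = E [vert X g]"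
    if X: "vb_section V X" and g: "g \<in> C" for X g
    using comm[OF X basic_const[of 1], of g] vertical_lift_basic[OF X basic_const[of 0]]
    by (simp add: \<Lambda>_one g derivation_closed[OF vertical_lift_derivation[OF X]] fun_eq_iff)
  have X\<Lambda>: "vert X (\<Lambda> [f, g]) = \<Lambda> [f, vert X g]"
    if X: "vb_section V X" and f: "f \<in> B" and g: "g \<in> C" for X f g
    using comm[OF X f, of g] EX[OF X g] by (simp add: fun_eq_iff)
  have EL: "E [a] \<in> B" if "a \<in> L" for a
    using E_affine_basic_if_commutes[OF EX EB that] affine_smooth by blast
  have BL: "\<Lambda> [b, a] \<in> B" if b: "b \<in> B" and a: "a \<in> L" for a b
    using X\<Lambda>[OF _ b affine_smooth[OF a]] \<Lambda>BB[OF b vertical_lift_affine[OF _ a]]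
    by (intro basic_if_vertical_zero derivation_closed[OF \<Lambda>_derivation[OF basic_smooth[OF b]]] affine_smooth[OF a]) auto
  have "\<Lambda> [a, a'] \<in> L" if a: "a \<in> L" and a': "a' \<in> L" for a a'
  proof (rule affine_if_vertical_basic)
    show \<Lambda>a: "\<Lambda> [a, a'] \<in> C"
      by (intro derivation_closed[OF \<Lambda>_derivation] affine_smooth a a')
    fix X assume X: "vb_section V X"
    let ?X = "\<lambda>f. vert X f"
    let ?R = "fst (schouten_jacobi (vertical_lift A X, \<lambda>fs x. 0) (\<Lambda>, E))"
    have R: "?R [g, h] = (\<lambda>y. ?X (\<Lambda> [g, h]) y - \<Lambda> [?X g, h] y - \<Lambda> [g, ?X h] y)" for g h
      by (rule bracket_once(3)[OF sec[OF X]])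
    have Xa: "?X a \<in> B" "?X a' \<in> B" by (auto intro: vertical_lift_affine X a a')
    have l1: "\<Lambda> [?X a, a'] \<in> B" by (rule BL[OF Xa(1) a'])
    have l2: "\<Lambda> [a, ?X a'] \<in> B" unfolding \<Lambda>_antisym[of a] by (rule basic_minus[OF BL[OF Xa(2) a]])
    have XL: "?X (\<Lambda> [a, a']) \<in> C" by (rule vertical_lift_smooth[OF X \<Lambda>a])
    have RC: "?R [a, a'] \<in> C"
      using smooth_lin[OF smooth_lin[OF XL basic_smooth[OF l1]] basic_smooth[OF l2], of "-1" "-1"] by (simp add: R)
    have Rb: "?R [b, g] = (\<lambda>y. 0)" if "b \<in> B" "g \<in> C" for b g
      using X\<Lambda>[OF X that] vertical_lift_basic[OF X that(1)] by (simp add: R \<Lambda>_zero)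
    \<comment> \<open>\<open>?R\<close> kills basic first arguments, so in the double bracket with
      two sections only \<open>vert Y (?R [a, a'])\<close> is left.\<close>
    have "?R [a, a'] \<in> B"
    proof (rule basic_if_vertical_zero[OF RC])
      fix Y assume Y: "vb_section V Y"
      have "fst zero_polydiffop [a, a'] = (\<lambda>y. 0)" by (simp add: zero_polydiffop_def)
      then show "vert Y (?R [a, a']) = (\<lambda>y. 0)"
        using bracket_twice(3)[OF sec[OF X] sec[OF Y], of a a'] zero[OF lifts(1)[OF Y] lifts(1)[OF X]]
          Rb[OF vertical_lift_affine[OF Y a] affine_smooth[OF a']]
          Rb[OF vertical_lift_affine[OF Y a'] affine_smooth[OF a]] by simp
    qed
    then have "(\<lambda>y. ?R [a, a'] y + \<Lambda> [?X a, a'] y + \<Lambda> [a, ?X a'] y) \<in> B"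
      by (intro basic_add l1 l2)
    then show "?X (\<Lambda> [a, a']) \<in> B" by (simp add: R)
  qed
  then show ?thesis using EB EL by (simp add: fibre_compatible_def)
qed

section \<open>Invariance of the vector field\<close>

lemma bracket_E:
  assumes D: "vertical_operator (P, \<lambda>fs x. 0)"
  defines "F \<equiv> schouten_jacobi (P, \<lambda>fs x. 0) (E, \<lambda>fs x. 0)"
  shows "fst F [] = (\<lambda>x. - E [P []] x)"
    and "fst F [g] = (\<lambda>x. P [E [g]] x - E [P [g]] x)"
    and "length fs > 1 \<Longrightarrow> fst F fs = (\<lambda>x. 0)"
    and "snd F fs = (\<lambda>x. 0)"
proof -
  note P0 = vertical_operator_zero[OF D]
  have E': "E gs = (\<lambda>x. 0)" if "length gs > 2" for gs using that by (intro E_support) auto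
  note G = schouten_jacobi_order1[of P E "\<lambda>fs x. 0", OF P0 E_zero refl vertical_operatorD(6)[OF D] E' refl,
      folded F_def, simplified]
  have short: "E [] = (\<lambda>x. 0)" "E [g, h] = (\<lambda>x. 0)" for g h
    by (simp_all add: E_support)
  show "fst F [] = (\<lambda>x. - E [P []] x)" by (simp add: G short P0)
  show "fst F [g] = (\<lambda>x. P [E [g]] x - E [P [g]] x)" by (simp add: G short)
  show "fst F fs = (\<lambda>x. 0)" if "length fs > 1"
  proof (cases "length fs > 2")
    case False
    with that obtain g h where "fs = [g, h]"
      by (cases fs; cases "tl fs"; cases "tl (tl fs)") auto
    then show ?thesis by (simp add: G short P0)
  qed (simp add: G)
  consider "fs = []" | g where "fs = [g]" | "length fs > 1"
    by (cases fs; cases "tl fs") auto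
  then show "snd F fs = (\<lambda>x. 0)"
    by cases (simp_all add: G P0)
qed

text \<open>Brackets of \<open>E\<close> with function lifts test that \<open>E\<close> kills basic
  functions, those with section lifts that \<open>E\<close> commutes with vertical lifts.\<close>

lemma compatible_iff_invariant:
  "fibre_compatible \<longleftrightarrow> affine_invariant A (E, \<lambda>fs x. 0) \<and> affine_bivector_field A \<Lambda>"
proof
  assume comp: fibre_compatible
  have "schouten_jacobi D (E, \<lambda>fs x. 0) = zero_polydiffop" if D: "D \<in> vertical_lifts A" for D
  proof -
    obtain P where P: "D = (P, \<lambda>fs x. 0)" "vertical_operator (P, \<lambda>fs x. 0)"
      by (rule vertical_lifts_obtain[OF D])
    show ?thesis
      unfolding P(1)
      by (rule polydiffop_zeroI)
        (simp_all add: bracket_E[OF P(2)] compatible_E_basic[OF comp] vertical_operatorD(1)[OF P(2)]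
          compatible_commutes_E[OF comp P(2)])
  qed
  then show "affine_invariant A (E, \<lambda>fs x. 0) \<and> affine_bivector_field A \<Lambda>"
    using comp by (simp add: affine_invariant_def affine_bivector_field_def fibre_compatible_def)
next
  assume asm: "affine_invariant A (E, \<lambda>fs x. 0) \<and> affine_bivector_field A \<Lambda>"
  then have zero: "schouten_jacobi D (E, \<lambda>fs x. 0) = zero_polydiffop" if "D \<in> vertical_lifts A" for D
    using that by (simp add: affine_invariant_def)
  have EB: "E [b] = (\<lambda>y. 0)" if b: "b \<in> B" for b
  proof -
    obtain f where f: "b = f \<circ> pr" "f \<in> C\<^sub>M"
      using b by (auto simp: basic_functions_def)
    note lift = vertical_lifts.function_lift[OF f(2)]
    have "function_lift A f [] = b" by (auto simp: function_lift_def f(1))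
    then have "(\<lambda>x. - E [b] x) = (\<lambda>x. 0)"
      using bracket_E(1)[OF vertical_lifts_vertical_operator[OF lift]] zero[OF lift]
      by (simp add: zero_polydiffop_def)
    then show ?thesis by (simp add: fun_eq_iff)
  qed
  have "vert X (E [a]) = E [vert X a]" if X: "vb_section V X" for X a
  proof -
    note lift = vertical_lifts.section_lift[OF X]
    show ?thesis
      using bracket_E(2)[OF vertical_lifts_vertical_operator[OF lift], of a] zero[OF lift]
      by (simp add: zero_polydiffop_def fun_eq_iff)
  qed
  then have "E [a] \<in> B" if "a \<in> L" for a
    using E_affine_basic_if_commutes[OF _ EB that] by blast
  then show fibre_compatible
    using EB asm by (simp add: fibre_compatible_def affine_bivector_field_def)
qed

section \<open>Strong affinity and the ideal of basic functions\<close>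

lemma compatible_imp_affine_jacobi:
  assumes comp: fibre_compatible and a: "a \<in> L" and b: "b \<in> L"
  shows "hamiltonian_vector_field \<Lambda> E a b \<in> L" "jacobi_bracket \<Lambda> E a b \<in> L"
proof -
  note E = compatible_E_affine[OF comp]
  have ham: "(\<lambda>y. \<Lambda> [a, b] y + E [b] y * a y) \<in> L"
    by (intro affine_add affine_mult_basic compatible_affine[OF comp] E a b)
  then show "hamiltonian_vector_field \<Lambda> E a b \<in> L"
    by (simp add: hamiltonian_vector_field_def mult.commute)
  have "(\<lambda>y. (\<Lambda> [a, b] y + E [b] y * a y) - E [a] y * b y) \<in> L"
    by (intro affine_diff ham affine_mult_basic E a b)
  then show "jacobi_bracket \<Lambda> E a b \<in> L"
    by (simp add: jacobi_bracket_def mult.commute)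
qed

text \<open>The hamiltonian field applied to b minus the bracket of a and b is b E(a). With b = 1
  this shows that E(a) is affine, and with b = E(a) that its square is affine, so E(a) is
  basic.\<close>

lemma compatible_iff_strongly_affine: "fibre_compatible \<longleftrightarrow> strongly_affine_jacobi A \<Lambda> E"
proof
  assume fibre_compatible
  then show "strongly_affine_jacobi A \<Lambda> E"
    using compatible_imp_affine_jacobi by (simp add: strongly_affine_jacobi_def affine_jacobi_def)
next
  assume str: "strongly_affine_jacobi A \<Lambda> E"
  have mult: "(\<lambda>y. b y * E [a] y) \<in> L" if a: "a \<in> L" and b: "b \<in> L" for a b
  proof -
    have "(\<lambda>y. hamiltonian_vector_field \<Lambda> E a b y - jacobi_bracket \<Lambda> E a b y) \<in> L"
      using str a b by (intro affine_diff) (auto simp: strongly_affine_jacobi_def affine_jacobi_def)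
    then show ?thesis by (simp add: hamiltonian_vector_field_def jacobi_bracket_def)
  qed
  show fibre_compatible
  proof (rule fibre_compatibleI)
    fix a assume a: "a \<in> L"
    have E: "E [a] \<in> L" using mult[OF a basic_affine[OF basic_const[of 1]]] by simp
    show "E [a] \<in> B" by (rule basic_if_square_affine[OF E mult[OF a E]])
  qed (use str in \<open>simp add: strongly_affine_jacobi_def\<close>)
qed

text \<open>E(a) is the bracket of the basic function 1 with a.\<close>

lemma compatible_iff_ideal:
  "fibre_compatible \<longleftrightarrow> affine_jacobi A \<Lambda> E \<and> lie_ideal L (jacobi_bracket \<Lambda> E) B"
proof
  assume comp: fibre_compatible
  have fa: "jacobi_bracket \<Lambda> E f a \<in> B" and af: "jacobi_bracket \<Lambda> E a f \<in> B" if f: "f \<in> B" and a: "a \<in> L" for f a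
  proof -
    have br: "(\<lambda>y. \<Lambda> [f, a] y + f y * E [a] y) \<in> B"
      by (intro basic_add basic_mult compatible_basic_affine[OF comp] compatible_E_affine[OF comp] f a)
    then show "jacobi_bracket \<Lambda> E f a \<in> B"
      by (simp add: jacobi_bracket_def compatible_E_basic[OF comp f])
    show "jacobi_bracket \<Lambda> E a f \<in> B"
      using basic_minus[OF br] \<Lambda>_antisym[of a f]
      by (simp add: jacobi_bracket_def compatible_E_basic[OF comp f])
  qed
  have "(\<lambda>x. f x + c * g x) \<in> B" if "f \<in> B" "g \<in> B" for f g c
    by (intro basic_add basic_mult basic_const that)
  then have "lie_ideal L (jacobi_bracket \<Lambda> E) B"
    using fa af basic_affine basic_const by (auto simp: lie_ideal_def)
  then show "affine_jacobi A \<Lambda> E \<and> lie_ideal L (jacobi_bracket \<Lambda> E) B"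
    using compatible_imp_affine_jacobi[OF comp] by (simp add: affine_jacobi_def)
next
  assume asm: "affine_jacobi A \<Lambda> E \<and> lie_ideal L (jacobi_bracket \<Lambda> E) B"
  have "E [a] \<in> B" if a: "a \<in> L" for a
  proof -
    have "jacobi_bracket \<Lambda> E (\<lambda>y. 1) a \<in> B"
      using asm a basic_const[of 1] by (simp add: lie_ideal_def)
    then show ?thesis
      by (simp add: jacobi_bracket_def \<Lambda>_one affine_smooth a E_one)
  qed
  with asm show fibre_compatible by (auto intro: fibre_compatibleI)
qed

section \<open>The section of the dual of \<open>A^+\<close> induced by E\<close>

text \<open>\<open>X\<^sub>0\<close> applies \<open>-E\<close> to an arbitrary extension of an affine function on a fibre; this is
  well defined by \<open>derivation_fibre_zero\<close>.\<close>

lemma compatible_imp_hat_section: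
  assumes comp: fibre_compatible
  shows "\<exists>X\<^sub>0. hat_section A X\<^sub>0 \<and> (\<forall>a\<in>L. \<forall>y. E [a] y = - X\<^sub>0 (pr y) (assoc_section A a (pr y)))"
proof -
  define ext where "ext p \<alpha> = (SOME a. a \<in> L \<and> assoc_section A a p = \<alpha>)" for p \<alpha>
  \<comment> \<open>The point of the fibre can be arbitrary because \<open>E\<close> of an affine
    function is basic.\<close>
  define X0 where "X0 p \<alpha> = - E [ext p \<alpha>] (SOME y. pr y = p)" for p \<alpha>
  note EL = compatible_E_affine[OF comp] and EB = compatible_E_basic[OF comp]
  have X0: "X0 (pr y) (assoc_section A a (pr y)) = - E [a] y" if a: "a \<in> L" for a y
  proof -
    let ?p = "pr y" and ?y = "SOME y'. pr y' = pr y"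
    have y: "pr ?y = ?p" by (rule someI[of _ y]) simp
    have e: "ext ?p (assoc_section A a ?p) \<in> L \<and> assoc_section A (ext ?p (assoc_section A a ?p)) ?p = assoc_section A a ?p"
      unfolding ext_def by (rule someI[of _ a]) (simp add: a)
    let ?e = "ext ?p (assoc_section A a ?p)"
    \<comment> \<open>The chosen extension and \<open>a\<close> agree on this fibre, so their
      difference vanishes there.\<close>
    have "E [\<lambda>y. ?e y + (-1) * a y] ?y = 0"
    proof (rule derivation_fibre_zero[OF E_derivation EB])
      show "(\<lambda>y. ?e y + (-1) * a y) \<in> L" using e a affine_diff by simp
      fix y' assume "pr y' = pr ?y"
      then have y': "y' \<in> ab_fibre A ?p" using y by (simp add: ab_fibre_def)
      have "restrict ?e (ab_fibre A ?p) y' = restrict a (ab_fibre A ?p) y'"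
        using e by (metis assoc_section_def)
      then show "?e y' + (-1) * a y' = 0"
        by (simp add: y')
    qed
    then have "E [?e] ?y = E [a] ?y"
      using derivation_lin[OF E_derivation affine_smooth affine_smooth[OF a], of ?e "-1"] e by simp
    then show ?thesis
      using basic_fibre[OF EL[OF a] y] by (simp add: X0_def)
  qed
  have X0_lin: "X0 p (restrict (\<lambda>y. \<alpha> y + c * \<beta> y) (ab_fibre A p)) = X0 p \<alpha> + c * X0 p \<beta>"
    if \<alpha>: "\<alpha> \<in> aff_fibre A p" and \<beta>: "\<beta> \<in> aff_fibre A p" for p \<alpha> \<beta> c
  proof -
    obtain a where a: "a \<in> L" "assoc_section A a p = \<alpha>" by (rule aff_fibre_extend[OF \<alpha>])
    obtain b where b: "b \<in> L" "assoc_section A b p = \<beta>" by (rule aff_fibre_extend[OF \<beta>])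
    obtain y where y: "pr y = p" using fibre_nonempty by blast
    have ab: "(\<lambda>y. a y + c * b y) \<in> L" by (intro affine_add affine_mult_basic basic_const a b)
    have "restrict (\<lambda>y. \<alpha> y + c * \<beta> y) (ab_fibre A p) = assoc_section A (\<lambda>y. a y + c * b y) p"
      unfolding a(2)[symmetric] b(2)[symmetric] by (auto simp: assoc_section_def)
    then show ?thesis
      using X0[OF ab, of y] X0[OF a(1), of y] X0[OF b(1), of y] a(2) b(2) y
        derivation_lin[OF E_derivation affine_smooth[OF a(1)] affine_smooth[OF b(1)]] by simp
  qed
  have smooth: "smooth_map_on (ab_base A) std_atlas U (\<lambda>p. X0 p (restrict (\<lambda>y. c + l (\<tau> y)) (ab_fibre A p)))"
    if triv: "ab_trivialization A U \<tau> \<theta>" and l: "linear l" for U \<tau> \<theta> c l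
  proof (rule smooth_real_mapI[OF atlas_base])
    fix p assume p: "p \<in> U"
    obtain W \<phi> \<psi> \<Psi> \<Theta> where W: "p \<in> W" "W \<subseteq> U" "bundle_chart A W \<phi> \<psi> \<tau> \<theta> \<Psi> \<Theta>"
      by (rule trivialization_bundle_chart[OF triv p])
    interpret bundle_chart A W \<phi> \<psi> \<tau> \<theta> \<Psi> \<Theta> by fact
    obtain \<beta> where \<beta>: "\<beta> \<in> C\<^sub>M" "\<beta> p = 1" and K: "supported_in \<beta> W"
      using bump_base[OF W(1)] by metis
    define a where "a y = \<beta> (pr y) * (c + l (snd (\<phi> (pr y), \<tau> y)))" for y
    have a: "a \<in> L"
      unfolding a_def
    proof (rule affine_cutoff[where G="\<lambda>z. c + l (snd z)", OF \<beta>(1) K])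
      show "smooth_on (\<phi> ` W \<times> UNIV) (\<lambda>z. c + l (snd z))"
        by (intro smooth_on_add smooth_on_const smooth_on_bounded_linear[OF _ linear_fin_euclidean_bounded[OF l]]
            smooth_on_snd smooth_on_id open_image_total)
      show "\<exists>k l'. linear l' \<and> (\<forall>u. c + l (snd (\<phi> q, u)) = k + l' u)" for q
        using l unfolding snd_conv by blast
    qed
    obtain g where g: "g \<in> C\<^sub>M" "E [a] = g \<circ> pr"
      using EL[OF a] by (auto simp: basic_functions_def)
    let ?\<alpha> = "\<lambda>q. restrict (\<lambda>y. c + l (\<tau> y)) (ab_fibre A q)"
    \<comment> \<open>One affine function \<open>a\<close> handles all nearby fibres at once, at the
      cost of the factor \<open>\<beta>\<close>, which is divided out later where it is
      nonzero.\<close>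
    have val: "\<beta> q * X0 q (?\<alpha> q) = - g q" if q: "q \<in> W" for q
    proof -
      obtain y where y: "pr y = q" using fibre_nonempty by blast
      have \<alpha>: "?\<alpha> q \<in> aff_fibre A q"
        using q by (intro aff_fibreI[OF q l, of _ c]) (auto simp: ab_fibre_def proj_\<Psi> \<tau>_\<Psi>)
      \<comment> \<open>The multiple by \<open>\<beta> q\<close> is written as
        \<open>1 + (\<beta> q - 1)\<close> times the function to fit the form of linearity in
        \<open>X0_lin\<close>.\<close>
      have "assoc_section A a q = restrict (\<lambda>y. ?\<alpha> q y + (\<beta> q - 1) * ?\<alpha> q y) (ab_fibre A q)"
        by (auto simp: assoc_section_def a_def ab_fibre_def fun_eq_iff algebra_simps)
      then have "X0 q (assoc_section A a q) = X0 q (?\<alpha> q) + (\<beta> q - 1) * X0 q (?\<alpha> q)"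
        using X0_lin[OF \<alpha> \<alpha>] by simp
      then show ?thesis
        using X0[OF a, of y] y g(2) by (simp add: algebra_simps)
    qed
    define N where "N = {q \<in> W. \<beta> q \<noteq> 0}"
    have "continuous_on UNIV \<beta>"
      using \<beta>(1) by (simp add: smooth_functions_def smooth_map_on_def)
    then have "open (\<beta> -` (- {0}))"
      by (simp add: continuous_on_open_vimage open_Compl)
    moreover have "N = W \<inter> \<beta> -` (- {0})" by (auto simp: N_def)
    ultimately have oN: "open N" using open_W by (simp only: open_Int)
    have N: "local_chart (ab_base A) N \<phi> \<psi>"
      by (rule local_chart_subset[OF chart_base oN]) (auto simp: N_def)
    have sub: "\<phi> ` N \<subseteq> \<phi> ` W" by (auto simp: N_def)
    have o: "open (\<phi> ` N)" using N by (simp add: local_chart_def)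
    have "smooth_on (\<phi> ` N) (\<lambda>x. - (inverse (\<beta> (\<psi> x)) * g (\<psi> x)))"
      by (intro smooth_intros o smooth_on_subset[OF smooth_base[OF \<beta>(1)] sub] smooth_on_subset[OF smooth_base[OF g(1)] sub])
        (auto simp: N_def base_inverse)
    then have "smooth_on (\<phi> ` N) (\<lambda>x. X0 (\<psi> x) (?\<alpha> (\<psi> x)))"
    proof (rule smooth_on_cong[OF o, rotated])
      fix x assume "x \<in> \<phi> ` N"
      then obtain q where q: "q \<in> W" "\<beta> q \<noteq> 0" "x = \<phi> q" by (auto simp: N_def)
      have "X0 q (?\<alpha> q) = inverse (\<beta> q) * (\<beta> q * X0 q (?\<alpha> q))"
        using q(2) by simp
      then show "- (inverse (\<beta> (\<psi> x)) * g (\<psi> x)) = X0 (\<psi> x) (?\<alpha> (\<psi> x))"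
        unfolding val[OF q(1)] by (simp add: q base_inverse)
    qed
    moreover have "p \<in> N" "N \<subseteq> U" using W \<beta>(2) by (auto simp: N_def)
    ultimately show "\<exists>Ua \<phi> \<psi>. p \<in> Ua \<and> Ua \<subseteq> U \<and> local_chart (ab_base A) Ua \<phi> \<psi> \<and>
        smooth_on (\<phi> ` Ua) (\<lambda>z. X0 (\<psi> z) (?\<alpha> (\<psi> z)))"
      using N by blast
  qed
  have "hat_section A X0"
    unfolding hat_section_def using X0_lin smooth by blast
  then show ?thesis using X0 by (intro exI[of _ X0]) simp
qed

text \<open>For the converse, the right-hand side of the formula depends on \<open>pr y\<close>
  only, so \<open>E [a]\<close> is constant on fibres.\<close>

lemma compatible_iff_hat_section:
  "fibre_compatible \<longleftrightarrow> affine_jacobi A \<Lambda> E \<and>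
    (\<exists>X\<^sub>0. hat_section A X\<^sub>0 \<and> (\<forall>a\<in>L. \<forall>y. E [a] y = - X\<^sub>0 (pr y) (assoc_section A a (pr y))))"
  (is "_ \<longleftrightarrow> ?r")
proof
  assume comp: fibre_compatible
  then show ?r
    using compatible_imp_affine_jacobi compatible_imp_hat_section by (simp add: affine_jacobi_def)
next
  assume asm: ?r
  then obtain X0 where X0: "\<And>a y. a \<in> L \<Longrightarrow> E [a] y = - X0 (pr y) (assoc_section A a (pr y))" by blast
  have "E [a] \<in> B" if a: "a \<in> L" for a
    by (rule basicI[OF derivation_closed[OF E_derivation affine_smooth[OF a]]]) (simp add: X0[OF a])
  with asm show fibre_compatible by (auto intro: fibre_compatibleI)
qed

end

theorem proposition5p6:
  fixes A :: "('a::{t2_space, second_countable_topology}, 'w::{t2_space, second_countable_topology},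
      'm::{t2_space, second_countable_topology}, 'e::fin_euclidean, 'f::fin_euclidean) affine_bundle"
    and \<Lambda> E :: "'a polyvector" and n :: nat
  assumes "is_affine_bundle A" and "ab_rank A = n" and "n > 0"
    and "jacobi_structure (ab_total A) \<Lambda> E"
  shows
    "(affine_homogeneous_jacobi A \<Lambda> E \<longleftrightarrow>
        affine_invariant A (E, \<lambda>fs x. 0) \<and> affine_bivector_field A \<Lambda>) \<and>
     (affine_homogeneous_jacobi A \<Lambda> E \<longleftrightarrow> strongly_affine_jacobi A \<Lambda> E) \<and>
     (affine_homogeneous_jacobi A \<Lambda> E \<longleftrightarrow>
        affine_jacobi A \<Lambda> E \<and>
        lie_ideal (affine_functions A) (jacobi_bracket \<Lambda> E) (basic_functions A)) \<and>
     (affine_homogeneous_jacobi A \<Lambda> E \<longleftrightarrow>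
        affine_jacobi A \<Lambda> E \<and>
        (\<exists>X\<^sub>0. hat_section A X\<^sub>0 \<and>
           (\<forall>a\<in>affine_functions A. \<forall>y. E [a] y = - X\<^sub>0 (ab_proj A y) (assoc_section A a (ab_proj A y)))))"
proof -
  interpret affine_bundle_fields A \<Lambda> E
    using assms by unfold_locales (auto simp: jacobi_structure_def)
  have "affine_homogeneous_jacobi A \<Lambda> E \<longleftrightarrow> fibre_compatible"
    using compatible_imp_homogeneous homogeneous_imp_compatible by blast
  then show ?thesis
    using compatible_iff_invariant compatible_iff_strongly_affine compatible_iff_ideal
      compatible_iff_hat_section by blast
qed

end
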